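(* Suppose $G$ is a minor of $H$ obtained by contraction of $r$ edges, deletion of $s$ vertices, and deletion of any number of edges, and let $A\in\mathcal{S}(G)$. If $A$ has the SMP and $\mathbf{m}(A)=(m_1,\dots,m_t)$, then there is a matrix $A'\in\mathcal{S}(H)$ having the SMP with $\mathbf{m}(A')$ obtained from $\mathbf{m}(A)$ by adding $r+s$ ones, with at most $s$ of these between $m_1$ and $m_t$. If in addition $A$ has the SSP, then $A'$ can be chosen to have the SSP, with $\operatorname{spec}(A)\subseteq\operatorname{spec}(A')$, all eigenvalues of $A'$ not in $\operatorname{spec}(A)$ simple and distinct, at most $s$ of these additional eigenvalues between $\lambda_{\min}(A)$ and $\lambda_{\max}(A)$, and $s$ of the additional simple eigenvalues (including all of those between $\lambda_{\min}(A)$ and $\lambda_{\max}(A)$) can be chosen arbitrarily.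
   Context: All matrices are real and symmetric, all graphs simple, undirected and finite. For a graph $G$ on vertices $\{1,\dots,n\}$, $\mathcal{S}(G)$ is the set of real symmetric $n\times n$ matrices $A=[a_{ij}]$ such that, for $i\neq j$, $a_{ij}\ne 0$ if and only if $ij$ is an edge of $G$ (diagonal entries are free). If $A$ has distinct eigenvalues $\lambda_1<\dots<\lambda_q$ with multiplicities $m_1,\dots,m_q$, its ordered multiplicity list is $\mathbf{m}(A)=(m_1,\dots,m_q)$. $\operatorname{spec}(A)$ is the spectrum of $A$ with multiplicities; $\lambda_{\min}(A),\lambda_{\max}(A)$ are the smallest and largest eigenvalues. Let $\circ$ be the entrywise product and $[A,X]=AX-XA$. $A$ has the Strong Spectral Property (SSP) if the only symmetric $X$ with $A\circ X=O$, $I\circ X=O$, $[A,X]=O$ is $X=O$. An $n\times n$ matrix $A$ has the Strong Multiplicity Property (SMP) if the only symmetric $X$ with $A\circ X=O$, $I\circ X=O$, $[A,X]=O$ and $\operatorname{tr}(A^iX)=0$ for $i=2,\dots,n-1$ is $X=O$. *)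

theory Defs
  imports
    Complex_Main
    "HOL-Library.Multiset"
    "HOL-Computational_Algebra.Polynomial"
    "Jordan_Normal_Form.Matrix"
    "Jordan_Normal_Form.Char_Poly"
    "Jordan_Normal_Form.Spectral_Radius"
begin

section \<open>Simple graphs and minors\<close>

datatype 'a graph = Graph (verts: "'a set") (edges: "'a set set")

definition simple_graph :: "'a graph \<Rightarrow> bool" where
  "simple_graph G \<longleftrightarrow> finite (verts G) \<and> verts G \<noteq> {} \<and>
     edges G \<subseteq> {{u, v} | u v. u \<in> verts G \<and> v \<in> verts G \<and> u \<noteq> v}"

definition delete_edge :: "'a graph \<Rightarrow> 'a set \<Rightarrow> 'a graph" where
  "delete_edge G e = Graph (verts G) (edges G - {e})"

definition delete_vertex :: "'a graph \<Rightarrow> 'a \<Rightarrow> 'a graph" where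
  "delete_vertex G v = Graph (verts G - {v}) {e \<in> edges G. v \<notin> e}"

text \<open>The vertex \<open>v\<close> is merged into \<open>u\<close>. The loop that \<open>{u, v}\<close> would become is dropped, and
  parallel edges are identified because edges are sets.\<close>

definition contract_edge :: "'a graph \<Rightarrow> 'a \<Rightarrow> 'a \<Rightarrow> 'a graph" where
  "contract_edge G u v =
     Graph (verts G - {v}) ((\<lambda>e. (\<lambda>x. if x = v then u else x) ` e) ` (edges G - {{u, v}}))"

text \<open>\<open>minor_ops H r s K\<close>: the graph \<open>K\<close> arises from \<open>H\<close> by a sequence, in any order, of
  exactly \<open>r\<close> edge contractions, exactly \<open>s\<close> vertex deletions and any number of edge
  deletions.\<close>

inductive minor_ops :: "'a graph \<Rightarrow> nat \<Rightarrow> nat \<Rightarrow> 'a graph \<Rightarrow> bool" for H where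
  start: "minor_ops H 0 0 H"
| contraction: "minor_ops H r s K \<Longrightarrow> {u, v} \<in> edges K \<Longrightarrow> minor_ops H (Suc r) s (contract_edge K u v)"
| vertex_deletion: "minor_ops H r s K \<Longrightarrow> v \<in> verts K \<Longrightarrow> minor_ops H r (Suc s) (delete_vertex K v)"
| edge_deletion: "minor_ops H r s K \<Longrightarrow> e \<in> edges K \<Longrightarrow> minor_ops H r s (delete_edge K e)"

definition graph_iso :: "'a graph \<Rightarrow> 'b graph \<Rightarrow> bool" where
  "graph_iso K G \<longleftrightarrow>
     (\<exists>f. bij_betw f (verts K) (verts G) \<and> edges G = (\<lambda>e. f ` e) ` edges K)"

definition minor_by :: "nat \<Rightarrow> nat \<Rightarrow> 'b graph \<Rightarrow> 'a graph \<Rightarrow> bool" where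
  "minor_by r s G H \<longleftrightarrow> (\<exists>K. minor_ops H r s K \<and> graph_iso K G)"

section \<open>Symmetric matrices of a graph\<close>

text \<open>Matrix indices start at 0, so the vertex set of a graph with \<open>n\<close> vertices is taken to be
  \<open>{0..<n}\<close> instead of \<open>{1,\<dots>,n}\<close>. The following definition is meant for such graphs.\<close>

definition sym_mats :: "nat graph \<Rightarrow> real mat set" where
  "sym_mats G = {A \<in> carrier_mat (card (verts G)) (card (verts G)).
     transpose_mat A = A \<and>
     (\<forall>i < card (verts G). \<forall>j < card (verts G). i \<noteq> j \<longrightarrow> (A $$ (i, j) \<noteq> 0 \<longleftrightarrow> {i, j} \<in> edges G))}"

section \<open>Spectrum and ordered multiplicity list\<close>

definition spec :: "real mat \<Rightarrow> real multiset" where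
  "spec A = proots (char_poly A)"

definition mult_list :: "real mat \<Rightarrow> nat list" where
  "mult_list A = map (count (spec A)) (sorted_list_of_set (spectrum A))"

definition lambda_min :: "real mat \<Rightarrow> real" where
  "lambda_min A = Min (spectrum A)"

definition lambda_max :: "real mat \<Rightarrow> real" where
  "lambda_max A = Max (spectrum A)"

text \<open>\<open>adds_ones k s ms ms'\<close>: the list \<open>ms'\<close> is obtained from \<open>ms\<close> by inserting \<open>k\<close> ones, at
  most \<open>s\<close> of them between the first and the last entry of \<open>ms\<close>. Here \<open>f\<close> sends the position of
  an entry of \<open>ms\<close> to its position in \<open>ms'\<close>; the remaining positions hold the inserted ones.\<close>

definition adds_ones :: "nat \<Rightarrow> nat \<Rightarrow> nat list \<Rightarrow> nat list \<Rightarrow> bool" where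
  "adds_ones k s ms ms' \<longleftrightarrow> length ms' = length ms + k \<and>
     (\<exists>f. strict_mono_on {..<length ms} f \<and>
          f ` {..<length ms} \<subseteq> {..<length ms'} \<and>
          (\<forall>i < length ms. ms' ! f i = ms ! i) \<and>
          (\<forall>j \<in> {..<length ms'} - f ` {..<length ms}. ms' ! j = 1) \<and>
          card {j \<in> {..<length ms'} - f ` {..<length ms}. f 0 < j \<and> j < f (length ms - 1)} \<le> s)"

section \<open>Strong properties\<close>

definition entrywise_prod :: "real mat \<Rightarrow> real mat \<Rightarrow> real mat" where
  "entrywise_prod A B = mat (dim_row A) (dim_col A) (\<lambda>ij. A $$ ij * B $$ ij)"

definition commutator :: "real mat \<Rightarrow> real mat \<Rightarrow> real mat" where
  "commutator A X = A * X - X * A"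

definition trace :: "real mat \<Rightarrow> real" where
  "trace A = (\<Sum>i < dim_row A. A $$ (i, i))"

definition SSP :: "real mat \<Rightarrow> bool" where
  "SSP A \<longleftrightarrow> (let n = dim_row A in
     \<forall>X \<in> carrier_mat n n.
       transpose_mat X = X \<and>
       entrywise_prod A X = 0\<^sub>m n n \<and>
       entrywise_prod (1\<^sub>m n) X = 0\<^sub>m n n \<and>
       commutator A X = 0\<^sub>m n n
       \<longrightarrow> X = 0\<^sub>m n n)"

definition SMP :: "real mat \<Rightarrow> bool" where
  "SMP A \<longleftrightarrow> (let n = dim_row A in
     \<forall>X \<in> carrier_mat n n.
       transpose_mat X = X \<and>
       entrywise_prod A X = 0\<^sub>m n n \<and>
       entrywise_prod (1\<^sub>m n) X = 0\<^sub>m n n \<and>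
       commutator A X = 0\<^sub>m n n \<and>
       (\<forall>i \<in> {2..n - 1}. trace ((A ^\<^sub>m i) * X) = 0)
       \<longrightarrow> X = 0\<^sub>m n n)"

end

(*
  A symmetric matrix is written in an eigenbasis as U^T diag(d) U, and one moves the orthogonal
  matrix U and, for the SMP, also the distinct eigenvalues. A strong property says that near the
  given matrix these motions act transversally to the pattern of the graph. Transversality is
  exploited by compactness instead of the implicit function theorem: one minimises
  |residual| + kappa * |displacement|. If the residual at the minimiser did not vanish, its
  normalised limit as kappa tends to 0 would be a nonzero matrix X contradicting the strong
  property. The same limit argument shows that the new matrix inherits the property.

  Minor operations are undone one at a time. An edge deletion is undone by prescribing small
  values on the new edges. A vertex deletion is undone by a direct sum with the chosen eigenvalue,
  followed by adding edges. A contraction is undone by a direct sum with a huge eigenvalue t: in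
  the basis rotated by 45 degrees in the plane of the two split vertices, the wanted pattern is a
  system of linear equations relating the last row to the row of the contracted vertex, and it is
  solvable near the direct sum since the coupling is of order 1/t.
*)

theory Submission
  imports Defs "HOL-Analysis.Function_Topology"
begin

section \<open>Orthogonal matrices and diagonal forms\<close>

text \<open>The obstacle is uniformity: a limit argument contradicts only estimates that concern all
  candidates near the given matrix. Each such estimate is therefore stated for all small
  \<open>e\<close> and all admissible data at once, and is proved by refuting a sequence of
  counterexamples with \<open>e k\<close> tending to 0. The penalty weight is \<open>e\<close> and
  the starting residual has order \<open>e\<^sup>2\<close>. So the minimiser stays within
  O(\<open>e\<close>) of the start, and its residual is orthogonal to every infinitesimal motion up
  to O(\<open>e\<close>) times its own norm, which disappears in the normalised limit. For a
  contraction there is no limit matrix, because \<open>t\<close> is unbounded. The constraints on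
  the last column start with an error of order 1 and need the weight \<open>e\<^sup>2\<close> to
  make the starting residual small enough. The dual matrix is then rescaled by
  \<open>e\<^sup>2\<close> in that column, so the coupling 1 / \<open>t\<close> has to be negligible
  against \<open>e\<^sup>2\<close>; \<open>t = 1 / e ^ 4\<close> leaves room to spare. The two
  properties differ only in the set of eigenvalues that may be shifted: none for the SSP, all of
  them for the SMP. This is why one proof serves both.\<close>

definition orth :: "nat \<Rightarrow> (nat \<Rightarrow> nat \<Rightarrow> real) \<Rightarrow> bool" where
  "orth m U \<longleftrightarrow> (\<forall>i<m. \<forall>j<m. (\<Sum>k<m. U k i * U k j) = (if i = j then 1 else 0))"

text \<open>Matrices are functions of two natural numbers because this function space carries a
  product topology in which Tychonoff's theorem applies. The rows of \<open>U\<close> are the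
  eigenvectors, so moving them is a multiplication of \<open>U\<close> from the left.\<close>

definition diag_form :: "nat \<Rightarrow> (nat \<Rightarrow> nat \<Rightarrow> real) \<Rightarrow> (nat \<Rightarrow> real) \<Rightarrow> nat \<Rightarrow> nat \<Rightarrow> real" where
  "diag_form m U d i j = (\<Sum>k<m. d k * U k i * U k j)"

definition conj_entry :: "nat \<Rightarrow> (nat \<Rightarrow> nat \<Rightarrow> real) \<Rightarrow> (nat \<Rightarrow> nat \<Rightarrow> real) \<Rightarrow> nat \<Rightarrow> nat \<Rightarrow> real" where
  "conj_entry m U X p q = (\<Sum>i<m. \<Sum>j<m. U p i * X i j * U q j)"

definition givens :: "nat \<Rightarrow> nat \<Rightarrow> (nat \<Rightarrow> nat \<Rightarrow> real) \<Rightarrow> real \<Rightarrow> nat \<Rightarrow> nat \<Rightarrow> real" where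
  "givens p q U s k j = (if k = p then cos s * U p j + sin s * U q j
     else if k = q then cos s * U q j - sin s * U p j else U k j)"

lemma diag_form_sym: "diag_form m U d i j = diag_form m U d j i"
  unfolding diag_form_def by (simp add: mult_ac)

lemma conj_entry_sym:
  assumes "\<And>i j. i < m \<Longrightarrow> j < m \<Longrightarrow> X i j = X j i"
  shows "conj_entry m U X p q = conj_entry m U X q p"
proof -
  have "conj_entry m U X p q = (\<Sum>j<m. \<Sum>i<m. U p i * X i j * U q j)"
    unfolding conj_entry_def by (rule sum.swap)
  also have "\<dots> = conj_entry m U X q p"
    unfolding conj_entry_def using assms by (intro sum.cong refl) (auto simp: mult_ac)
  finally show ?thesis .
qed

lemma orth_rows:
  assumes "orth m U" "i < m" "j < m"
  shows "(\<Sum>k<m. U i k * U j k) = (if i = j then 1 else 0)"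
proof -
  define M where "M = mat m m (\<lambda>(i, j). U i j)"
  have M: "M \<in> carrier_mat m m" and MT: "transpose_mat M \<in> carrier_mat m m"
    by (auto simp: M_def)
  have "transpose_mat M * M = 1\<^sub>m m"
    using assms(1) by (intro eq_matI) (auto simp: M_def orth_def scalar_prod_def atLeast0LessThan)
  then have "M * transpose_mat M = 1\<^sub>m m"
    using mat_mult_left_right_inverse[OF MT M] by simp
  then have "(M * transpose_mat M) $$ (i, j) = (if i = j then 1 else 0)"
    using assms by simp
  then show ?thesis
    using assms by (simp add: M_def scalar_prod_def atLeast0LessThan)
qed

lemma orth_abs_le_1:
  assumes "orth m U" "i < m" "j < m"
  shows "\<bar>U i j\<bar> \<le> 1"
proof -
  have "(U i j)\<^sup>2 \<le> (\<Sum>k<m. (U k j)\<^sup>2)"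
    using assms by (intro member_le_sum) auto
  also have "\<dots> = 1"
    using assms unfolding orth_def by (simp add: power2_eq_square)
  finally show ?thesis by (simp add: abs_square_le_1)
qed

lemma sum_split2:
  fixes f :: "nat \<Rightarrow> 'a::comm_monoid_add"
  assumes "p < m" "q < m" "p \<noteq> q"
  shows "(\<Sum>k<m. f k) = f p + f q + (\<Sum>k\<in>{..<m} - {p, q}. f k)"
proof -
  have "{..<m} - {p} - {q} = {..<m} - {p, q}" by auto
  then show ?thesis
    using assms by (simp add: sum.remove[of "{..<m}" p] sum.remove[of "{..<m} - {p}" q] add.assoc)
qed

lemma orth_givens:
  assumes "orth m U" "p < m" "q < m" "p \<noteq> q"
  shows "orth m (givens p q U s)"
proof -
  have "(\<Sum>k<m. givens p q U s k i * givens p q U s k j) = (\<Sum>k<m. U k i * U k j)" for i j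
  proof -
    have rot: "(c * x + z * y) * (c * x' + z * y') + (c * y - z * x) * (c * y' - z * x')
        = (z\<^sup>2 + c\<^sup>2) * (x * x' + y * y')" for c z x y x' y' :: real
      by (simp add: power2_eq_square algebra_simps)
    have "givens p q U s p a = cos s * U p a + sin s * U q a"
      "givens p q U s q a = cos s * U q a - sin s * U p a" for a
      using assms(4) by (simp_all add: givens_def)
    then have pq: "givens p q U s p i * givens p q U s p j + givens p q U s q i * givens p q U s q j
      = U p i * U p j + U q i * U q j"
      by (simp only: rot sin_cos_squared_add mult_1)
    have "(\<Sum>k\<in>{..<m} - {p, q}. givens p q U s k i * givens p q U s k j)
      = (\<Sum>k\<in>{..<m} - {p, q}. U k i * U k j)"
      by (intro sum.cong refl) (auto simp: givens_def)
    with pq show ?thesis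
      unfolding sum_split2[OF assms(2-4)] by (simp only:)
  qed
  then show ?thesis using assms(1) unfolding orth_def by simp
qed

lemma givens_0 [simp]: "givens p q U 0 = U"
  by (auto simp: givens_def fun_eq_iff)

text \<open>Rotations of two rows span the tangent space of the orthogonal group, so these
  derivatives are all the isospectral directions. The factor \<open>d p - d q\<close> reflects that
  a rotation inside an eigenspace does not move the matrix.\<close>

lemma diag_form_givens_deriv:
  assumes "p < m" "q < m" "p \<noteq> q"
  shows "((\<lambda>s. diag_form m (givens p q U s) d i j) has_real_derivative
    (d p - d q) * (U p i * U q j + U q i * U p j)) (at 0)"
proof -
  have eq: "diag_form m (givens p q U s) d i j =
      d p * (cos s * U p i + sin s * U q i) * (cos s * U p j + sin s * U q j)
    + d q * (cos s * U q i - sin s * U p i) * (cos s * U q j - sin s * U p j)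
    + (\<Sum>k\<in>{..<m} - {p, q}. d k * U k i * U k j)" for s
    using assms unfolding diag_form_def by (simp add: sum_split2[of p m q] givens_def)
  show ?thesis
    unfolding eq by (auto intro!: derivative_eq_intros simp: algebra_simps)
qed

lemma sum_swap4:
  "(\<Sum>p\<in>P. \<Sum>q\<in>Q. \<Sum>a\<in>A. \<Sum>b\<in>B. f p q a b :: 'a::comm_monoid_add) = (\<Sum>a\<in>A. \<Sum>b\<in>B. \<Sum>p\<in>P. \<Sum>q\<in>Q. f p q a b)"
proof -
  have "(\<Sum>p\<in>P. \<Sum>q\<in>Q. \<Sum>a\<in>A. \<Sum>b\<in>B. f p q a b) = (\<Sum>p\<in>P. \<Sum>a\<in>A. \<Sum>q\<in>Q. \<Sum>b\<in>B. f p q a b)"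
    by (intro sum.cong refl sum.swap)
  also have "\<dots> = (\<Sum>a\<in>A. \<Sum>p\<in>P. \<Sum>q\<in>Q. \<Sum>b\<in>B. f p q a b)"
    by (rule sum.swap)
  also have "\<dots> = (\<Sum>a\<in>A. \<Sum>p\<in>P. \<Sum>b\<in>B. \<Sum>q\<in>Q. f p q a b)"
    by (intro sum.cong refl sum.swap)
  also have "\<dots> = (\<Sum>a\<in>A. \<Sum>b\<in>B. \<Sum>p\<in>P. \<Sum>q\<in>Q. f p q a b)"
    by (intro sum.cong refl sum.swap)
  finally show ?thesis .
qed

lemma conj_back:
  assumes "orth m U" "i < m" "j < m"
  shows "(\<Sum>p<m. \<Sum>q<m. U p i * conj_entry m U X p q * U q j) = X i j"
proof -
  have "(\<Sum>p<m. \<Sum>q<m. U p i * conj_entry m U X p q * U q j)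
    = (\<Sum>p<m. \<Sum>q<m. \<Sum>a<m. \<Sum>b<m. (U p i * U p a) * X a b * (U q b * U q j))"
    unfolding conj_entry_def by (simp add: sum_distrib_left sum_distrib_right mult_ac)
  also have "\<dots> = (\<Sum>a<m. \<Sum>b<m. \<Sum>p<m. \<Sum>q<m. (U p i * U p a) * X a b * (U q b * U q j))"
    by (rule sum_swap4)
  also have "\<dots> = (\<Sum>a<m. \<Sum>b<m. (\<Sum>p<m. U p i * U p a) * X a b * (\<Sum>q<m. U q b * U q j))"
    by (simp add: sum_distrib_left sum_distrib_right mult_ac)
  also have "\<dots> = (\<Sum>a<m. \<Sum>b<m. (if i = a then 1 else 0) * X a b * (if b = j then 1 else 0))"
    using assms unfolding orth_def by (intro sum.cong refl) auto
  also have "\<dots> = X i j"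
    using assms by (simp add: if_distrib[of "\<lambda>x. x * _"] if_distrib[of "\<lambda>x. _ * x"] sum.delta cong: if_cong)
  finally show ?thesis .
qed

section \<open>Compactness of the orthogonal group\<close>

lemma compact_box:
  fixes K :: "'a \<Rightarrow> ('b::topological_space) set"
  assumes "\<And>i. compact (K i)"
  shows "compact {x. \<forall>i. x i \<in> K i}"
proof -
  have "compactin (product_topology (\<lambda>_. euclidean) UNIV) (PiE UNIV K)"
    using assms by (subst compactin_PiE) (auto simp: compactin_euclidean_iff)
  moreover have "PiE UNIV K = {x. \<forall>i. x i \<in> K i}"
    by (auto simp: PiE_def Pi_def)
  ultimately show ?thesis
    by (simp add: euclidean_product_topology compactin_euclidean_iff)
qed

lemma continuous_on_entry [continuous_intros]:
  "continuous_on S (\<lambda>x :: 'a \<Rightarrow> 'b \<Rightarrow> 'c::topological_space. x i j)"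
  by (rule continuous_on_product_then_coordinatewise[OF continuous_on_product_then_coordinatewise[OF continuous_on_id]])

text \<open>\<open>orth\<close> says nothing about entries outside the index range. Fixing them to 0
  makes the set a closed subset of a Tychonoff product of compact intervals and points.\<close>

lemma compact_orth: "compact {U. orth m U \<and> (\<forall>i j. \<not> (i < m \<and> j < m) \<longrightarrow> U i j = 0)}"
proof -
  define B where "B = {U :: nat \<Rightarrow> nat \<Rightarrow> real. \<forall>i. U i \<in> {v. \<forall>j. v j \<in> (if i < m \<and> j < m then {-1..1} else {0})}}"
  have "compact B"
    unfolding B_def by (intro compact_box) auto
  moreover have "closed {U. orth m U}"
  proof -
    have eq: "{U. orth m U} = (\<Inter>i\<in>{..<m}. \<Inter>j\<in>{..<m}. {U. (\<Sum>k<m. U k i * U k j) = (if i = j then 1 else (0::real))})"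
      by (auto simp: orth_def)
    show ?thesis
      unfolding eq by (intro closed_INT ballI closed_Collect_eq continuous_intros)
  qed
  moreover have "{U. orth m U \<and> (\<forall>i j. \<not> (i < m \<and> j < m) \<longrightarrow> U i j = 0)} = B \<inter> {U. orth m U}"
    using orth_abs_le_1 by (auto simp: B_def abs_le_iff split: if_splits)
  ultimately show ?thesis by (simp add: compact_Int_closed)
qed


section \<open>Diagonalisation of symmetric matrices\<close>

lemma orth_one: "orth m (\<lambda>i j. if i = j \<and> i < m then 1 else 0)"
proof -
  have "(\<Sum>k<m. (if k = i \<and> k < m then 1 else 0) * (if k = j \<and> k < m then 1 else 0))
     = (if i = j then 1 else (0::real))" if "i < m" "j < m" for i j
  proof -
    have "(\<Sum>k<m. (if k = i \<and> k < m then 1 else 0) * (if k = j \<and> k < m then 1 else 0))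
      = (\<Sum>k<m. if k = i then (if i = j then 1 else (0::real)) else 0)"
      using that by (intro sum.cong) auto
    then show ?thesis using that by simp
  qed
  then show ?thesis unfolding orth_def by simp
qed

text \<open>Cyclicity of the trace: the left side is the trace of diag(e) V X V^T, the right side is
  the Frobenius product of X with V^T diag(e) V.\<close>

lemma sum_conj_entry_diag: "(\<Sum>k<m. e k * conj_entry m V X k k) = (\<Sum>i<m. \<Sum>j<m. X i j * diag_form m V e i j)"
proof -
  have "(\<Sum>k<m. e k * conj_entry m V X k k) = (\<Sum>k<m. \<Sum>i<m. \<Sum>j<m. X i j * (e k * V k i * V k j))"
    unfolding conj_entry_def sum_distrib_left by (simp add: mult_ac)
  also have "\<dots> = (\<Sum>i<m. \<Sum>k<m. \<Sum>j<m. X i j * (e k * V k i * V k j))"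
    by (rule sum.swap)
  also have "\<dots> = (\<Sum>i<m. \<Sum>j<m. \<Sum>k<m. X i j * (e k * V k i * V k j))"
    by (intro sum.cong refl sum.swap)
  finally show ?thesis unfolding diag_form_def sum_distrib_left .
qed

lemma conj_entry_givens_deriv:
  assumes "p < m" "q < m" "p \<noteq> q" and sym: "\<And>i j. i < m \<Longrightarrow> j < m \<Longrightarrow> X i j = X j i"
  shows "((\<lambda>s. \<Sum>k<m. e k * conj_entry m (givens p q U s) X k k) has_real_derivative
    2 * (e p - e q) * conj_entry m U X p q) (at 0)"
proof -
  have "(\<Sum>i<m. \<Sum>j<m. X i j * ((e p - e q) * (U p i * U q j + U q i * U p j)))
    = (\<Sum>i<m. \<Sum>j<m. (e p - e q) * (U p i * X i j * U q j) + (e p - e q) * (U q i * X i j * U p j))"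
    by (simp add: algebra_simps)
  also have "\<dots> = (e p - e q) * conj_entry m U X p q + (e p - e q) * conj_entry m U X q p"
    unfolding conj_entry_def by (simp add: sum.distrib sum_distrib_left)
  also have "\<dots> = 2 * (e p - e q) * conj_entry m U X p q"
    using conj_entry_sym[of m X U q p] sym by simp
  finally have fin: "(\<Sum>i<m. \<Sum>j<m. X i j * ((e p - e q) * (U p i * U q j + U q i * U p j)))
    = 2 * (e p - e q) * conj_entry m U X p q" .
  show ?thesis
    unfolding sum_conj_entry_diag fin[symmetric]
    by (intro DERIV_sum DERIV_cmult diag_form_givens_deriv assms(1-3))
qed

lemma givens_outside:
  assumes "p < m" "q < m" "\<forall>i j. \<not> (i < m \<and> j < m) \<longrightarrow> U i j = 0"
  shows "\<forall>i j. \<not> (i < m \<and> j < m) \<longrightarrow> givens p q U s i j = 0"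
  using assms by (auto simp: givens_def)

text \<open>A variational proof: the trace of diag(0, ..., m - 1) U A U^T attains a maximum on the
  compact orthogonal group, and there its derivative along every rotation of two rows vanishes. That
  derivative is \<open>2 * (real p - real q)\<close> times an off-diagonal entry of the conjugated
  matrix. Since the weights are distinct, the conjugated matrix is diagonal.\<close>

theorem spectral_theorem:
  assumes sym: "\<And>i j. i < m \<Longrightarrow> j < m \<Longrightarrow> A i j = A j i"
  obtains Q d where "orth m Q" "\<And>i j. i < m \<Longrightarrow> j < m \<Longrightarrow> A i j = diag_form m Q d i j"
proof -
  let ?S = "{U. orth m U \<and> (\<forall>i j. \<not> (i < m \<and> j < m) \<longrightarrow> U i j = 0)}"
  define F where "F U = (\<Sum>k<m. real k * conj_entry m U A k k)" for U
  have ne: "?S \<noteq> {}" using orth_one[of m] by (auto intro!: exI[of _ "\<lambda>i j. if i = j \<and> i < m then 1 else 0"] split: if_splits)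
  have "continuous_on ?S F"
    unfolding F_def conj_entry_def by (intro continuous_intros)
  from continuous_attains_sup[OF compact_orth ne this]
  obtain U where U: "U \<in> ?S" and "\<forall>V\<in>?S. F V \<le> F U" ..
  then have max: "\<And>V. V \<in> ?S \<Longrightarrow> F V \<le> F U" by blast
  have off: "conj_entry m U A p q = 0" if pq: "p < m" "q < m" "p \<noteq> q" for p q
  proof -
    have "((\<lambda>s. F (givens p q U s)) has_real_derivative 2 * (real p - real q) * conj_entry m U A p q) (at 0)"
      unfolding F_def by (rule conj_entry_givens_deriv[OF pq sym])
    moreover have "F (givens p q U s) \<le> F (givens p q U 0)" for s
      unfolding givens_0 using U orth_givens[of m U p q s] givens_outside[of p m q U s] pq by (intro max) auto
    ultimately have "2 * (real p - real q) * conj_entry m U A p q = 0"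
      by (intro DERIV_local_max[of _ _ 0 1]) auto
    then show ?thesis using pq by simp
  qed
  have "A i j = diag_form m U (\<lambda>k. conj_entry m U A k k) i j" if "i < m" "j < m" for i j
  proof -
    have "A i j = (\<Sum>p<m. \<Sum>q<m. U p i * conj_entry m U A p q * U q j)"
      using U that conj_back[of m U i j A] by simp
    also have "\<dots> = (\<Sum>p<m. \<Sum>q<m. if p = q then U p i * conj_entry m U A p p * U p j else 0)"
      using off by (intro sum.cong refl) auto
    also have "\<dots> = diag_form m U (\<lambda>k. conj_entry m U A k k) i j"
      unfolding diag_form_def by (intro sum.cong refl) (auto simp: mult_ac)
    finally show ?thesis .
  qed
  then show thesis using that U by blast
qed

section \<open>Near-critical points\<close>

text \<open>Where the residual is nonzero, its norm is differentiable, and the derivative is the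
  inner product of residual and velocity divided by the norm. A function that drops by at most
  \<open>a * \<bar>s\<bar>\<close> on both sides of 0 has slope between \<open>- a\<close> and
  \<open>a\<close>. Multiplying by the norm gives a form that is trivially true where the residual
  vanishes.\<close>

lemma sqrt_sum_near_critical:
  fixes \<rho> :: "'j \<Rightarrow> real \<Rightarrow> real"
  assumes "finite J" and deriv: "\<And>j. j \<in> J \<Longrightarrow> (\<rho> j has_real_derivative \<rho>' j) (at 0)"
    and "\<eta> > 0"
    and le: "\<And>s. \<bar>s\<bar> < \<eta> \<Longrightarrow> sqrt (\<Sum>j\<in>J. (\<rho> j 0)\<^sup>2) \<le> sqrt (\<Sum>j\<in>J. (\<rho> j s)\<^sup>2) + a * \<bar>s\<bar>"
  shows "\<bar>\<Sum>j\<in>J. \<rho> j 0 * \<rho>' j\<bar> \<le> a * sqrt (\<Sum>j\<in>J. (\<rho> j 0)\<^sup>2)"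
proof (cases "(\<Sum>j\<in>J. (\<rho> j 0)\<^sup>2) = 0")
  case True
  then have "\<forall>j\<in>J. \<rho> j 0 = 0"
    using assms(1) by (simp add: sum_nonneg_eq_0_iff)
  then show ?thesis by simp
next
  case False
  define g where "g s = sqrt (\<Sum>j\<in>J. (\<rho> j s)\<^sup>2)" for s
  define D where "D = (\<Sum>j\<in>J. \<rho> j 0 * \<rho>' j) / g 0"
  have pos: "(\<Sum>j\<in>J. (\<rho> j 0)\<^sup>2) > 0"
    using False by (simp add: sum_nonneg order.strict_iff_order)
  then have g0: "g 0 > 0" by (simp add: g_def)
  have "((\<lambda>s. \<Sum>j\<in>J. (\<rho> j s)\<^sup>2) has_real_derivative (\<Sum>j\<in>J. 2 * (\<rho> j 0 * \<rho>' j))) (at 0)"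
    by (rule DERIV_sum) (auto intro!: derivative_eq_intros deriv)
  from DERIV_chain2[where f = sqrt and g = "\<lambda>s. \<Sum>j\<in>J. (\<rho> j s)\<^sup>2", OF DERIV_real_sqrt[OF pos] this]
  have "(g has_real_derivative (inverse (sqrt (\<Sum>j\<in>J. (\<rho> j 0)\<^sup>2)) / 2) * (\<Sum>j\<in>J. 2 * (\<rho> j 0 * \<rho>' j))) (at 0)"
    unfolding g_def .
  moreover have "(\<Sum>j\<in>J. 2 * (\<rho> j 0 * \<rho>' j)) = 2 * (\<Sum>j\<in>J. \<rho> j 0 * \<rho>' j)"
    by (rule sum_distrib_left[symmetric])
  ultimately have D: "(g has_real_derivative D) (at 0)"
    by (simp only: D_def g_def divide_inverse) (simp add: ac_simps)
  have "D + a \<ge> 0"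
  proof (rule ccontr)
    assume "\<not> D + a \<ge> 0"
    moreover have "((\<lambda>s. g s + a * s) has_real_derivative D + a) (at 0)"
      using D by (auto intro!: derivative_eq_intros)
    ultimately obtain e where e: "e > 0" "\<And>h. 0 < h \<Longrightarrow> h < e \<Longrightarrow> g (0 + h) + a * (0 + h) < g 0 + a * 0"
      using DERIV_neg_dec_right[of "\<lambda>s. g s + a * s" "D + a" 0] by (auto simp: not_le)
    define h where "h = min e \<eta> / 2"
    have h: "0 < h" "h < e" "h < \<eta>" using e(1) assms(3) by (auto simp: h_def)
    from e(2)[OF h(1,2)] le[of h] h show False by (simp add: g_def)
  qed
  moreover have "D - a \<le> 0"
  proof (rule ccontr)
    assume "\<not> D - a \<le> 0"
    moreover have "((\<lambda>s. g s - a * s) has_real_derivative D - a) (at 0)"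
      using D by (auto intro!: derivative_eq_intros)
    ultimately obtain e where e: "e > 0" "\<And>h. 0 < h \<Longrightarrow> h < e \<Longrightarrow> g (0 - h) - a * (0 - h) < g 0 - a * 0"
      using DERIV_pos_inc_left[of "\<lambda>s. g s - a * s" "D - a" 0] by (auto simp: not_le)
    define h where "h = min e \<eta> / 2"
    have h: "0 < h" "h < e" "h < \<eta>" using e(1) assms(3) by (auto simp: h_def)
    from e(2)[OF h(1,2)] le[of "-h"] h show False by (simp add: g_def)
  qed
  ultimately have "\<bar>D\<bar> \<le> a" by linarith
  then have "\<bar>D\<bar> * g 0 \<le> a * g 0" using g0 by (intro mult_right_mono) auto
  then show ?thesis using g0 by (simp add: D_def abs_divide g_def)
qed

text \<open>The shift is a function of the eigenvalue and not of the index: coinciding eigenvalues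
  move together, which protects the multiplicities.\<close>

definition perturbed :: "(nat \<Rightarrow> real) \<Rightarrow> (real \<Rightarrow> real) \<Rightarrow> nat \<Rightarrow> real" where
  "perturbed d c k = d k + c (d k)"

definition frob :: "nat \<Rightarrow> (nat \<Rightarrow> nat \<Rightarrow> real) \<Rightarrow> (nat \<Rightarrow> nat \<Rightarrow> real) \<Rightarrow> real" where
  "frob m C M = (\<Sum>i<m. \<Sum>l<m. C i l * M i l)"

text \<open>The constraints are linear functionals with coefficient matrices \<open>C j\<close> and
  targets \<open>T j\<close>. Single entries would do for adding edges, but splitting a vertex
  constrains combinations of two entries.\<close>

definition resid :: "nat \<Rightarrow> (nat \<Rightarrow> real) \<Rightarrow> ('j \<Rightarrow> nat \<Rightarrow> nat \<Rightarrow> real) \<Rightarrow> ('j \<Rightarrow> real) \<Rightarrow>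
    (nat \<Rightarrow> nat \<Rightarrow> real) \<Rightarrow> (real \<Rightarrow> real) \<Rightarrow> 'j \<Rightarrow> real" where
  "resid m d C T U c j = frob m (C j) (diag_form m U (perturbed d c)) - T j"

definition dist1 :: "nat \<Rightarrow> real set \<Rightarrow> (nat \<Rightarrow> nat \<Rightarrow> real) \<Rightarrow> (nat \<Rightarrow> nat \<Rightarrow> real) \<Rightarrow> (real \<Rightarrow> real) \<Rightarrow> real" where
  "dist1 m L U0 U c = (\<Sum>i<m. \<Sum>j<m. \<bar>U i j - U0 i j\<bar>) + (\<Sum>l\<in>L. \<bar>c l\<bar>)"

lemma givens_entry_diff:
  assumes "orth m U" "p < m" "q < m" "p \<noteq> q" "i < m" "j < m"
  shows "\<bar>givens p q U s i j - U i j\<bar> \<le> (if i = p then 2 * \<bar>s\<bar> else 0) + (if i = q then 2 * \<bar>s\<bar> else 0)"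
proof -
  have "1 - cos s = 2 * (sin (s / 2))\<^sup>2"
    using cos_double_sin[of "s / 2"] by simp
  also have "\<dots> = 2 * (\<bar>sin (s / 2)\<bar> * \<bar>sin (s / 2)\<bar>)"
    by (simp add: power2_eq_square)
  also have "\<dots> \<le> 2 * (\<bar>s / 2\<bar> * 1)"
    by (intro mult_left_mono mult_mono abs_sin_x_le_abs_x) auto
  finally have c: "\<bar>cos s - 1\<bar> \<le> \<bar>s\<bar>" using cos_le_one[of s] by simp
  have s: "\<bar>sin s\<bar> \<le> \<bar>s\<bar>" by (rule abs_sin_x_le_abs_x)
  have U: "\<bar>U p j\<bar> \<le> 1" "\<bar>U q j\<bar> \<le> 1"
    using orth_abs_le_1 assms by auto
  have 1: "\<bar>(cos s - 1) * x + sin s * y\<bar> \<le> 2 * \<bar>s\<bar>" if "\<bar>x\<bar> \<le> 1" "\<bar>y\<bar> \<le> 1" for x y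
  proof -
    have "\<bar>(cos s - 1) * x\<bar> \<le> \<bar>s\<bar> * 1" "\<bar>sin s * y\<bar> \<le> \<bar>s\<bar> * 1"
      unfolding abs_mult using c s that by (intro mult_mono; simp)+
    then show ?thesis by linarith
  qed
  have "givens p q U s i j - U i j = (if i = p then (cos s - 1) * U p j + sin s * U q j
    else if i = q then (cos s - 1) * U q j + sin s * (- U p j) else 0)"
    by (simp add: givens_def algebra_simps)
  then show ?thesis using 1[of "U p j" "U q j"] 1[of "U q j" "- U p j"] U by (auto split: if_splits)
qed

text \<open>Two rows of \<open>m\<close> entries change, each entry by at most
  \<open>2 * \<bar>s\<bar>\<close>. This is the origin of the constant \<open>4 * real m\<close> in
  all later bounds.\<close>

lemma dist1_givens:
  assumes "orth m U" "p < m" "q < m" "p \<noteq> q"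
  shows "dist1 m L U0 (givens p q U s) c \<le> dist1 m L U0 U c + 4 * real m * \<bar>s\<bar>"
proof -
  have "(\<Sum>i<m. \<Sum>j<m. \<bar>givens p q U s i j - U0 i j\<bar>)
    \<le> (\<Sum>i<m. \<Sum>j<m. \<bar>U i j - U0 i j\<bar> + ((if i = p then 2 * \<bar>s\<bar> else 0) + (if i = q then 2 * \<bar>s\<bar> else 0)))"
    (is "_ \<le> (\<Sum>i<m. \<Sum>j<m. ?f i j)")
  proof (intro sum_mono)
    fix i j assume "i \<in> {..<m}" "j \<in> {..<m}"
    then show "\<bar>givens p q U s i j - U0 i j\<bar> \<le> ?f i j"
      using givens_entry_diff[OF assms, of i j s] by simp
  qed
  also have "\<dots> = (\<Sum>i<m. \<Sum>j<m. \<bar>U i j - U0 i j\<bar>) + real m * ((\<Sum>i<m. if i = p then 2 * \<bar>s\<bar> else 0)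
    + (\<Sum>i<m. if i = q then 2 * \<bar>s\<bar> else 0))"
    unfolding sum.distrib sum_constant by (simp only: sum.distrib sum_distrib_left card_lessThan distrib_left)
  also have "\<dots> = (\<Sum>i<m. \<Sum>j<m. \<bar>U i j - U0 i j\<bar>) + 4 * real m * \<bar>s\<bar>"
    using assms by simp
  finally show ?thesis unfolding dist1_def by simp
qed

lemma diag_form_cong:
  assumes "\<And>k. k < m \<Longrightarrow> d k = e k" "\<And>k. k < m \<Longrightarrow> U k i = V k i" "\<And>k. k < m \<Longrightarrow> U k j = V k j"
  shows "diag_form m U d i j = diag_form m V e i j"
  unfolding diag_form_def using assms by (intro sum.cong) auto

lemma frob_has_derivative:
  assumes "\<And>i j. ((\<lambda>s. M s i j) has_real_derivative M' i j) (at x)"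
  shows "((\<lambda>s. frob m C (M s)) has_real_derivative frob m C M') (at x)"
  unfolding frob_def by (intro DERIV_sum DERIV_cmult assms)

text \<open>The penalty enters with its norm and not squared (as in Ekeland's variational principle):
  a minimiser then has either zero residual or a residual that is almost orthogonal to all
  directions in which the spectral data may move.\<close>

lemma near_critical_point:
  fixes C :: "'j \<Rightarrow> nat \<Rightarrow> nat \<Rightarrow> real"
  assumes U0: "orth m U0" and fin: "finite J" "finite L" and \<kappa>: "\<kappa> > 0"
    and f0: "sqrt (\<Sum>j\<in>J. (resid m d C T U0 (\<lambda>_. 0) j)\<^sup>2) < \<kappa>"
  obtains U c where "orth m U" "\<And>l. l \<notin> L \<Longrightarrow> c l = 0"
    "sqrt (\<Sum>j\<in>J. (resid m d C T U c j)\<^sup>2) + \<kappa> * dist1 m L U0 U c \<le> sqrt (\<Sum>j\<in>J. (resid m d C T U0 (\<lambda>_. 0) j)\<^sup>2)"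
    "\<And>p q. p < m \<Longrightarrow> q < m \<Longrightarrow>
      \<bar>\<Sum>j\<in>J. resid m d C T U c j * frob m (C j) (\<lambda>i l. (perturbed d c p - perturbed d c q) * (U p i * U q l + U q i * U p l))\<bar>
        \<le> \<kappa> * (4 * real m) * sqrt (\<Sum>j\<in>J. (resid m d C T U c j)\<^sup>2)"
    "\<And>x. x \<in> L \<Longrightarrow>
      \<bar>\<Sum>j\<in>J. resid m d C T U c j * frob m (C j) (\<lambda>i l. \<Sum>k | k < m \<and> d k = x. U k i * U k l)\<bar>
        \<le> \<kappa> * sqrt (\<Sum>j\<in>J. (resid m d C T U c j)\<^sup>2)"
proof -
  define R where "R U c = sqrt (\<Sum>j\<in>J. (resid m d C T U c j)\<^sup>2)" for U c
  define f where "f z = R (fst z) (snd z) + \<kappa> * dist1 m L U0 (fst z) (snd z)" for z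
  define SU where "SU = {U. orth m U \<and> (\<forall>i j. \<not> (i < m \<and> j < m) \<longrightarrow> U i j = (0::real))}"
  define Sc where "Sc = {c. \<forall>l. c l \<in> (if l \<in> L then {-1..1} else {0::real})}"
  \<comment> \<open>The starting point has to lie in the compact set, so the entries of
    \<open>U0\<close> outside the index range are cut off.\<close>
  define V0 where "V0 i j = (if i < m \<and> j < m then U0 i j else 0)" for i j
  have "compact (SU \<times> Sc)"
    unfolding SU_def Sc_def by (intro compact_Times compact_orth compact_box) auto
  moreover have V0: "V0 \<in> SU" "(\<lambda>_. 0) \<in> Sc"
    using U0 by (auto simp: SU_def Sc_def V0_def orth_def)
  then have "SU \<times> Sc \<noteq> {}" by auto
  moreover have "continuous_on (SU \<times> Sc) f"
  proof -
    have e: "continuous_on (SU \<times> Sc) (\<lambda>z. fst z i j)" for i j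
      by (rule continuous_on_compose2[OF continuous_on_entry[of UNIV] continuous_on_fst[OF continuous_on_id]]) auto
    have c: "continuous_on (SU \<times> Sc) (\<lambda>z. snd z l)" for l
      by (rule continuous_on_compose2[OF continuous_on_product_coordinates continuous_on_snd[OF continuous_on_id]]) auto
    show ?thesis
      unfolding f_def R_def dist1_def resid_def frob_def diag_form_def perturbed_def
      by (intro continuous_intros e c)
  qed
  ultimately have "\<exists>z\<in>SU \<times> Sc. \<forall>y\<in>SU \<times> Sc. f z \<le> f y"
    by (rule continuous_attains_inf)
  then obtain U c where Uc: "U \<in> SU" "c \<in> Sc" and min: "\<And>V e. V \<in> SU \<Longrightarrow> e \<in> Sc \<Longrightarrow> f (U, c) \<le> f (V, e)"
    by auto
  have dist_nn: "dist1 m L U0 V e \<ge> 0" for V e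
    unfolding dist1_def by (intro add_nonneg_nonneg sum_nonneg) auto
  have "f (V0, \<lambda>_. 0) = R U0 (\<lambda>_. 0)"
  proof -
    have "diag_form m V0 e i j = diag_form m U0 e i j" if "i < m" "j < m" for e i j
      using that by (intro diag_form_cong) (auto simp: V0_def)
    then show ?thesis
      by (simp add: f_def R_def resid_def frob_def dist1_def V0_def)
  qed
  with min[OF V0] have le0: "R U c + \<kappa> * dist1 m L U0 U c \<le> R U0 (\<lambda>_. 0)"
    by (simp add: f_def)
  have orth: "orth m U" and c0: "\<And>l. l \<notin> L \<Longrightarrow> c l = 0" and c1: "\<And>l. \<bar>c l\<bar> \<le> 1"
    using Uc unfolding SU_def Sc_def by (auto simp: abs_le_iff split: if_splits)
  have "\<bar>\<Sum>j\<in>J. resid m d C T U c j * frob m (C j) (\<lambda>i l. (perturbed d c p - perturbed d c q) * (U p i * U q l + U q i * U p l))\<bar>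
        \<le> \<kappa> * (4 * real m) * R U c" if pq: "p < m" "q < m" for p q
  proof (cases "p = q")
    case True
    then show ?thesis using \<kappa> by (simp add: frob_def R_def sum_nonneg)
  next
    case False
    define \<rho> where "\<rho> j s = resid m d C T (givens p q U s) c j" for j s
    have "\<bar>\<Sum>j\<in>J. \<rho> j 0 * frob m (C j) (\<lambda>i l. (perturbed d c p - perturbed d c q) * (U p i * U q l + U q i * U p l))\<bar>
      \<le> (\<kappa> * (4 * real m)) * sqrt (\<Sum>j\<in>J. (\<rho> j 0)\<^sup>2)"
    proof (rule sqrt_sum_near_critical[OF fin(1), where \<eta> = 1])
      show "(\<rho> j has_real_derivative frob m (C j) (\<lambda>i l. (perturbed d c p - perturbed d c q) * (U p i * U q l + U q i * U p l))) (at 0)" for j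
      proof -
        have "((\<lambda>s. frob m (C j) (diag_form m (givens p q U s) (perturbed d c)) - T j) has_real_derivative
          frob m (C j) (\<lambda>i l. (perturbed d c p - perturbed d c q) * (U p i * U q l + U q i * U p l)) - 0) (at 0)"
          by (intro DERIV_diff DERIV_const frob_has_derivative diag_form_givens_deriv pq False)
        then show ?thesis by (simp add: \<rho>_def[abs_def] resid_def)
      qed
    next
      fix s :: real
      have "givens p q U s \<in> SU"
        using Uc(1) orth_givens[OF orth pq False] givens_outside[OF pq] by (auto simp: SU_def)
      from min[OF this Uc(2)]
      have "R U c + \<kappa> * dist1 m L U0 U c \<le> R (givens p q U s) c + \<kappa> * dist1 m L U0 (givens p q U s) c"
        by (simp add: f_def)
      also have "\<dots> \<le> R (givens p q U s) c + \<kappa> * (dist1 m L U0 U c + 4 * real m * \<bar>s\<bar>)"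
        using \<kappa> dist1_givens[OF orth pq False] by simp
      finally show "sqrt (\<Sum>j\<in>J. (\<rho> j 0)\<^sup>2) \<le> sqrt (\<Sum>j\<in>J. (\<rho> j s)\<^sup>2) + \<kappa> * (4 * real m) * \<bar>s\<bar>"
        by (simp add: \<rho>_def R_def algebra_simps)
    qed auto
    then show ?thesis by (simp add: \<rho>_def R_def)
  qed
  moreover have "\<bar>\<Sum>j\<in>J. resid m d C T U c j * frob m (C j) (\<lambda>i l. \<Sum>k | k < m \<and> d k = x. U k i * U k l)\<bar>
        \<le> \<kappa> * R U c" if x: "x \<in> L" for x
  proof -
    define \<rho> where "\<rho> j s = resid m d C T U (c(x := c x + s)) j" for j s
    \<comment> \<open>The penalty keeps the minimiser off the walls of the box:
      \<open>\<kappa> * \<bar>c x\<bar>\<close> is at most the starting residual, which is below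
      \<open>\<kappa>\<close> by \<open>f0\<close>. Hence \<open>c x\<close> can be varied in both
      directions.\<close>
    have "\<kappa> * \<bar>c x\<bar> \<le> \<kappa> * dist1 m L U0 U c"
    proof (intro mult_left_mono)
      have "\<bar>c x\<bar> \<le> (\<Sum>l\<in>L. \<bar>c l\<bar>)"
        by (intro member_le_sum x fin) auto
      moreover have "0 \<le> (\<Sum>i<m. \<Sum>j<m. \<bar>U i j - U0 i j\<bar>)"
        by (intro sum_nonneg) auto
      ultimately show "\<bar>c x\<bar> \<le> dist1 m L U0 U c" unfolding dist1_def by linarith
    qed (use \<kappa> in auto)
    also have "\<dots> < \<kappa> * 1"
    proof -
      have "R U c \<ge> 0" unfolding R_def by (simp add: sum_nonneg)
      then show ?thesis using le0 f0 unfolding R_def by linarith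
    qed
    finally have cx: "\<bar>c x\<bar> < 1" using \<kappa> by simp
    have "\<bar>\<Sum>j\<in>J. \<rho> j 0 * frob m (C j) (\<lambda>i l. \<Sum>k | k < m \<and> d k = x. U k i * U k l)\<bar>
      \<le> \<kappa> * sqrt (\<Sum>j\<in>J. (\<rho> j 0)\<^sup>2)"
    proof (rule sqrt_sum_near_critical[OF fin(1), where \<eta> = "1 - \<bar>c x\<bar>"])
      have eq: "diag_form m U (perturbed d (c(x := c x + s))) i l = diag_form m U (perturbed d c) i l + s * (\<Sum>k | k < m \<and> d k = x. U k i * U k l)" for s i l
      proof -
        have "(\<Sum>k | k < m \<and> d k = x. U k i * U k l) = (\<Sum>k<m. if d k = x then U k i * U k l else 0)"
          by (simp add: sum.inter_filter[symmetric] lessThan_def)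
        then have "diag_form m U (perturbed d c) i l + s * (\<Sum>k | k < m \<and> d k = x. U k i * U k l)
            = (\<Sum>k<m. perturbed d c k * U k i * U k l + s * (if d k = x then U k i * U k l else 0))"
          unfolding diag_form_def by (simp only: sum.distrib sum_distrib_left)
        also have "\<dots> = diag_form m U (perturbed d (c(x := c x + s))) i l"
          unfolding diag_form_def perturbed_def by (intro sum.cong) (auto simp: algebra_simps)
        finally show ?thesis ..
      qed
      show "(\<rho> j has_real_derivative frob m (C j) (\<lambda>i l. \<Sum>k | k < m \<and> d k = x. U k i * U k l)) (at 0)" for j
      proof -
        have "((\<lambda>s. frob m (C j) (diag_form m U (perturbed d (c(x := c x + s)))) - T j) has_real_derivative
          frob m (C j) (\<lambda>i l. \<Sum>k | k < m \<and> d k = x. U k i * U k l) - 0) (at 0)"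
        proof (intro DERIV_diff DERIV_const frob_has_derivative)
          show "((\<lambda>s. diag_form m U (perturbed d (c(x := c x + s))) i l) has_real_derivative
            (\<Sum>k | k < m \<and> d k = x. U k i * U k l)) (at 0)" for i l
            unfolding eq by (auto intro!: derivative_eq_intros)
        qed
        then show ?thesis by (simp add: \<rho>_def[abs_def] resid_def)
      qed
      show "0 < 1 - \<bar>c x\<bar>" using cx by simp
    next
      fix s :: real assume s: "\<bar>s\<bar> < 1 - \<bar>c x\<bar>"
      have "c(x := c x + s) \<in> Sc"
        unfolding Sc_def
      proof (intro CollectI allI)
        fix l
        show "(c(x := c x + s)) l \<in> (if l \<in> L then {-1..1} else {0})"
          using s x c0[of l] c1[of l] by auto
      qed
      from min[OF Uc(1) this]
      have "R U c + \<kappa> * dist1 m L U0 U c \<le> R U (c(x := c x + s)) + \<kappa> * dist1 m L U0 U (c(x := c x + s))"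
        by (simp add: f_def)
      moreover have "dist1 m L U0 U (c(x := c x + s)) \<le> dist1 m L U0 U c + \<bar>s\<bar>"
      proof -
        have "(\<Sum>l\<in>L. \<bar>(c(x := c x + s)) l\<bar>) = \<bar>c x + s\<bar> + (\<Sum>l\<in>L - {x}. \<bar>c l\<bar>)"
          using fin x by (simp add: sum.remove[of L x])
        moreover have "(\<Sum>l\<in>L. \<bar>c l\<bar>) = \<bar>c x\<bar> + (\<Sum>l\<in>L - {x}. \<bar>c l\<bar>)"
          using fin x by (simp add: sum.remove[of L x])
        ultimately show ?thesis unfolding dist1_def by linarith
      qed
      then have "\<kappa> * dist1 m L U0 U (c(x := c x + s)) \<le> \<kappa> * dist1 m L U0 U c + \<kappa> * \<bar>s\<bar>"
        using \<kappa> by (simp add: distrib_left[symmetric])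
      ultimately show "sqrt (\<Sum>j\<in>J. (\<rho> j 0)\<^sup>2) \<le> sqrt (\<Sum>j\<in>J. (\<rho> j s)\<^sup>2) + \<kappa> * \<bar>s\<bar>"
        by (simp add: \<rho>_def R_def)
    qed
    then show ?thesis by (simp add: \<rho>_def R_def)
  qed
  ultimately show thesis
    using that[of U c, OF orth c0] le0 unfolding R_def by blast
qed

section \<open>The strong properties in an eigenbasis\<close>

text \<open>The flag selects the property: \<open>True\<close> is the SSP, \<open>False\<close> the SMP. The matrix is
  \<open>diag_form n Q d\<close>, and \<open>conj_entry n Q X\<close> is \<open>X\<close> in its eigenbasis, where commuting means
  vanishing between different eigenvalues and \<open>tr (A\<^sup>i X) = 0\<close> for all \<open>i\<close> means that the
  traces over the eigenspaces vanish.\<close>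

definition strong_prop :: "bool \<Rightarrow> nat \<Rightarrow> (nat \<times> nat) set \<Rightarrow> (nat \<Rightarrow> nat \<Rightarrow> real) \<Rightarrow> (nat \<Rightarrow> real) \<Rightarrow> bool" where
  "strong_prop sp n N Q d \<longleftrightarrow> (\<forall>X.
     (\<forall>i<n. \<forall>j<n. X i j = X j i) \<and>
     (\<forall>i<n. \<forall>j<n. (i, j) \<notin> N \<longrightarrow> X i j = 0) \<and>
     (\<forall>p<n. \<forall>q<n. (d p - d q) * conj_entry n Q X p q = 0) \<and>
     (\<not> sp \<longrightarrow> (\<forall>x. (\<Sum>k | k < n \<and> d k = x. conj_entry n Q X k k) = 0))
     \<longrightarrow> (\<forall>i<n. \<forall>j<n. X i j = 0))"

lemma strong_prop_D:
  assumes strong_prop: "strong_prop sp n N Q d"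
    and sym: "\<And>i j. i < n \<Longrightarrow> j < n \<Longrightarrow> X i j = X j i"
    and supp: "\<And>i j. i < n \<Longrightarrow> j < n \<Longrightarrow> (i, j) \<notin> N \<Longrightarrow> X i j = 0"
    and comm: "\<And>p q. p < n \<Longrightarrow> q < n \<Longrightarrow> (d p - d q) * conj_entry n Q X p q = 0"
    and tr: "\<And>x. \<not> sp \<Longrightarrow> (\<Sum>k | k < n \<and> d k = x. conj_entry n Q X k k) = 0"
    and ij: "i < n" "j < n"
  shows "X i j = 0"
proof -
  have a: "\<forall>i<n. \<forall>j<n. X i j = X j i" using sym by blast
  have b: "\<forall>i<n. \<forall>j<n. (i, j) \<notin> N \<longrightarrow> X i j = 0" using supp by blast
  have c: "\<forall>p<n. \<forall>q<n. (d p - d q) * conj_entry n Q X p q = 0" using comm by blast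
  have e: "\<not> sp \<longrightarrow> (\<forall>x. (\<Sum>k | k < n \<and> d k = x. conj_entry n Q X k k) = 0)" using tr by blast
  from mp[OF spec[OF strong_prop[unfolded strong_prop_def], of X] conjI[OF a conjI[OF b conjI[OF c e]]]] ij
  show ?thesis by blast
qed

lemma tendsto_entry:
  fixes X :: "'k \<Rightarrow> 'a \<Rightarrow> 'b \<Rightarrow> 'c::topological_space"
  assumes "(X \<longlongrightarrow> X0) F"
  shows "((\<lambda>k. X k i j) \<longlongrightarrow> X0 i j) F"
  using continuous_on_tendsto_compose[OF continuous_on_entry[of UNIV i j] assms] by simp

text \<open>Bounded matrices have a convergent subsequence; the limit satisfies every condition on a
  test matrix in \<open>strong_prop\<close> and has norm 1. The separate \<open>Y\<close> is needed
  because the approximate relations are known in a moving eigenbasis, and only asymptotically for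
  \<open>X k\<close> in the basis \<open>Q\<close>.\<close>

lemma strong_prop_limit:
  assumes strong_prop: "strong_prop sp n N Q d"
    and sym: "\<And>k i j. i < n \<Longrightarrow> j < n \<Longrightarrow> X k i j = X k j i"
    and supp: "\<And>i j. i < n \<Longrightarrow> j < n \<Longrightarrow> (i, j) \<notin> N \<Longrightarrow> (\<lambda>k. X k i j) \<longlonglongrightarrow> 0"
    and bound: "\<And>k i j. i < n \<Longrightarrow> j < n \<Longrightarrow> \<bar>X k i j\<bar> \<le> b"
    and norm: "(\<lambda>k. \<Sum>i<n. \<Sum>j<n. (X k i j)\<^sup>2) \<longlonglongrightarrow> 1"
    and Y: "\<And>p q. p < n \<Longrightarrow> q < n \<Longrightarrow> (\<lambda>k. Y k p q - conj_entry n Q (X k) p q) \<longlonglongrightarrow> 0"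
    and comm: "\<And>p q. p < n \<Longrightarrow> q < n \<Longrightarrow> (\<lambda>k. (d p - d q) * Y k p q) \<longlonglongrightarrow> 0"
    and tr: "\<And>x. \<not> sp \<Longrightarrow> x \<in> d ` {..<n} \<Longrightarrow> (\<lambda>k. \<Sum>i | i < n \<and> d i = x. Y k i i) \<longlonglongrightarrow> 0"
  shows False
proof -
  define B where "B = {X :: nat \<Rightarrow> nat \<Rightarrow> real. \<forall>i. X i \<in> {v. \<forall>j. v j \<in> (if i < n \<and> j < n then {-b..b} else {0})}}"
  define X' where "X' k i j = (if i < n \<and> j < n then X k i j else 0)" for k i j
  have "compact B"
    unfolding B_def by (intro compact_box) auto
  then have "seq_compact B" by (rule compact_imp_seq_compact)
  moreover have "X' k \<in> B" for k
    using bound[of _ _ k] by (auto simp: B_def X'_def abs_le_iff minus_le_iff)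
  ultimately obtain X0 r where r: "strict_mono r" and lim: "(X' \<circ> r) \<longlonglongrightarrow> X0"
    unfolding seq_compact_def by metis
  have X0: "(\<lambda>k. X (r k) i j) \<longlonglongrightarrow> X0 i j" if "i < n" "j < n" for i j
    using tendsto_entry[OF lim, of i j] that by (simp add: X'_def)
  have sub: "(\<lambda>k. f (r k)) \<longlonglongrightarrow> l" if "f \<longlonglongrightarrow> l" for f :: "nat \<Rightarrow> real" and l
    using LIMSEQ_subseq_LIMSEQ[OF that r] by (simp add: o_def)
  have cjX0: "(\<lambda>k. conj_entry n Q (X (r k)) p q) \<longlonglongrightarrow> conj_entry n Q X0 p q" for p q
    unfolding conj_entry_def by (intro tendsto_sum tendsto_mult tendsto_const X0) auto
  have Y0: "(\<lambda>k. Y (r k) p q) \<longlonglongrightarrow> conj_entry n Q X0 p q" if "p < n" "q < n" for p q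
    using tendsto_add[OF sub[OF Y[OF that]] cjX0[of p q]] by simp
  have "X0 i j = 0" if "i < n" "j < n" for i j
  proof (rule strong_prop_D[OF strong_prop _ _ _ _ that])
    show "X0 i j = X0 j i" if ij: "i < n" "j < n" for i j
      using LIMSEQ_unique[OF X0[OF ij]] X0[OF ij(2,1)] sym[OF ij] by simp
    show "X0 i j = 0" if "i < n" "j < n" "(i, j) \<notin> N" for i j
      by (rule LIMSEQ_unique[OF X0 sub[OF supp]]) fact+
    show "(d p - d q) * conj_entry n Q X0 p q = 0" if "p < n" "q < n" for p q
      by (rule LIMSEQ_unique[OF tendsto_mult[OF tendsto_const Y0] sub[OF comm]]) fact+
    show "(\<Sum>k | k < n \<and> d k = x. conj_entry n Q X0 k k) = 0" if "\<not> sp" for x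
    proof (cases "x \<in> d ` {..<n}")
      case True
      have "(\<lambda>k. \<Sum>i | i < n \<and> d i = x. Y (r k) i i) \<longlonglongrightarrow> (\<Sum>k | k < n \<and> d k = x. conj_entry n Q X0 k k)"
        by (intro tendsto_sum Y0) auto
      then show ?thesis
        by (rule LIMSEQ_unique[OF _ sub[OF tr[OF that True]]])
    next
      case False
      then have "{k. k < n \<and> d k = x} = {}" by auto
      then show ?thesis by (simp only: sum.empty)
    qed
  qed
  moreover have "(\<lambda>k. \<Sum>i<n. \<Sum>j<n. (X (r k) i j)\<^sup>2) \<longlonglongrightarrow> (\<Sum>i<n. \<Sum>j<n. (X0 i j)\<^sup>2)"
    by (intro tendsto_sum tendsto_power X0) auto
  then have "(\<Sum>i<n. \<Sum>j<n. (X0 i j)\<^sup>2) = 1"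
    by (rule LIMSEQ_unique[OF _ sub[OF norm]])
  ultimately show False by simp
qed

text \<open>Contraposition: if the claim fails for arbitrarily small \<open>e\<close>, choose
  counterexamples with \<open>e k\<close> below 1 / (k + 1). A statement that is uniform in
  \<open>z\<close> thus becomes one about sequences, where compactness applies.\<close>

lemma eventually_at_right_0_seqI:
  fixes G P :: "real \<Rightarrow> 'z \<Rightarrow> bool"
  assumes "\<And>e z. (\<And>k. 0 < e k) \<Longrightarrow> e \<longlonglongrightarrow> 0 \<Longrightarrow> (\<And>k. G (e k) (z k)) \<Longrightarrow> (\<And>k. \<not> P (e k) (z k)) \<Longrightarrow> False"
  shows "\<forall>\<^sub>F e in at_right 0. \<forall>z. G e z \<longrightarrow> P e z"
proof (rule ccontr)
  assume neg: "\<not> ?thesis"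
  have "\<exists>e z. 0 < e \<and> e < 1 / (real k + 1) \<and> G e z \<and> \<not> P e z" for k
  proof (rule ccontr)
    assume "\<not> ?thesis"
    then have "\<exists>b>0. \<forall>e>0. e < b \<longrightarrow> (\<forall>z. G e z \<longrightarrow> P e z)"
      by (intro exI[of _ "1 / (real k + 1)"]) auto
    with neg show False by (simp add: eventually_at_right_field)
  qed
  then obtain e z where *: "\<And>k. 0 < e k" "\<And>k. e k < 1 / (real k + 1)" "\<And>k. G (e k) (z k)" "\<And>k. \<not> P (e k) (z k)"
    by metis
  have "e \<longlonglongrightarrow> 0"
  proof (rule tendsto_sandwich[OF _ _ tendsto_const])
    show "(\<lambda>k. 1 / (real k + 1)) \<longlonglongrightarrow> 0"
      using LIMSEQ_Suc[OF lim_1_over_n] by (simp add: add.commute)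
  qed (auto intro!: always_eventually less_imp_le *)
  with * assms show False by blast
qed

section \<open>Sequences of near-critical data\<close>

lemma dist1_entry:
  assumes "i < m" "j < m" "finite L"
  shows "\<bar>U i j - U0 i j\<bar> \<le> dist1 m L U0 U c"
proof -
  have "\<bar>U i j - U0 i j\<bar> \<le> (\<Sum>j<m. \<bar>U i j - U0 i j\<bar>)"
    using assms by (intro member_le_sum) auto
  also have "\<dots> \<le> (\<Sum>i<m. \<Sum>j<m. \<bar>U i j - U0 i j\<bar>)"
    using assms by (intro member_le_sum[of i "{..<m}" "\<lambda>i. \<Sum>j<m. \<bar>U i j - U0 i j\<bar>"]) (auto intro: sum_nonneg)
  finally show ?thesis unfolding dist1_def by (simp add: sum_nonneg add_increasing2)
qed

lemma dist1_coeff: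
  assumes "finite L" "x \<in> L"
  shows "\<bar>c x\<bar> \<le> dist1 m L U0 U c"
proof -
  have "\<bar>c x\<bar> \<le> (\<Sum>l\<in>L. \<bar>c l\<bar>)"
    using assms by (intro member_le_sum) auto
  then show ?thesis unfolding dist1_def by (simp add: sum_nonneg add_increasing)
qed

lemma dist1_bound_tendsto:
  assumes fin: "finite L" and e: "e \<longlonglongrightarrow> 0"
    and off: "\<And>k x. x \<notin> L \<Longrightarrow> c k x = 0"
    and le: "\<And>k. dist1 m L Q (U k) (c k) \<le> K * e k"
  shows "i < m \<Longrightarrow> j < m \<Longrightarrow> (\<lambda>k. U k i j) \<longlonglongrightarrow> Q i j" "(\<lambda>k. c k x) \<longlonglongrightarrow> 0"
proof -
  have K: "(\<lambda>k. K * e k) \<longlonglongrightarrow> 0"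
    using tendsto_mult[OF tendsto_const e, of K] by simp
  show "(\<lambda>k. U k i j) \<longlonglongrightarrow> Q i j" if "i < m" "j < m"
  proof -
    have "norm (U k i j - Q i j) \<le> K * e k" for k
      using order_trans[OF dist1_entry[OF that fin] le[of k]] by simp
    then have "(\<lambda>k. U k i j - Q i j) \<longlonglongrightarrow> 0"
      by (intro tendsto_0_le[OF K, of _ 1] always_eventually allI)
        (metis abs_ge_self mult_1_right order_trans real_norm_def)
    then show ?thesis by (rule LIM_zero_cancel)
  qed
  show "(\<lambda>k. c k x) \<longlonglongrightarrow> 0"
  proof (cases "x \<in> L")
    case True
    have "norm (c k x) \<le> K * e k" for k
      using order_trans[OF dist1_coeff[OF fin True] le[of k]] by simp
    then show ?thesis
      by (intro tendsto_0_le[OF K, of _ 1] always_eventually allI)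
        (metis abs_ge_self mult_1_right order_trans real_norm_def)
  qed (simp add: off)
qed

text \<open>Almost orthogonality of \<open>X\<close> to all admissible motions, with error
  \<open>b\<close>: the first condition belongs to rotations, the second to shifts of the
  eigenvalues in \<open>L\<close>. The two sizes differ when a large eigenvalue has been appended:
  then \<open>m = Suc n\<close>, and the traces run over the old indices only.\<close>

definition critical :: "nat \<Rightarrow> nat \<Rightarrow> real set \<Rightarrow> (nat \<Rightarrow> real) \<Rightarrow> (nat \<Rightarrow> nat \<Rightarrow> real) \<Rightarrow> (real \<Rightarrow> real) \<Rightarrow>
    real \<Rightarrow> (nat \<Rightarrow> nat \<Rightarrow> real) \<Rightarrow> bool" where
  "critical m n L d U c b X \<longleftrightarrow>
     (\<forall>p<m. \<forall>q<m. \<bar>(perturbed d c p - perturbed d c q) * conj_entry m U X p q\<bar> \<le> b) \<and>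
     (\<forall>x\<in>L. \<bar>\<Sum>k | k < n \<and> d k = x. conj_entry m U X k k\<bar> \<le> b)"

lemma eventually_strict_mono_on:
  fixes S :: "real set"
  assumes "finite S" "\<And>x. x \<in> S \<Longrightarrow> (\<lambda>k. c k x) \<longlonglongrightarrow> 0"
  shows "\<forall>\<^sub>F k in sequentially. strict_mono_on S (\<lambda>x. x + c k x)"
proof -
  have "\<forall>\<^sub>F k in sequentially. \<forall>x\<in>S. \<forall>y\<in>S. x < y \<longrightarrow> x + c k x < y + c k y"
  proof (intro eventually_ball_finite assms(1) ballI)
    fix x y assume xy: "x \<in> S" "y \<in> S"
    show "\<forall>\<^sub>F k in sequentially. x < y \<longrightarrow> x + c k x < y + c k y"
    proof (cases "x < y")
      case True
      have "(\<lambda>k. (y + c k y) - (x + c k x)) \<longlonglongrightarrow> (y + 0) - (x + 0)"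
        using xy by (intro tendsto_intros assms(2))
      from order_tendstoD(1)[OF this, of 0] True
      show ?thesis by (auto elim!: eventually_mono)
    qed simp
  qed
  then show ?thesis by (rule eventually_mono) (simp add: strict_mono_on_def)
qed

lemma sum_restrict_pairs:
  fixes g :: "nat \<Rightarrow> nat \<Rightarrow> real"
  assumes "N \<subseteq> {..<n} \<times> {..<n}" "\<And>i j. i < n \<Longrightarrow> j < n \<Longrightarrow> (i, j) \<notin> N \<Longrightarrow> g i j = 0"
  shows "(\<Sum>(i, j)\<in>N. g i j) = (\<Sum>i<n. \<Sum>j<n. g i j)"
proof -
  have "(\<Sum>i<n. \<Sum>j<n. g i j) = (\<Sum>(i, j)\<in>{..<n} \<times> {..<n}. g i j)"
    by (simp add: sum.cartesian_product)
  also have "\<dots> = (\<Sum>(i, j)\<in>N. g i j)"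
    using assms by (intro sum.mono_neutral_right) auto
  finally show ?thesis ..
qed

lemma frob_unit:
  assumes "a < m" "b < m"
  shows "frob m (\<lambda>i l. of_bool (i = a \<and> l = b)) M = M a b"
proof -
  have "frob m (\<lambda>i l. of_bool (i = a \<and> l = b)) M = (\<Sum>i<m. if i = a then (\<Sum>l<m. if l = b then M a b else 0) else 0)"
    unfolding frob_def by (intro sum.cong refl) (auto intro!: sum.cong)
  then show ?thesis using assms by simp
qed

section \<open>Adding edges\<close>

lemma conj_entry_bound:
  assumes U: "orth m U" and X: "\<And>i j. i < m \<Longrightarrow> j < m \<Longrightarrow> \<bar>X i j\<bar> \<le> b" and pq: "p < m" "q < m"
  shows "\<bar>conj_entry m U X p q\<bar> \<le> real m * real m * b"
proof -
  have "\<bar>U p i * X i j * U q j\<bar> \<le> b" if "i < m" "j < m" for i j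
  proof -
    have "\<bar>U p i\<bar> * \<bar>X i j\<bar> * \<bar>U q j\<bar> \<le> 1 * b * 1"
      using that X[OF that] pq orth_abs_le_1[OF U] by (intro mult_mono) (auto intro: order_trans[OF abs_ge_zero])
    then show ?thesis by (simp add: abs_mult)
  qed
  then have "\<bar>conj_entry m U X p q\<bar> \<le> (\<Sum>i<m. \<Sum>j<m. b)"
    unfolding conj_entry_def by (intro order_trans[OF sum_abs] sum_mono) auto
  then show ?thesis by simp
qed

lemma entry_le_1:
  fixes X :: "nat \<Rightarrow> nat \<Rightarrow> real"
  assumes "(\<Sum>i<m. \<Sum>j<m. (X i j)\<^sup>2) \<le> 1" "i < m" "j < m"
  shows "\<bar>X i j\<bar> \<le> 1"
proof -
  have "(X i j)\<^sup>2 \<le> (\<Sum>j<m. (X i j)\<^sup>2)"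
    using assms by (intro member_le_sum) auto
  also have "\<dots> \<le> (\<Sum>i<m. \<Sum>j<m. (X i j)\<^sup>2)"
    using assms by (intro member_le_sum[of i "{..<m}" "\<lambda>i. \<Sum>j<m. (X i j)\<^sup>2"]) (auto intro: sum_nonneg)
  also have "\<dots> \<le> 1" by (rule assms)
  finally show ?thesis by (simp add: abs_square_le_1)
qed

lemma tendsto_zero_mult_bounded:
  fixes f g :: "nat \<Rightarrow> real"
  assumes "f \<longlonglongrightarrow> 0" "\<And>k. \<bar>g k\<bar> \<le> b"
  shows "(\<lambda>k. f k * g k) \<longlonglongrightarrow> 0"
  by (rule tendsto_0_le[OF assms(1), of _ b])
    (use assms(2) in \<open>auto simp: abs_mult intro!: always_eventually mult_left_mono\<close>)

text \<open>The matrices \<open>X k\<close> need not converge. It suffices that they are bounded and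
  that the coefficients built from \<open>U k\<close> and \<open>Q\<close> approach each
  other.\<close>

lemma tendsto_conj_entry_diff:
  assumes U: "\<And>i j. i < m \<Longrightarrow> j < m \<Longrightarrow> (\<lambda>k. U k i j) \<longlonglongrightarrow> Q i j"
    and X: "\<And>k i j. i < m \<Longrightarrow> j < m \<Longrightarrow> \<bar>X k i j\<bar> \<le> 1" and pq: "p < m" "q < m"
  shows "(\<lambda>k. conj_entry m (U k) (X k) p q - conj_entry m Q (X k) p q) \<longlonglongrightarrow> 0"
proof -
  have "conj_entry m (U k) (X k) p q - conj_entry m Q (X k) p q
    = (\<Sum>i<m. \<Sum>j<m. (U k p i * U k q j - Q p i * Q q j) * X k i j)" for k
    unfolding conj_entry_def sum_subtractf[symmetric] by (simp add: algebra_simps)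
  moreover have "(\<lambda>k. \<Sum>i<m. \<Sum>j<m. (U k p i * U k q j - Q p i * Q q j) * X k i j) \<longlonglongrightarrow> (\<Sum>i<m. \<Sum>j<m. 0)"
  proof (intro tendsto_sum)
    fix i j assume "i \<in> {..<m}" "j \<in> {..<m}"
    then have ij: "i < m" "j < m" by auto
    have "(\<lambda>k. U k p i * U k q j - Q p i * Q q j) \<longlonglongrightarrow> Q p i * Q q j - Q p i * Q q j"
      by (intro tendsto_intros U pq ij)
    then have "(\<lambda>k. U k p i * U k q j - Q p i * Q q j) \<longlonglongrightarrow> 0" by simp
    then show "(\<lambda>k. (U k p i * U k q j - Q p i * Q q j) * X k i j) \<longlonglongrightarrow> 0"
      by (rule tendsto_zero_mult_bounded) (rule X[OF ij])
  qed
  ultimately show ?thesis by simp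
qed

lemma tendsto_comm_unperturbed:
  assumes Y: "\<And>k. \<bar>Y k\<bar> \<le> b" and c: "\<And>x. (\<lambda>k. c k x) \<longlonglongrightarrow> 0"
    and comm: "(\<lambda>k. (perturbed d (c k) p - perturbed d (c k) q) * Y k) \<longlonglongrightarrow> (0::real)"
  shows "(\<lambda>k. (d p - d q) * Y k) \<longlonglongrightarrow> 0"
proof -
  have "(\<lambda>k. c k (d p) - c k (d q)) \<longlonglongrightarrow> 0 - 0"
    by (intro tendsto_diff c)
  then have "(\<lambda>k. (c k (d p) - c k (d q)) * Y k) \<longlonglongrightarrow> 0"
    using Y by (intro tendsto_zero_mult_bounded[where b = b]) auto
  from tendsto_diff[OF comm this] show ?thesis
    by (simp add: perturbed_def algebra_simps)
qed

lemma critical_tendsto: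
  assumes crit: "\<And>k. critical m n (L :: real set) (d k) (U k) (c k) (B * e k) (X k)" and e: "e \<longlonglongrightarrow> 0"
  shows "p < m \<Longrightarrow> q < m \<Longrightarrow> (\<lambda>k. (perturbed (d k) (c k) p - perturbed (d k) (c k) q) * conj_entry m (U k) (X k) p q) \<longlonglongrightarrow> 0"
    and "x \<in> L \<Longrightarrow> (\<lambda>k. \<Sum>i | i < n \<and> d k i = x. conj_entry m (U k) (X k) i i) \<longlonglongrightarrow> 0"
proof -
  have *: "f \<longlonglongrightarrow> 0" if "\<And>k. \<bar>f k\<bar> \<le> B * e k" for f :: "nat \<Rightarrow> real"
  proof -
    have "(\<lambda>k. B * e k) \<longlonglongrightarrow> 0" using tendsto_mult[OF tendsto_const e, of B] by simp
    then show ?thesis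
      by (rule tendsto_0_le[of _ _ _ 1])
        (use that in \<open>auto intro!: always_eventually order_trans[OF that abs_ge_self]\<close>)
  qed
  show "(\<lambda>k. (perturbed (d k) (c k) p - perturbed (d k) (c k) q) * conj_entry m (U k) (X k) p q) \<longlonglongrightarrow> 0" if "p < m" "q < m"
    using crit that unfolding critical_def by (intro *) blast
  show "(\<lambda>k. \<Sum>i | i < n \<and> d k i = x. conj_entry m (U k) (X k) i i) \<longlonglongrightarrow> 0" if "x \<in> L"
    using crit that unfolding critical_def by (intro *) blast
qed

lemma conj_entry_scale: "conj_entry m U (\<lambda>i j. a * X i j) p q = a * conj_entry m U X p q"
  unfolding conj_entry_def by (simp add: sum_distrib_left mult_ac)

lemma critical_scale:
  assumes "critical m n L d U c b X" "a \<ge> 0"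
  shows "critical m n L d U c (a * b) (\<lambda>i j. a * X i j)"
proof -
  have "\<bar>(perturbed d c p - perturbed d c q) * (a * y)\<bar> = a * \<bar>(perturbed d c p - perturbed d c q) * y\<bar>" for p q y
    using assms(2) by (simp add: abs_mult)
  moreover have "\<bar>\<Sum>k | k < n \<and> d k = x. a * conj_entry m U X k k\<bar> = a * \<bar>\<Sum>k | k < n \<and> d k = x. conj_entry m U X k k\<bar>" for x
    unfolding sum_distrib_left[symmetric] using assms(2) by (simp add: abs_mult)
  ultimately show ?thesis
    using assms unfolding critical_def conj_entry_scale by (auto intro: mult_left_mono)
qed

text \<open>This is the duality behind the method: paired with a rotation, \<open>X\<close> shows an
  entry in the eigenbasis weighted by an eigenvalue difference; paired with a shift, it shows a
  trace over an eigenspace. The inequalities at a near-critical point thereby become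
  \<open>critical\<close> for the residual.\<close>

lemma frob_direction:
  assumes sym: "\<And>i j. i < m \<Longrightarrow> j < m \<Longrightarrow> X i j = X j i"
  shows "frob m X (\<lambda>i j. v * (U p i * U q j + U q i * U p j)) = 2 * (v * conj_entry m U X p q)"
    and "frob m X (\<lambda>i j. \<Sum>k\<in>S. U k i * U k j) = (\<Sum>k\<in>S. conj_entry m U X k k)"
proof -
  have "frob m X (\<lambda>i j. v * (U p i * U q j + U q i * U p j))
    = (\<Sum>i<m. \<Sum>j<m. v * (U p i * X i j * U q j) + v * (U q i * X i j * U p j))"
    unfolding frob_def by (simp add: algebra_simps)
  also have "\<dots> = v * conj_entry m U X p q + v * conj_entry m U X q p"
    unfolding conj_entry_def by (simp add: sum.distrib sum_distrib_left)
  also have "conj_entry m U X q p = conj_entry m U X p q" by (rule conj_entry_sym) (rule sym)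
  finally show "frob m X (\<lambda>i j. v * (U p i * U q j + U q i * U p j)) = 2 * (v * conj_entry m U X p q)"
    by simp
  have "frob m X (\<lambda>i j. \<Sum>k\<in>S. U k i * U k j) = (\<Sum>i<m. \<Sum>j<m. \<Sum>k\<in>S. U k i * X i j * U k j)"
    unfolding frob_def by (simp add: sum_distrib_left mult_ac)
  also have "\<dots> = (\<Sum>i<m. \<Sum>k\<in>S. \<Sum>j<m. U k i * X i j * U k j)"
    by (intro sum.cong refl sum.swap)
  also have "\<dots> = (\<Sum>k\<in>S. conj_entry m U X k k)"
    unfolding conj_entry_def by (rule sum.swap)
  finally show "frob m X (\<lambda>i j. \<Sum>k\<in>S. U k i * U k j) = (\<Sum>k\<in>S. conj_entry m U X k k)" .
qed

lemma sqrt_sum_squares_le_sum_abs: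
  assumes "finite J"
  shows "sqrt (\<Sum>j\<in>J. (f j)\<^sup>2) \<le> (\<Sum>j\<in>J. \<bar>f j :: real\<bar>)"
proof -
  have "(\<Sum>j\<in>J. (f j)\<^sup>2) \<le> (\<Sum>j\<in>J. \<bar>f j\<bar>)\<^sup>2"
    using assms
  proof (induction J rule: finite_induct)
    case (insert x J)
    have "(\<Sum>j\<in>insert x J. (f j)\<^sup>2) \<le> \<bar>f x\<bar>\<^sup>2 + (\<Sum>j\<in>J. \<bar>f j\<bar>)\<^sup>2"
      using insert by simp
    also have "\<dots> \<le> (\<bar>f x\<bar> + (\<Sum>j\<in>J. \<bar>f j\<bar>))\<^sup>2"
      by (simp add: power2_sum sum_nonneg)
    finally show ?case using insert by simp
  qed simp
  then show ?thesis by (intro real_le_lsqrt) (auto intro: sum_nonneg)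
qed

lemma strict_mono_on_classes:
  fixes \<phi> :: "real \<Rightarrow> real"
  assumes "strict_mono_on (d ` {..<n}) \<phi>" "x \<in> d ` {..<n :: nat}"
  shows "{k. k < n \<and> \<phi> (d k) = \<phi> x} = {k. k < n \<and> d k = (x :: real)}"
  using strict_mono_on_imp_inj_on[OF assms(1)] assms(2) by (auto simp: inj_on_def)

text \<open>The positions in \<open>N\<close> are the only constrained ones: the target is a small
  positive number on \<open>F\<close> and 0 on the rest of \<open>N\<close>. Entries that were
  nonzero remain so because the motion is small. The property is kept with respect to the old set
  \<open>N\<close>, which is stronger than what the larger graph requires.\<close>

lemma supergraph_realization:
  assumes Q: "orth n Q" and strong_prop: "strong_prop sp n N Q d"
    and N: "N \<subseteq> {..<n} \<times> {..<n}" "\<And>i j. (i, j) \<in> N \<Longrightarrow> (j, i) \<in> N"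
    and F: "\<And>i j. (i, j) \<in> F \<Longrightarrow> (j, i) \<in> F"
    and zero: "\<And>i j. (i, j) \<in> N \<Longrightarrow> diag_form n Q d i j = 0"
  obtains U \<phi> where "orth n U" "strict_mono_on (d ` {..<n}) \<phi>" "\<And>x. sp \<Longrightarrow> \<phi> x = x"
    "\<And>i j. (i, j) \<in> N \<Longrightarrow> diag_form n U (\<phi> \<circ> d) i j \<noteq> 0 \<longleftrightarrow> (i, j) \<in> F"
    "\<And>i j. i < n \<Longrightarrow> j < n \<Longrightarrow> diag_form n Q d i j \<noteq> 0 \<Longrightarrow> diag_form n U (\<phi> \<circ> d) i j \<noteq> 0"
    "strong_prop sp n N U (\<phi> \<circ> d)"
proof -
  define L where "L = (if sp then {} else d ` {..<n})"
  define K where "K = real (card N) + 1"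
  \<comment> \<open>Large enough for both kinds of motion: rotations contribute the factor
    \<open>4 * real n\<close>, shifts the factor 1.\<close>
  define B where "B = 4 * real n + 1"
  \<comment> \<open>The set of all data that a minimiser at scale \<open>e\<close> can produce. The
    radius \<open>K * e\<close> comes from dividing the starting residual, at most
    \<open>K * e\<^sup>2\<close>, by the penalty weight \<open>e\<close>.\<close>
  define G where "G e z \<longleftrightarrow> orth n (fst z) \<and> (\<forall>x. x \<notin> L \<longrightarrow> snd z x = 0) \<and> dist1 n L Q (fst z) (snd z) \<le> K * e"
    for e :: real and z :: "(nat \<Rightarrow> nat \<Rightarrow> real) \<times> (real \<Rightarrow> real)"
  have finL: "finite L" and finN: "finite N"
    using N(1) finite_subset by (auto simp: L_def)
  have G_lim: "\<And>i j. i < n \<Longrightarrow> j < n \<Longrightarrow> (\<lambda>k. fst (z k) i j) \<longlonglongrightarrow> Q i j" "\<And>x. (\<lambda>k. snd (z k) x) \<longlonglongrightarrow> 0"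
    if "e \<longlonglongrightarrow> 0" "\<And>k. G (e k) (z k)" for e z
    using dist1_bound_tendsto[OF finL that(1), of "\<lambda>k. snd (z k)" n Q "\<lambda>k. fst (z k)" K] that(2)
    by (auto simp: G_def)
  have E1: "\<forall>\<^sub>F e in at_right 0. \<forall>z. G e z \<longrightarrow> strict_mono_on (d ` {..<n}) (\<lambda>x. x + snd z x)"
  proof (rule eventually_at_right_0_seqI)
    fix e z assume e: "e \<longlonglongrightarrow> 0" and G: "\<And>k. G (e k) (z k)"
      and no: "\<And>k. \<not> strict_mono_on (d ` {..<n}) (\<lambda>x. x + snd (z k) x)"
    have "\<forall>\<^sub>F k in sequentially. strict_mono_on (d ` {..<n}) (\<lambda>x. x + snd (z k) x)"
      by (rule eventually_strict_mono_on) (use G_lim(2)[OF e G] in auto)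
    then show False using no by simp
  qed
  have E2: "\<forall>\<^sub>F e in at_right 0. \<forall>z. G e z \<longrightarrow> diag_form n Q d i j \<noteq> 0 \<longrightarrow> diag_form n (fst z) (perturbed d (snd z)) i j \<noteq> 0"
    if ij: "i < n" "j < n" for i j
  proof (rule eventually_at_right_0_seqI)
    fix e z assume e: "e \<longlonglongrightarrow> 0" and G: "\<And>k. G (e k) (z k)"
      and no: "\<And>k. \<not> (diag_form n Q d i j \<noteq> 0 \<longrightarrow> diag_form n (fst (z k)) (perturbed d (snd (z k))) i j \<noteq> 0)"
    have "(\<lambda>k. diag_form n (fst (z k)) (perturbed d (snd (z k))) i j) \<longlonglongrightarrow> (\<Sum>k<n. (d k + 0) * Q k i * Q k j)"
      unfolding diag_form_def perturbed_def by (intro tendsto_intros G_lim[OF e G] ij) auto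
    then have "diag_form n Q d i j = 0"
      using no by (simp add: diag_form_def LIMSEQ_const_iff)
    then show False using no by simp
  qed
  have "\<forall>\<^sub>F e in at_right 0. \<forall>zX. G e (fst zX) \<and> (\<forall>i<n. \<forall>j<n. snd zX i j = snd zX j i)
      \<and> (\<forall>i<n. \<forall>j<n. (i, j) \<notin> N \<longrightarrow> snd zX i j = 0) \<and> (\<Sum>i<n. \<Sum>j<n. (snd zX i j)\<^sup>2) = 1
      \<longrightarrow> \<not> critical n n L d (fst (fst zX)) (snd (fst zX)) (B * e) (snd zX)"
  proof (rule eventually_at_right_0_seqI)
    fix e :: "nat \<Rightarrow> real" and zX :: "nat \<Rightarrow> ((nat \<Rightarrow> nat \<Rightarrow> real) \<times> (real \<Rightarrow> real)) \<times> (nat \<Rightarrow> nat \<Rightarrow> real)"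
    assume e: "e \<longlonglongrightarrow> 0"
      and A: "\<And>k. G (e k) (fst (zX k)) \<and> (\<forall>i<n. \<forall>j<n. snd (zX k) i j = snd (zX k) j i)
      \<and> (\<forall>i<n. \<forall>j<n. (i, j) \<notin> N \<longrightarrow> snd (zX k) i j = 0) \<and> (\<Sum>i<n. \<Sum>j<n. (snd (zX k) i j)\<^sup>2) = 1"
      and no: "\<And>k. \<not> \<not> critical n n L d (fst (fst (zX k))) (snd (fst (zX k))) (B * e k) (snd (zX k))"
    define U c X where "U k = fst (fst (zX k))" and "c k = snd (fst (zX k))" and "X k = snd (zX k)" for k
    have G: "\<And>k. G (e k) (U k, c k)" and sym: "\<And>k i j. i < n \<Longrightarrow> j < n \<Longrightarrow> X k i j = X k j i"
      and supp: "\<And>k i j. i < n \<Longrightarrow> j < n \<Longrightarrow> (i, j) \<notin> N \<Longrightarrow> X k i j = 0"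
      and norm: "\<And>k. (\<Sum>i<n. \<Sum>j<n. (X k i j)\<^sup>2) = 1"
      and crit: "\<And>k. critical n n L d (U k) (c k) (B * e k) (X k)"
      using A no by (auto simp: U_def c_def X_def)
    have lim: "\<And>i j. i < n \<Longrightarrow> j < n \<Longrightarrow> (\<lambda>k. U k i j) \<longlonglongrightarrow> Q i j" "\<And>x. (\<lambda>k. c k x) \<longlonglongrightarrow> 0"
      using G_lim[OF e, of "\<lambda>k. (U k, c k)"] G by simp_all
    have X1: "\<bar>X k i j\<bar> \<le> 1" if "i < n" "j < n" for k i j
      using entry_le_1[OF _ that] norm[of k] by simp
    show False
    proof (rule strong_prop_limit[OF strong_prop sym, where b = 1 and Y = "\<lambda>k. conj_entry n (U k) (X k)"])
      show "(\<lambda>k. X k i j) \<longlonglongrightarrow> 0" if "i < n" "j < n" "(i, j) \<notin> N" for i j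
        using supp[OF that] by simp
      show "(\<lambda>k. (d p - d q) * conj_entry n (U k) (X k) p q) \<longlonglongrightarrow> 0" if "p < n" "q < n" for p q
      proof (rule tendsto_comm_unperturbed[OF _ lim(2) critical_tendsto(1)[OF crit e that]])
        show "\<bar>conj_entry n (U k) (X k) p q\<bar> \<le> real n * real n * 1" for k
          using G[of k] that by (intro conj_entry_bound X1) (auto simp: G_def)
      qed
      show "(\<lambda>k. \<Sum>i | i < n \<and> d i = x. conj_entry n (U k) (X k) i i) \<longlonglongrightarrow> 0" if "\<not> sp" "x \<in> d ` {..<n}" for x
        by (rule critical_tendsto(2)[OF crit e]) (use that in \<open>simp add: L_def\<close>)
    qed (use X1 norm tendsto_conj_entry_diff[OF lim(1) X1] in auto)
  qed
  \<comment> \<open>The conditions are homogeneous in \<open>X\<close>, so a nonzero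
    \<open>X\<close> can be scaled to norm 1.\<close>
  then have E3: "\<forall>\<^sub>F e in at_right 0. \<forall>z X. G e z \<longrightarrow> (\<forall>i<n. \<forall>j<n. X i j = X j i) \<longrightarrow>
      (\<forall>i<n. \<forall>j<n. (i, j) \<notin> N \<longrightarrow> X i j = 0) \<longrightarrow> (\<Sum>i<n. \<Sum>j<n. (X i j)\<^sup>2) > 0
      \<longrightarrow> \<not> critical n n L d (fst z) (snd z) (B * e * sqrt (\<Sum>i<n. \<Sum>j<n. (X i j)\<^sup>2)) X"
  proof (rule eventually_mono, intro allI impI notI)
    fix e z and X :: "nat \<Rightarrow> nat \<Rightarrow> real"
    let ?w = "\<Sum>i<n. \<Sum>j<n. (X i j)\<^sup>2"
    assume *: "\<forall>zX. G e (fst zX) \<and> (\<forall>i<n. \<forall>j<n. snd zX i j = snd zX j i)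
      \<and> (\<forall>i<n. \<forall>j<n. (i, j) \<notin> N \<longrightarrow> snd zX i j = 0) \<and> (\<Sum>i<n. \<Sum>j<n. (snd zX i j)\<^sup>2) = 1
      \<longrightarrow> \<not> critical n n L d (fst (fst zX)) (snd (fst zX)) (B * e) (snd zX)"
      and z: "G e z" and X: "\<forall>i<n. \<forall>j<n. X i j = X j i" "\<forall>i<n. \<forall>j<n. (i, j) \<notin> N \<longrightarrow> X i j = 0" and w: "?w > 0"
      and crit: "critical n n L d (fst z) (snd z) (B * e * sqrt ?w) X"
    have "critical n n L d (fst z) (snd z) (1 / sqrt ?w * (B * e * sqrt ?w)) (\<lambda>i j. 1 / sqrt ?w * X i j)"
      by (rule critical_scale[OF crit]) (use w in auto)
    then have "critical n n L d (fst z) (snd z) (B * e) (\<lambda>i j. X i j / sqrt ?w)"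
      using w by simp
    moreover have "(\<Sum>i<n. \<Sum>j<n. (X i j / sqrt ?w)\<^sup>2) = 1"
      using w by (simp add: power_divide sum_divide_distrib[symmetric])
    moreover have "\<forall>i<n. \<forall>j<n. X i j / sqrt ?w = X j i / sqrt ?w"
    proof (intro allI impI)
      fix i j assume "i < n" "j < n"
      then have "X i j = X j i" using X(1) by blast
      then show "X i j / sqrt ?w = X j i / sqrt ?w" by (simp only:)
    qed
    ultimately show False
      using spec[OF *, of "(z, \<lambda>i j. X i j / sqrt ?w)"] z X(2) by simp
  qed
  \<comment> \<open>The bound \<open>1 / K\<close> makes the starting residual smaller than
    \<open>e\<close>, as the existence of a near-critical point requires.\<close>
  have E4: "\<forall>\<^sub>F e in at_right (0::real). 0 < e \<and> e < 1 / K"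
    unfolding eventually_at_right_field by (intro exI[of _ "1 / K"]) (auto simp: K_def)
  have E2': "\<forall>\<^sub>F e in at_right 0. \<forall>i\<in>{..<n}. \<forall>j\<in>{..<n}. \<forall>z. G e z \<longrightarrow> diag_form n Q d i j \<noteq> 0 \<longrightarrow> diag_form n (fst z) (perturbed d (snd z)) i j \<noteq> 0"
    by (intro eventually_ball_finite ballI E2) auto
  obtain e where e: "0 < e" "e < 1 / K"
    and e1: "\<And>z. G e z \<Longrightarrow> strict_mono_on (d ` {..<n}) (\<lambda>x. x + snd z x)"
    and e2: "\<And>z i j. G e z \<Longrightarrow> i < n \<Longrightarrow> j < n \<Longrightarrow> diag_form n Q d i j \<noteq> 0 \<Longrightarrow> diag_form n (fst z) (perturbed d (snd z)) i j \<noteq> 0"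
    and e3: "\<And>z X. G e z \<Longrightarrow> (\<forall>i<n. \<forall>j<n. X i j = X j i) \<Longrightarrow>
      (\<forall>i<n. \<forall>j<n. (i, j) \<notin> N \<longrightarrow> X i j = 0) \<Longrightarrow> (\<Sum>i<n. \<Sum>j<n. (X i j)\<^sup>2) > 0
      \<Longrightarrow> \<not> critical n n L d (fst z) (snd z) (B * e * sqrt (\<Sum>i<n. \<Sum>j<n. (X i j)\<^sup>2)) X"
    using eventually_happens'[OF _ eventually_conj[OF E4 eventually_conj[OF E1 eventually_conj[OF E2' E3]]]]
    by (auto simp: trivial_limit_at_right_real)
  define C where "C ab i l = (of_bool (i = fst ab \<and> l = snd ab) :: real)" for ab :: "nat \<times> nat" and i l :: nat
  \<comment> \<open>The value on the new edges only has to be nonzero; the order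
    \<open>e\<^sup>2\<close> keeps it small against the penalty weight \<open>e\<close>.\<close>
  define T where "T ab = (if ab \<in> F then e\<^sup>2 else 0)" for ab
  have pairC: "frob n (C (a, b)) M = M a b" if "(a, b) \<in> N" for a b M
    using that N(1) frob_unit[of a n b M] by (auto simp: C_def[abs_def])
  have res: "resid n d C T U c (a, b) = diag_form n U (perturbed d c) a b - T (a, b)" if "(a, b) \<in> N" for U c a b
    unfolding resid_def by (simp add: pairC that)
  have start: "sqrt (\<Sum>j\<in>N. (resid n d C T Q (\<lambda>_. 0) j)\<^sup>2) \<le> K * e\<^sup>2"
  proof -
    have "sqrt (\<Sum>j\<in>N. (resid n d C T Q (\<lambda>_. 0) j)\<^sup>2) \<le> (\<Sum>j\<in>N. \<bar>resid n d C T Q (\<lambda>_. 0) j\<bar>)"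
      by (rule sqrt_sum_squares_le_sum_abs[OF finN])
    also have "\<dots> \<le> (\<Sum>j\<in>N. e\<^sup>2)"
    proof (rule sum_mono)
      fix j assume "j \<in> N"
      then show "\<bar>resid n d C T Q (\<lambda>_. 0) j\<bar> \<le> e\<^sup>2"
        using zero[of "fst j" "snd j"] res[of "fst j" "snd j" Q "\<lambda>_. 0"]
        by (auto simp: T_def perturbed_def[abs_def])
    qed
    also have "\<dots> \<le> K * e\<^sup>2"
      unfolding K_def by (simp add: distrib_right)
    finally show ?thesis .
  qed
  have Ke: "K * e\<^sup>2 < e"
  proof -
    have "K * e < 1" using e by (simp add: K_def pos_less_divide_eq mult.commute)
    then have "K * e * e < 1 * e" using e by (intro mult_strict_right_mono)
    then show ?thesis by (simp add: power2_eq_square mult_ac)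
  qed
  obtain U c where U: "orth n U" and c0: "\<And>l. l \<notin> L \<Longrightarrow> c l = 0"
    and le: "sqrt (\<Sum>j\<in>N. (resid n d C T U c j)\<^sup>2) + e * dist1 n L Q U c \<le> sqrt (\<Sum>j\<in>N. (resid n d C T Q (\<lambda>_. 0) j)\<^sup>2)"
    and cr1: "\<And>p q. p < n \<Longrightarrow> q < n \<Longrightarrow>
      \<bar>\<Sum>j\<in>N. resid n d C T U c j * frob n (C j) (\<lambda>i l. (perturbed d c p - perturbed d c q) * (U p i * U q l + U q i * U p l))\<bar>
        \<le> e * (4 * real n) * sqrt (\<Sum>j\<in>N. (resid n d C T U c j)\<^sup>2)"
    and cr2: "\<And>x. x \<in> L \<Longrightarrow>
      \<bar>\<Sum>j\<in>N. resid n d C T U c j * frob n (C j) (\<lambda>i l. \<Sum>k | k < n \<and> d k = x. U k i * U k l)\<bar>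
        \<le> e * sqrt (\<Sum>j\<in>N. (resid n d C T U c j)\<^sup>2)"
    by (rule near_critical_point[OF Q finN finL e(1), of d C T]) (use start Ke in linarith, blast)
  have "0 \<le> sqrt (\<Sum>j\<in>N. (resid n d C T U c j)\<^sup>2)" by (simp add: sum_nonneg)
  then have "e * dist1 n L Q U c \<le> K * e\<^sup>2"
    using le start by linarith
  then have "e * dist1 n L Q U c \<le> e * (K * e)"
    by (simp only: power2_eq_square mult_ac)
  then have "dist1 n L Q U c \<le> K * e" using e(1) by simp
  then have G: "G e (U, c)" using U c0 by (simp add: G_def)
  define \<phi> where "\<phi> x = x + c x" for x
  have \<phi>d: "\<phi> \<circ> d = perturbed d c" by (simp add: fun_eq_iff \<phi>_def perturbed_def)
  \<comment> \<open>Extended by 0, the residual is a symmetric matrix supported on \<open>N\<close>,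
    hence itself a candidate for the test matrix in the strong property.\<close>
  define r where "r i j = (if (i, j) \<in> N then resid n d C T U c (i, j) else 0)" for i j
  have rsym: "r i j = r j i" for i j
    unfolding r_def using N(2)[of i j] N(2)[of j i] F[of i j] F[of j i] diag_form_sym[of n U "perturbed d c" i j]
    by (auto simp: res T_def)
  have sumr: "(\<Sum>j\<in>N. (resid n d C T U c j)\<^sup>2) = (\<Sum>i<n. \<Sum>j<n. (r i j)\<^sup>2)"
    using sum_restrict_pairs[OF N(1), of "\<lambda>i j. (r i j)\<^sup>2"] by (auto simp: r_def case_prod_beta intro!: sum.cong)
  have "critical n n L d U c (B * e * sqrt (\<Sum>i<n. \<Sum>j<n. (r i j)\<^sup>2)) r"
  proof -
    have le1: "e * (4 * real n) * sqrt w \<le> 2 * (B * e * sqrt w)" "e * sqrt w \<le> B * e * sqrt w" if "w \<ge> 0" for w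
      using e(1) that by (auto simp: B_def algebra_simps)
    have w: "(\<Sum>i<n. \<Sum>j<n. (r i j)\<^sup>2) \<ge> 0" by (intro sum_nonneg) auto
    have eq: "(\<Sum>j\<in>N. resid n d C T U c j * frob n (C j) M) = frob n r M" for M
    proof -
      have "(\<Sum>j\<in>N. resid n d C T U c j * frob n (C j) M) = (\<Sum>(i, j)\<in>N. r i j * M i j)"
        by (intro sum.cong) (auto simp: r_def pairC)
      also have "\<dots> = frob n r M"
        unfolding frob_def by (rule sum_restrict_pairs[OF N(1)]) (simp add: r_def)
      finally show ?thesis .
    qed
    have "\<bar>(perturbed d c p - perturbed d c q) * conj_entry n U r p q\<bar> \<le> B * e * sqrt (\<Sum>i<n. \<Sum>j<n. (r i j)\<^sup>2)" if "p < n" "q < n" for p q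
    proof -
      have "2 * \<bar>(perturbed d c p - perturbed d c q) * conj_entry n U r p q\<bar> = \<bar>2 * ((perturbed d c p - perturbed d c q) * conj_entry n U r p q)\<bar>"
        by simp
      also have "\<dots> \<le> e * (4 * real n) * sqrt (\<Sum>i<n. \<Sum>j<n. (r i j)\<^sup>2)"
        using cr1[OF that] unfolding eq sumr frob_direction(1)[of n r, OF rsym] .
      also note le1(1)[OF w]
      finally show ?thesis by simp
    qed
    moreover have "\<bar>\<Sum>k | k < n \<and> d k = x. conj_entry n U r k k\<bar> \<le> B * e * sqrt (\<Sum>i<n. \<Sum>j<n. (r i j)\<^sup>2)" if "x \<in> L" for x
    proof -
      have "\<bar>\<Sum>k | k < n \<and> d k = x. conj_entry n U r k k\<bar> \<le> e * sqrt (\<Sum>i<n. \<Sum>j<n. (r i j)\<^sup>2)"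
        using cr2[OF that] unfolding eq sumr frob_direction(2)[of n r, OF rsym] .
      also note le1(2)[OF w]
      finally show ?thesis .
    qed
    ultimately show ?thesis unfolding critical_def by blast
  qed
  with e3[OF G, of r] rsym have "\<not> (\<Sum>i<n. \<Sum>j<n. (r i j)\<^sup>2) > 0"
    by (auto simp: r_def)
  moreover have "0 \<le> (\<Sum>i<n. \<Sum>j<n. (r i j)\<^sup>2)" by (intro sum_nonneg) auto
  ultimately have "(\<Sum>j\<in>N. (resid n d C T U c j)\<^sup>2) = 0"
    unfolding sumr by linarith
  then have "\<And>j. j \<in> N \<Longrightarrow> resid n d C T U c j = 0"
    using finN by (simp add: sum_nonneg_eq_0_iff)
  then have val: "diag_form n U (perturbed d c) i j = (if (i, j) \<in> F then e\<^sup>2 else 0)" if "(i, j) \<in> N" for i j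
    using that res[of i j U c] by (auto simp: T_def)
  have mono: "strict_mono_on (d ` {..<n}) \<phi>"
    using e1[OF G] by (simp add: \<phi>_def[abs_def])
  show thesis
  proof (rule that[OF U mono])
    show "\<phi> x = x" if sp for x using c0 that by (simp add: \<phi>_def L_def)
    show "diag_form n U (\<phi> \<circ> d) i j \<noteq> 0 \<longleftrightarrow> (i, j) \<in> F" if "(i, j) \<in> N" for i j
      using val[OF that] e(1) by (simp add: \<phi>d)
    show "diag_form n U (\<phi> \<circ> d) i j \<noteq> 0" if "i < n" "j < n" "diag_form n Q d i j \<noteq> 0" for i j
      using e2[OF G that] by (simp add: \<phi>d)
    \<comment> \<open>A test matrix for the new data satisfies the orthogonality relations exactly,
      hence also with the nonnegative error allowed in \<open>critical\<close>. The estimate that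
      excluded a nonzero residual therefore excludes it too.\<close>
    show "strong_prop sp n N U (\<phi> \<circ> d)"
      unfolding strong_prop_def
    proof (intro allI impI, elim conjE)
      fix X i j
      assume ij: "i < n" "j < n" and X: "\<forall>i<n. \<forall>j<n. X i j = X j i" "\<forall>i<n. \<forall>j<n. (i, j) \<notin> N \<longrightarrow> X i j = 0"
        and comm: "\<forall>p<n. \<forall>q<n. ((\<phi> \<circ> d) p - (\<phi> \<circ> d) q) * conj_entry n U X p q = 0"
        and tr: "\<not> sp \<longrightarrow> (\<forall>x. (\<Sum>k | k < n \<and> (\<phi> \<circ> d) k = x. conj_entry n U X k k) = 0)"
      have "(\<Sum>k | k < n \<and> d k = x. conj_entry n U X k k) = 0" if "x \<in> L" for x
      proof -
        have "\<not> sp" "x \<in> d ` {..<n}" using that by (auto simp: L_def split: if_splits)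
        then show ?thesis
          using tr[rule_format, of "\<phi> x"] strict_mono_on_classes[OF mono, of x] by simp
      qed
      moreover have "0 \<le> B * e * sqrt (\<Sum>i<n. \<Sum>j<n. (X i j)\<^sup>2)"
        using e(1) by (auto simp: B_def intro!: mult_nonneg_nonneg sum_nonneg)
      ultimately have "critical n n L d U c (B * e * sqrt (\<Sum>i<n. \<Sum>j<n. (X i j)\<^sup>2)) X"
        using comm by (simp add: critical_def \<phi>d[symmetric] del: mult_eq_0_iff)
      with e3[OF G X] have "\<not> (\<Sum>i<n. \<Sum>j<n. (X i j)\<^sup>2) > 0" by auto
      moreover have "0 \<le> (\<Sum>i<n. \<Sum>j<n. (X i j)\<^sup>2)" by (intro sum_nonneg) auto
      ultimately have "(\<Sum>i<n. \<Sum>j<n. (X i j)\<^sup>2) = 0" by linarith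
      then show "X i j = 0"
        using ij by (simp add: sum_nonneg_eq_0_iff sum_nonneg)
    qed
  qed
qed

section \<open>Splitting a vertex\<close>

definition border :: "nat \<Rightarrow> (nat \<Rightarrow> nat \<Rightarrow> real) \<Rightarrow> nat \<Rightarrow> nat \<Rightarrow> real" where
  "border n Q i j = (if i < n \<and> j < n then Q i j else if i = n \<and> j = n then 1 else 0)"

definition snoc :: "nat \<Rightarrow> (nat \<Rightarrow> real) \<Rightarrow> real \<Rightarrow> nat \<Rightarrow> real" where
  "snoc n d t k = (if k < n then d k else t)"

text \<open>A matrix \<open>X\<close> orthogonal to all solutions of the constraints ``last column \<open>= cf *\<close> column
  \<open>w\<close>'' has the entries \<open>- cf i * X i n\<close> in row and column \<open>w\<close>. They are removed here, and the
  last column is rescaled in the norm because its constraints have weight \<open>e\<^sup>2\<close>.\<close>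

definition reduced_entry :: "nat \<Rightarrow> nat \<Rightarrow> (nat \<Rightarrow> real) \<Rightarrow> (nat \<Rightarrow> nat \<Rightarrow> real) \<Rightarrow> nat \<Rightarrow> nat \<Rightarrow> real" where
  "reduced_entry n w cf X i j = X i j + (if j = w then cf i * X i n else 0) + (if i = w then cf j * X j n else 0)"

definition reduced_norm :: "nat \<Rightarrow> nat \<Rightarrow> (nat \<Rightarrow> real) \<Rightarrow> real \<Rightarrow> (nat \<Rightarrow> nat \<Rightarrow> real) \<Rightarrow> real" where
  "reduced_norm n w cf e X = (\<Sum>i<n. \<Sum>j<n. (reduced_entry n w cf X i j)\<^sup>2) + (\<Sum>i<n. (2 * X i n / e\<^sup>2)\<^sup>2)"

lemma orth_border:
  assumes "orth n Q"
  shows "orth (Suc n) (border n Q)"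
proof -
  have "(\<Sum>k<n. border n Q k i * border n Q k j) = (if i < n \<and> j < n then (\<Sum>k<n. Q k i * Q k j) else 0)" for i j
    by (auto simp: border_def)
  then show ?thesis
    using assms unfolding orth_def by (auto simp: border_def less_Suc_eq)
qed

lemma tendsto_zero_mult_cancel:
  fixes f g :: "nat \<Rightarrow> real"
  assumes "(\<lambda>k. f k * g k) \<longlonglongrightarrow> 0" "g \<longlonglongrightarrow> l" "l \<noteq> 0"
  shows "f \<longlonglongrightarrow> 0"
proof -
  have "(\<lambda>k. f k * g k / g k) \<longlonglongrightarrow> 0 / l"
    by (intro tendsto_divide assms)
  moreover have "\<forall>\<^sub>F k in sequentially. f k * g k / g k = f k"
    using tendsto_imp_eventually_ne[OF assms(2,3)] by eventually_elim simp
  ultimately show ?thesis by (auto intro: Lim_transform_eventually)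
qed

lemma tendsto_zero_of_square:
  fixes f :: "nat \<Rightarrow> real"
  assumes "(\<lambda>k. (f k)\<^sup>2) \<longlonglongrightarrow> 0"
  shows "f \<longlonglongrightarrow> 0"
proof -
  have "(\<lambda>k. sqrt ((f k)\<^sup>2)) \<longlonglongrightarrow> sqrt 0" by (intro tendsto_intros assms)
  then show ?thesis by (simp add: tendsto_rabs_zero_iff)
qed

text \<open>The eigenvalue \<open>t = 1 / e\<^sup>4\<close> tends to infinity, while the boundedness hypothesis on the last
  column keeps the off-diagonal part of the last row of \<open>U\<close> at size \<open>O(1 / t)\<close>.\<close>

locale decontraction_limit =
  fixes n w :: nat and cf :: "nat \<Rightarrow> real" and Q :: "nat \<Rightarrow> nat \<Rightarrow> real" and d :: "nat \<Rightarrow> real"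
    and L :: "real set" and K :: real
    and e :: "nat \<Rightarrow> real" and U :: "nat \<Rightarrow> nat \<Rightarrow> nat \<Rightarrow> real" and c :: "nat \<Rightarrow> real \<Rightarrow> real"
  assumes w: "w < n" and Q: "orth n Q" and fin: "finite L"
    and e_pos: "\<And>k. 0 < e k" and e_lt: "\<And>k. e k < 1" and e_lim: "e \<longlonglongrightarrow> 0"
    and U: "\<And>k. orth (Suc n) (U k)"
    and c_off: "\<And>k x. x \<notin> L \<Longrightarrow> c k x = 0" and c_t: "\<And>k. c k (1 / e k ^ 4) = 0"
    and dist: "\<And>k. dist1 (Suc n) L (border n Q) (U k) (c k) \<le> K * e k"
    and bd: "\<And>k i. i < n \<Longrightarrow> \<bar>diag_form (Suc n) (U k) (perturbed (snoc n d (1 / e k ^ 4)) (c k)) i n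
      - cf i * diag_form (Suc n) (U k) (perturbed (snoc n d (1 / e k ^ 4)) (c k)) i w\<bar> \<le> K"
begin

abbreviation "M k \<equiv> diag_form (Suc n) (U k) (perturbed (snoc n d (1 / e k ^ 4)) (c k))"

lemma U_lim: "i < Suc n \<Longrightarrow> j < Suc n \<Longrightarrow> (\<lambda>k. U k i j) \<longlonglongrightarrow> border n Q i j"
  and c_lim: "(\<lambda>k. c k x) \<longlonglongrightarrow> 0"
  using dist1_bound_tendsto[OF fin e_lim c_off dist] by auto

text \<open>The eigenvalue \<open>t\<close> is not shifted, so all of its effect is one explicit
  rank-one term. What remains converges, whatever the size of \<open>t\<close>.\<close>

lemma M_eq: "M k i j = diag_form n (U k) (perturbed d (c k)) i j + 1 / e k ^ 4 * U k n i * U k n j"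
  unfolding diag_form_def by (simp add: perturbed_def snoc_def c_t)

lemma S_lim:
  assumes "i < Suc n" "j < Suc n"
  shows "(\<lambda>k. diag_form n (U k) (perturbed d (c k)) i j) \<longlonglongrightarrow> diag_form n (border n Q) d i j"
proof -
  have "(\<lambda>k. diag_form n (U k) (perturbed d (c k)) i j) \<longlonglongrightarrow> (\<Sum>k<n. (d k + 0) * border n Q k i * border n Q k j)"
    unfolding diag_form_def perturbed_def using assms by (intro tendsto_intros U_lim c_lim) auto
  then show ?thesis by (simp add: diag_form_def)
qed

text \<open>In the constrained combination of columns \<open>n\<close> and \<open>w\<close> the
  rank-one term is \<open>t * U k n i\<close> times a factor that tends to 1. By \<open>bd\<close>
  and the convergence of the remaining terms this product is bounded, so \<open>U k n i\<close> is
  O(\<open>e k ^ 4\<close>); multiplication by one factor \<open>e k\<close> turns boundedness into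
  convergence to 0.\<close>

lemma row_rate:
  assumes i: "i < n"
  shows "(\<lambda>k. U k n i / e k ^ 3) \<longlonglongrightarrow> 0"
proof (rule tendsto_zero_mult_cancel)
  have "(\<lambda>k. U k n n - cf i * U k n w) \<longlonglongrightarrow> border n Q n n - cf i * border n Q n w"
    using w by (intro tendsto_intros U_lim) auto
  then show "(\<lambda>k. U k n n - cf i * U k n w) \<longlonglongrightarrow> 1"
    using w by (simp add: border_def)
  have "(\<lambda>k. e k * (M k i n - cf i * M k i w)) \<longlonglongrightarrow> 0"
    using bd[OF i] by (intro tendsto_zero_mult_bounded[OF e_lim]) auto
  moreover have "(\<lambda>k. e k * (diag_form n (U k) (perturbed d (c k)) i n - cf i * diag_form n (U k) (perturbed d (c k)) i w))
    \<longlonglongrightarrow> 0 * (diag_form n (border n Q) d i n - cf i * diag_form n (border n Q) d i w)"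
    using w i by (intro tendsto_intros e_lim S_lim) auto
  ultimately have "(\<lambda>k. e k * (M k i n - cf i * M k i w)
      - e k * (diag_form n (U k) (perturbed d (c k)) i n - cf i * diag_form n (U k) (perturbed d (c k)) i w)) \<longlonglongrightarrow> 0 - 0"
    by (intro tendsto_diff) auto
  moreover have "e k * (M k i n - cf i * M k i w)
      - e k * (diag_form n (U k) (perturbed d (c k)) i n - cf i * diag_form n (U k) (perturbed d (c k)) i w)
    = U k n i / e k ^ 3 * (U k n n - cf i * U k n w)" for k
  proof -
    have "e k * (1 / e k ^ 4) = 1 / e k ^ 3"
      using e_pos[of k] by (simp add: power4_eq_xxxx power3_eq_cube)
    moreover have "e k * (M k i n - cf i * M k i w)
      - e k * (diag_form n (U k) (perturbed d (c k)) i n - cf i * diag_form n (U k) (perturbed d (c k)) i w)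
      = (e k * (1 / e k ^ 4)) * U k n i * (U k n n - cf i * U k n w)"
    proof -
      have "x * ((a + u * y * z) - f * (b + u * y * z')) - x * (a - f * b) = x * u * y * (z - f * z')"
        for x a u y z f b z' :: real
        by (simp add: algebra_simps)
      then show ?thesis unfolding M_eq by blast
    qed
    ultimately show ?thesis by simp
  qed
  ultimately show "(\<lambda>k. U k n i / e k ^ 3 * (U k n n - cf i * U k n w)) \<longlonglongrightarrow> 0" by simp
qed simp

text \<open>Row \<open>n\<close> and column \<open>n\<close> of an orthogonal matrix are unit
  vectors sharing the entry at \<open>(n, n)\<close>, so their remaining parts have the same
  norm.\<close>

lemma column_rate:
  assumes q: "q < n"
  shows "(\<lambda>k. U k q n / e k ^ 3) \<longlonglongrightarrow> 0"
proof (rule tendsto_zero_of_square)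
  have "(\<lambda>k. \<Sum>i<n. (U k n i / e k ^ 3)\<^sup>2) \<longlonglongrightarrow> (\<Sum>i<n. 0\<^sup>2)"
    by (intro tendsto_intros row_rate) auto
  then have lim: "(\<lambda>k. \<Sum>i<n. (U k n i / e k ^ 3)\<^sup>2) \<longlonglongrightarrow> 0" by simp
  have "(U k q n / e k ^ 3)\<^sup>2 \<le> (\<Sum>i<n. (U k n i / e k ^ 3)\<^sup>2)" for k
  proof -
    have "(\<Sum>i<n. (U k i n)\<^sup>2) = (\<Sum>i<n. (U k n i)\<^sup>2)"
      using U[of k, unfolded orth_def, rule_format, of n n] orth_rows[OF U[of k], of n n]
      by (simp add: power2_eq_square)
    moreover have "(U k q n)\<^sup>2 \<le> (\<Sum>i<n. (U k i n)\<^sup>2)"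
      using q by (intro member_le_sum) auto
    ultimately have "(U k q n)\<^sup>2 / (e k ^ 3)\<^sup>2 \<le> (\<Sum>i<n. (U k n i)\<^sup>2) / (e k ^ 3)\<^sup>2"
      by (simp add: divide_right_mono)
    then show ?thesis by (simp add: power_divide sum_divide_distrib)
  qed
  then show "(\<lambda>k. (U k q n / e k ^ 3)\<^sup>2) \<longlonglongrightarrow> 0"
    by (intro tendsto_sandwich[OF _ _ tendsto_const lim]) auto
qed

lemma rate2: "(\<lambda>k. f k / e k ^ 3) \<longlonglongrightarrow> 0 \<Longrightarrow> (\<lambda>k. f k / (e k)\<^sup>2) \<longlonglongrightarrow> 0"
proof -
  assume "(\<lambda>k. f k / e k ^ 3) \<longlonglongrightarrow> 0"
  from tendsto_mult[OF this e_lim] have "(\<lambda>k. f k / e k ^ 3 * e k) \<longlonglongrightarrow> 0" by simp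
  moreover have "f k / e k ^ 3 * e k = f k / (e k)\<^sup>2" for k
    using e_pos[of k] by (simp add: power3_eq_cube power2_eq_square)
  ultimately show ?thesis by simp
qed

text \<open>The rank-one term is a product of two factors o(\<open>e k ^ 3\<close>) divided by
  \<open>e k ^ 4\<close>, so it vanishes in the limit although \<open>t\<close> is
  unbounded.\<close>

lemma M_lim:
  assumes ij: "i < n" "j < n"
  shows "(\<lambda>k. M k i j) \<longlonglongrightarrow> diag_form n Q d i j"
proof -
  have "(\<lambda>k. diag_form n (U k) (perturbed d (c k)) i j + (U k n i / e k ^ 3) * (U k n j / e k ^ 3) * (e k)\<^sup>2)
    \<longlonglongrightarrow> diag_form n (border n Q) d i j + 0 * 0 * 0\<^sup>2"
    using ij by (intro tendsto_intros S_lim row_rate e_lim) auto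
  moreover have "(U k n i / e k ^ 3) * (U k n j / e k ^ 3) * (e k)\<^sup>2 = 1 / e k ^ 4 * U k n i * U k n j" for k
    using e_pos[of k] by (simp add: power2_eq_square power3_eq_cube power4_eq_xxxx)
  moreover have "diag_form n (border n Q) d i j = diag_form n Q d i j"
    using ij by (intro diag_form_cong) (auto simp: border_def)
  ultimately show ?thesis by (simp add: M_eq)
qed

text \<open>Multiplied by \<open>e k ^ 4\<close>, the gap between the two diagonal entries tends to
  1. After the rotation by 45 degrees this gap is what makes the contracted edge nonzero.\<close>

lemma M_corner: "\<forall>\<^sub>F k in sequentially. M k w w < M k n n"
proof -
  have "(\<lambda>k. e k ^ 4 * (diag_form n (U k) (perturbed d (c k)) n n - M k w w) + U k n n * U k n n) \<longlonglongrightarrow>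
     0 ^ 4 * (diag_form n (border n Q) d n n - diag_form n Q d w w) + border n Q n n * border n Q n n"
    using w by (intro tendsto_intros e_lim S_lim M_lim U_lim) auto
  then have "(\<lambda>k. e k ^ 4 * (diag_form n (U k) (perturbed d (c k)) n n - M k w w) + U k n n * U k n n) \<longlonglongrightarrow> 1"
    by (simp add: border_def)
  moreover have "e k ^ 4 * (diag_form n (U k) (perturbed d (c k)) n n - M k w w) + U k n n * U k n n
      = e k ^ 4 * (M k n n - M k w w)" for k
    using e_pos[of k] by (simp add: M_eq[of k n n] distrib_left right_diff_distrib)
  ultimately have "(\<lambda>k. e k ^ 4 * (M k n n - M k w w)) \<longlonglongrightarrow> 1" by simp
  from order_tendstoD(1)[OF this, of 0]
  have "\<forall>\<^sub>F k in sequentially. 0 < e k ^ 4 * (M k n n - M k w w)" by simp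
  then show ?thesis
  proof eventually_elim
    case (elim k)
    then show ?case using e_pos[of k] by (simp add: zero_less_mult_iff)
  qed
qed

text \<open>The last column of \<open>X\<close>, even divided by \<open>(e k)\<^sup>2\<close>, tends
  to 0, so the whole reduced norm passes to the \<open>n\<close> by \<open>n\<close> block of
  reduced entries. That block differs from \<open>X\<close> by a null sequence and satisfies the
  approximate relations in the limit basis \<open>Q\<close>, which contradicts the strong property
  of the contracted graph's matrix.\<close>

lemma no_critical_sequence:
  assumes strong_prop: "strong_prop sp n N Q d" and L: "L = (if sp then {} else d ` {..<n})"
    and sym: "\<And>k i j. i \<le> n \<Longrightarrow> j \<le> n \<Longrightarrow> X k i j = X k j i"
    and Xn: "\<And>k. X k n n = 0"
    and supp: "\<And>k i j. i < n \<Longrightarrow> j < n \<Longrightarrow> (i, j) \<notin> N \<Longrightarrow> reduced_entry n w cf (X k) i j = 0"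
    and norm: "\<And>k. reduced_norm n w cf (e k) (X k) = 1"
    and crit: "\<And>k. critical (Suc n) n L (snoc n d (1 / e k ^ 4)) (U k) (c k) (B * e k) (X k)"
  shows False
proof -
  \<comment> \<open>An entry of \<open>X\<close> is recovered from its reduced entry by undoing at
    most two corrections, each bounded by the sum of the \<open>\<bar>cf i\<bar>\<close>.\<close>
  define b where "b = 1 + 2 * (\<Sum>i<n. \<bar>cf i\<bar>)"
  define Y where "Y k = conj_entry (Suc n) (U k) (X k)" for k
  have cf: "\<bar>cf i\<bar> \<le> (\<Sum>i<n. \<bar>cf i\<bar>)" if "i < n" for i
    using that by (intro member_le_sum) auto
  have sum_nn: "0 \<le> (\<Sum>i<n. (2 * X k i n / (e k)\<^sup>2)\<^sup>2)" "0 \<le> (\<Sum>i<n. \<Sum>j<n. (reduced_entry n w cf (X k) i j)\<^sup>2)" for k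
    by (intro sum_nonneg; simp)+
  have R1: "\<bar>reduced_entry n w cf (X k) i j\<bar> \<le> 1" if "i < n" "j < n" for k i j
    using norm[of k] sum_nn[of k] by (intro entry_le_1[OF _ that]) (simp add: reduced_norm_def)
  have X1: "\<bar>2 * X k i n / (e k)\<^sup>2\<bar> \<le> 1" if "i < n" for k i
  proof -
    have "(2 * X k i n / (e k)\<^sup>2)\<^sup>2 \<le> (\<Sum>i<n. (2 * X k i n / (e k)\<^sup>2)\<^sup>2)"
      using that by (intro member_le_sum) auto
    also have "\<dots> \<le> 1"
      using norm[of k] sum_nn[of k] unfolding reduced_norm_def by linarith
    finally show ?thesis by (simp only: abs_square_le_1)
  qed
  have Xin: "\<bar>X k i n\<bar> \<le> (e k)\<^sup>2" "\<bar>X k i n\<bar> \<le> 1" if "i < n" for k i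
  proof -
    have "\<bar>2 * X k i n\<bar> \<le> (e k)\<^sup>2"
      using X1[OF that, of k] e_pos[of k] by (simp add: abs_divide divide_le_eq)
    moreover have "(e k)\<^sup>2 \<le> 1"
      using e_pos[of k] e_lt[of k] by (intro power_le_one) auto
    ultimately show "\<bar>X k i n\<bar> \<le> (e k)\<^sup>2" "\<bar>X k i n\<bar> \<le> 1" by auto
  qed
  have Xin_lim: "(\<lambda>k. X k i n) \<longlonglongrightarrow> 0" if "i < n" for i
  proof (rule tendsto_0_le[of "\<lambda>k. (e k)\<^sup>2" _ _ 1])
    show "(\<lambda>k. (e k)\<^sup>2) \<longlonglongrightarrow> 0" using tendsto_power[OF e_lim, of 2] by simp
  qed (use Xin(1)[OF that] in auto)
  have Xb: "\<bar>X k i j\<bar> \<le> b" if "i < Suc n" "j < Suc n" for k i j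
  proof -
    have b1: "1 \<le> b" unfolding b_def by (simp add: sum_nonneg)
    have in_cases: "\<bar>X k i j\<bar> \<le> b" if ij: "i < n" "j < n" for i j
    proof -
      have "\<bar>cf i * X k i n\<bar> \<le> (\<Sum>i<n. \<bar>cf i\<bar>) * 1" "\<bar>cf j * X k j n\<bar> \<le> (\<Sum>i<n. \<bar>cf i\<bar>) * 1"
        unfolding abs_mult using ij cf Xin(2) by (intro mult_mono; force intro: sum_nonneg)+
      moreover have "0 \<le> (\<Sum>i<n. \<bar>cf i\<bar>)" by (intro sum_nonneg) auto
      ultimately show ?thesis
        using R1[OF ij, of k] unfolding reduced_entry_def b_def by (auto split: if_splits)
    qed
    show ?thesis
      using that in_cases[of i j] Xin(2)[of i k] Xin(2)[of j k] sym[of n j k] Xn[of k] b1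
      by (auto simp: less_Suc_eq)
  qed
  have Yb: "\<bar>Y k p q\<bar> \<le> real (Suc n) * real (Suc n) * b" if "p < Suc n" "q < Suc n" for k p q
    unfolding Y_def using Xb that by (intro conj_entry_bound[OF U]) auto
  have Ysym: "Y k p q = Y k q p" for k p q
    unfolding Y_def by (rule conj_entry_sym) (simp add: sym)
  have bounded_mult: "\<bar>x * y\<bar> \<le> 1 * (real (Suc n) * real (Suc n) * b)"
    if "\<bar>x\<bar> \<le> 1" "\<bar>y\<bar> \<le> real (Suc n) * real (Suc n) * b" for x y
    unfolding abs_mult using that by (intro mult_mono) (auto intro: order_trans[OF abs_ge_zero])
  have perturbed_t: "perturbed (snoc n d (1 / e k ^ 4)) (c k) n = 1 / e k ^ 4" for k
    by (simp add: perturbed_def snoc_def c_t)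
  have perturbed_lt: "perturbed (snoc n d (1 / e k ^ 4)) (c k) p = perturbed d (c k) p" if "p < n" for k p
    using that by (simp add: perturbed_def snoc_def)
  \<comment> \<open>The commutator condition between an old eigenvalue and \<open>t\<close> carries
    the factor \<open>1 / e k ^ 4\<close>, which forces these entries to be very small.\<close>
  have Y_last: "(\<lambda>k. Y k p n / (e k)\<^sup>2) \<longlonglongrightarrow> 0" if p: "p < n" for p
  proof (rule tendsto_zero_mult_cancel)
    have "(\<lambda>k. e k ^ 4 * perturbed d (c k) p - 1) \<longlonglongrightarrow> 0 ^ 4 * (d p + 0) - 1"
      unfolding perturbed_def by (intro tendsto_intros e_lim c_lim)
    then show "(\<lambda>k. e k ^ 4 * perturbed d (c k) p - 1) \<longlonglongrightarrow> - 1" by simp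
    have "(\<lambda>k. (e k)\<^sup>2 * ((perturbed d (c k) p - 1 / e k ^ 4) * Y k p n)) \<longlonglongrightarrow> 0\<^sup>2 * 0"
      using critical_tendsto(1)[OF crit e_lim, of p n] p
      by (intro tendsto_intros e_lim) (simp add: Y_def perturbed_t perturbed_lt)
    moreover have "(e k)\<^sup>2 * ((perturbed d (c k) p - 1 / e k ^ 4) * Y k p n)
        = Y k p n / (e k)\<^sup>2 * (e k ^ 4 * perturbed d (c k) p - 1)" for k
      using e_pos[of k] by (simp add: field_simps power2_eq_square power4_eq_xxxx)
    ultimately show "(\<lambda>k. Y k p n / (e k)\<^sup>2 * (e k ^ 4 * perturbed d (c k) p - 1)) \<longlonglongrightarrow> 0" by simp
  qed simp
  have \<xi>_lim: "(\<lambda>k. 2 * X k i n / (e k)\<^sup>2) \<longlonglongrightarrow> 0" if i: "i < n" for i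
  proof -
    \<comment> \<open>Every summand in the expansion of \<open>X k i n\<close> has one small factor:
      \<open>U k q n\<close> if \<open>q < n\<close>, the entry \<open>Y k p n\<close> if only
      \<open>q = n\<close>, and \<open>U k n i\<close> if both indices are \<open>n\<close>.\<close>
    have "(\<lambda>k. \<Sum>p<Suc n. \<Sum>q<Suc n. U k p i * Y k p q * U k q n / (e k)\<^sup>2) \<longlonglongrightarrow> (\<Sum>p<Suc n. \<Sum>q<Suc n. 0)"
    proof (intro tendsto_sum)
      fix p q assume "p \<in> {..<Suc n}" "q \<in> {..<Suc n}"
      then have pq: "p < Suc n" "q < Suc n" by auto
      have U1: "\<bar>U k x y\<bar> \<le> 1" if "x < Suc n" "y < Suc n" for k x y
        using orth_abs_le_1[OF U that] .
      consider "q < n" | "q = n" "p < n" | "q = n" "p = n" using pq by linarith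
      then show "(\<lambda>k. U k p i * Y k p q * U k q n / (e k)\<^sup>2) \<longlonglongrightarrow> 0"
      proof cases
        case 1
        have "(\<lambda>k. U k q n / (e k)\<^sup>2 * (U k p i * Y k p q)) \<longlonglongrightarrow> 0"
        proof (rule tendsto_zero_mult_bounded[OF rate2[OF column_rate[OF 1]]])
          show "\<bar>U k p i * Y k p q\<bar> \<le> 1 * (real (Suc n) * real (Suc n) * b)" for k
            using i pq by (intro bounded_mult U1 Yb) auto
        qed
        then show ?thesis by (simp add: mult_ac)
      next
        case 2
        have "(\<lambda>k. Y k p n / (e k)\<^sup>2 * (U k p i * U k n n)) \<longlonglongrightarrow> 0"
        proof (rule tendsto_zero_mult_bounded[OF Y_last[OF 2(2)]])
          show "\<bar>U k p i * U k n n\<bar> \<le> 1 * 1" for k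
            unfolding abs_mult using i pq by (intro mult_mono U1) auto
        qed
        then show ?thesis using 2 by (simp add: mult_ac)
      next
        case 3
        have "(\<lambda>k. U k n i / (e k)\<^sup>2 * (U k n n * Y k n n)) \<longlonglongrightarrow> 0"
        proof (rule tendsto_zero_mult_bounded[OF rate2[OF row_rate[OF i]]])
          show "\<bar>U k n n * Y k n n\<bar> \<le> 1 * (real (Suc n) * real (Suc n) * b)" for k
            by (intro bounded_mult U1 Yb) auto
        qed
        then show ?thesis using 3 by (simp add: mult_ac)
      qed
    qed
    moreover have "(\<Sum>p<Suc n. \<Sum>q<Suc n. U k p i * Y k p q * U k q n / (e k)\<^sup>2) = X k i n / (e k)\<^sup>2" for k
      using conj_back[OF U[of k], of i n "X k"] i
      unfolding Y_def sum_divide_distrib[symmetric] by simp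
    ultimately have "(\<lambda>k. X k i n / (e k)\<^sup>2) \<longlonglongrightarrow> 0" by simp
    from tendsto_mult[OF tendsto_const this, of 2] show ?thesis by simp
  qed
  define R where "R k i j = (if i < n \<and> j < n then reduced_entry n w cf (X k) i j else 0)" for k i j
  have cjR: "conj_entry (Suc n) V (R k) p q = conj_entry n V (R k) p q" for V k p q
    unfolding conj_entry_def by (simp add: R_def)
  have R1': "\<bar>R k i j\<bar> \<le> 1" for k i j
    using R1[of i j k] by (simp add: R_def)
  have XR: "(\<lambda>k. X k i j - R k i j) \<longlonglongrightarrow> 0" if "i < Suc n" "j < Suc n" for i j
  proof (cases "i < n \<and> j < n")
    case True
    have "(\<lambda>k. - ((if j = w then cf i * X k i n else 0) + (if i = w then cf j * X k j n else 0))) \<longlonglongrightarrow>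
      - ((if j = w then cf i * 0 else 0) + (if i = w then cf j * 0 else 0))"
      using True by (auto intro!: tendsto_eq_intros Xin_lim)
    then show ?thesis
      using True by (simp add: R_def reduced_entry_def algebra_simps split: if_splits)
  next
    case False
    then have "R k i j = 0" for k by (auto simp: R_def)
    moreover have "(\<lambda>k. X k i j) \<longlonglongrightarrow> 0"
      using that False Xin_lim[of i] Xin_lim[of j] sym[of n j] by (auto simp: less_Suc_eq Xn)
    ultimately show ?thesis by simp
  qed
  show False
  proof (rule strong_prop_limit[OF strong_prop, where X = R and b = 1 and Y = Y])
    show "R k i j = R k j i" if "i < n" "j < n" for k i j
      using that sym[of i j k] by (simp add: R_def reduced_entry_def)
    show "(\<lambda>k. R k i j) \<longlonglongrightarrow> 0" if "i < n" "j < n" "(i, j) \<notin> N" for i j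
    proof -
      have "R k i j = 0" for k using supp[OF that, of k] by (simp add: R_def)
      then show ?thesis by simp
    qed
    have "(\<lambda>k. 1 - (\<Sum>i<n. (2 * X k i n / (e k)\<^sup>2)\<^sup>2)) \<longlonglongrightarrow> 1 - (\<Sum>i<n. 0\<^sup>2)"
      by (intro tendsto_diff tendsto_const tendsto_sum tendsto_power \<xi>_lim) auto
    moreover have "1 - (\<Sum>i<n. (2 * X k i n / (e k)\<^sup>2)\<^sup>2) = (\<Sum>i<n. \<Sum>j<n. (R k i j)\<^sup>2)" for k
      using norm[of k] by (simp add: reduced_norm_def R_def)
    ultimately show "(\<lambda>k. \<Sum>i<n. \<Sum>j<n. (R k i j)\<^sup>2) \<longlonglongrightarrow> 1" by simp
    show "(\<lambda>k. Y k p q - conj_entry n Q (R k) p q) \<longlonglongrightarrow> 0" if pq: "p < n" "q < n" for p q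
    proof -
      have "(\<lambda>k. conj_entry (Suc n) (U k) (\<lambda>i j. X k i j - R k i j) p q) \<longlonglongrightarrow>
        (\<Sum>i<Suc n. \<Sum>j<Suc n. border n Q p i * 0 * border n Q q j)"
        unfolding conj_entry_def using pq by (intro tendsto_intros U_lim XR) auto
      then have "(\<lambda>k. conj_entry (Suc n) (U k) (\<lambda>i j. X k i j - R k i j) p q) \<longlonglongrightarrow> 0" by simp
      moreover have "conj_entry (Suc n) (U k) (\<lambda>i j. X k i j - R k i j) p q = Y k p q - conj_entry n (U k) (R k) p q" for k
        unfolding Y_def cjR[symmetric] unfolding conj_entry_def sum_subtractf[symmetric] by (simp add: algebra_simps)
      moreover have "(\<lambda>k. U k i j) \<longlonglongrightarrow> Q i j" if "i < n" "j < n" for i j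
        using U_lim[of i j] that by (simp add: border_def)
      then have "(\<lambda>k. conj_entry n (U k) (R k) p q - conj_entry n Q (R k) p q) \<longlonglongrightarrow> 0"
        using R1' pq by (intro tendsto_conj_entry_diff) auto
      ultimately have "(\<lambda>k. (Y k p q - conj_entry n (U k) (R k) p q) + (conj_entry n (U k) (R k) p q - conj_entry n Q (R k) p q)) \<longlonglongrightarrow> 0 + 0"
        by (intro tendsto_add) auto
      then show ?thesis by simp
    qed
    show "(\<lambda>k. (d p - d q) * Y k p q) \<longlonglongrightarrow> 0" if pq: "p < n" "q < n" for p q
    proof (rule tendsto_comm_unperturbed[OF _ c_lim])
      show "\<bar>Y k p q\<bar> \<le> real (Suc n) * real (Suc n) * b" for k
        using pq by (intro Yb) auto
      show "(\<lambda>k. (perturbed d (c k) p - perturbed d (c k) q) * Y k p q) \<longlonglongrightarrow> 0"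
        using critical_tendsto(1)[OF crit e_lim, of p q] pq by (simp add: Y_def perturbed_lt)
    qed
    show "(\<lambda>k. \<Sum>i | i < n \<and> d i = x. Y k i i) \<longlonglongrightarrow> 0" if "\<not> sp" "x \<in> d ` {..<n}" for x
    proof -
      have "{i. i < n \<and> snoc n d t i = x} = {i. i < n \<and> d i = x}" for t
        by (auto simp: snoc_def)
      then show ?thesis
        using critical_tendsto(2)[OF crit e_lim, of x] that by (simp add: L Y_def)
    qed
  qed (use R1' in auto)
qed

end

section \<open>Existence of the split matrix\<close>

lemma eventually_less_inverse_power:
  "\<forall>\<^sub>F e in at_right (0::real). x < 1 / e ^ 4"
  unfolding eventually_at_right_field
proof (intro exI[of _ "1 / (\<bar>x\<bar> + 1)"] conjI allI impI)
  fix e :: real assume e: "0 < e" "e < 1 / (\<bar>x\<bar> + 1)"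
  have "(\<bar>x\<bar> + 1) * e < 1" using e(2) by (simp add: pos_less_divide_eq mult.commute add_nonneg_pos)
  moreover have "e \<le> 1" using e(2) by (rule order_trans[OF less_imp_le]) simp
  then have "e ^ 4 \<le> e ^ 1" using e(1) by (intro power_decreasing) auto
  then have "x * e ^ 4 \<le> (\<bar>x\<bar> + 1) * e" using e(1) by (intro mult_mono) auto
  ultimately show "x < 1 / e ^ 4" using e(1) by (simp add: pos_less_divide_eq)
qed simp

lemma frob_lincomb: "frob m (\<lambda>i l. x * (A i l - y * B i l)) S = x * (frob m A S - y * frob m B S)"
  unfolding frob_def by (simp add: sum_distrib_left sum_subtractf[symmetric] algebra_simps)

text \<open>The strong property of the enlarged matrix before the rotation by 45 degrees. The
  admissible \<open>X\<close> are dual to the linear constraints imposed on it: zeros at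
  \<open>N\<close>, and the last column proportional to column \<open>w\<close> entry by entry. The
  corner \<open>(n, n)\<close> is unconstrained for the matrix, which is why
  \<open>X n n = 0\<close>.\<close>

definition contracted_strong_prop :: "bool \<Rightarrow> nat \<Rightarrow> nat \<Rightarrow> (nat \<Rightarrow> real) \<Rightarrow> (nat \<times> nat) set \<Rightarrow>
    (nat \<Rightarrow> nat \<Rightarrow> real) \<Rightarrow> (nat \<Rightarrow> real) \<Rightarrow> bool" where
  "contracted_strong_prop sp n w cf N U d \<longleftrightarrow> (\<forall>X.
     (\<forall>i\<le>n. \<forall>j\<le>n. X i j = X j i) \<longrightarrow> X n n = 0 \<longrightarrow>
     (\<forall>i<n. \<forall>j<n. (i, j) \<notin> N \<longrightarrow> reduced_entry n w cf X i j = 0) \<longrightarrow>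
     (\<forall>p\<le>n. \<forall>q\<le>n. (d p - d q) * conj_entry (Suc n) U X p q = 0) \<longrightarrow>
     (\<not> sp \<longrightarrow> (\<forall>x. (\<Sum>k | k < Suc n \<and> d k = x. conj_entry (Suc n) U X k k) = 0)) \<longrightarrow>
     (\<forall>i\<le>n. \<forall>j\<le>n. X i j = 0))"

lemma contracted_strong_prop_D:
  assumes strong_prop: "contracted_strong_prop sp n w cf N U d"
    and sym: "\<And>i j. i \<le> n \<Longrightarrow> j \<le> n \<Longrightarrow> X i j = X j i" and Xn: "X n n = 0"
    and supp: "\<And>i j. i < n \<Longrightarrow> j < n \<Longrightarrow> (i, j) \<notin> N \<Longrightarrow> reduced_entry n w cf X i j = 0"
    and comm: "\<And>p q. p \<le> n \<Longrightarrow> q \<le> n \<Longrightarrow> (d p - d q) * conj_entry (Suc n) U X p q = 0"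
    and tr: "\<And>x. \<not> sp \<Longrightarrow> (\<Sum>k | k < Suc n \<and> d k = x. conj_entry (Suc n) U X k k) = 0"
  shows "\<forall>i\<le>n. \<forall>j\<le>n. X i j = 0"
proof -
  have a: "\<forall>i\<le>n. \<forall>j\<le>n. X i j = X j i" using sym by blast
  have b: "\<forall>i<n. \<forall>j<n. (i, j) \<notin> N \<longrightarrow> reduced_entry n w cf X i j = 0" using supp by blast
  have c: "\<forall>p\<le>n. \<forall>q\<le>n. (d p - d q) * conj_entry (Suc n) U X p q = 0" using comm by blast
  have e: "\<not> sp \<longrightarrow> (\<forall>x. (\<Sum>k | k < Suc n \<and> d k = x. conj_entry (Suc n) U X k k) = 0)" using tr by blast
  show ?thesis
    by (rule spec[OF strong_prop[unfolded contracted_strong_prop_def], of X, THEN mp, OF a, THEN mp, OF Xn, THEN mp, OF b,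
      THEN mp, OF c, THEN mp, OF e])
qed

text \<open>The scheme is that of \<open>supergraph_realization\<close>, started at the direct sum
  with \<open>t\<close>, where the last column is 0 and so violates the proportionality constraints
  by a fixed amount. The parameter \<open>t0\<close> lets the caller keep \<open>t\<close> away from
  eigenvalues that are still to be added.\<close>

lemma decontraction_realization:
  assumes Q: "orth n Q" and strong_prop: "strong_prop sp n N Q d"
    and N: "N \<subseteq> {..<n} \<times> {..<n}" "\<And>i j. (i, j) \<in> N \<Longrightarrow> (j, i) \<in> N"
    and zero: "\<And>i j. (i, j) \<in> N \<Longrightarrow> diag_form n Q d i j = 0"
    and w: "w < n" and cfw: "cf w = 0"
  obtains U \<phi> t where "orth (Suc n) U" "strict_mono_on (d ` {..<n}) \<phi>" "\<And>x. sp \<Longrightarrow> \<phi> x = x"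
    "t0 < t" "\<And>k. k < n \<Longrightarrow> \<phi> (d k) < t"
    "\<And>i j. (i, j) \<in> N \<Longrightarrow> diag_form (Suc n) U (snoc n (\<phi> \<circ> d) t) i j = 0"
    "\<And>i j. i < n \<Longrightarrow> j < n \<Longrightarrow> diag_form n Q d i j \<noteq> 0 \<Longrightarrow> diag_form (Suc n) U (snoc n (\<phi> \<circ> d) t) i j \<noteq> 0"
    "\<And>i. i < n \<Longrightarrow> diag_form (Suc n) U (snoc n (\<phi> \<circ> d) t) i n = cf i * diag_form (Suc n) U (snoc n (\<phi> \<circ> d) t) i w"
    "diag_form (Suc n) U (snoc n (\<phi> \<circ> d) t) w w < diag_form (Suc n) U (snoc n (\<phi> \<circ> d) t) n n"
    "contracted_strong_prop sp n w cf N U (snoc n (\<phi> \<circ> d) t)"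
proof -
  define L where "L = (if sp then {} else d ` {..<n})"
  \<comment> \<open>At the direct sum the constraint of row \<open>i\<close> fails by
    \<open>cf i * diag_form n Q d i w\<close>; the sum of these errors, after the weight
    \<open>e\<^sup>2\<close>, bounds the starting residual.\<close>
  define K where "K = (\<Sum>i<n. \<bar>cf i * diag_form n Q d i w\<bar>) + 1"
  define B where "B = 4 * real (Suc n) + 1"
  define MM where "MM e z = diag_form (Suc n) (fst z) (perturbed (snoc n d (1 / e ^ 4)) (snd z))"
    for e :: real and z :: "(nat \<Rightarrow> nat \<Rightarrow> real) \<times> (real \<Rightarrow> real)"
  define G where "G e z \<longleftrightarrow> e < 1 \<and> orth (Suc n) (fst z) \<and> (\<forall>x. x \<notin> L \<longrightarrow> snd z x = 0) \<and> snd z (1 / e ^ 4) = 0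
      \<and> dist1 (Suc n) L (border n Q) (fst z) (snd z) \<le> K * e \<and> (\<forall>i<n. \<bar>MM e z i n - cf i * MM e z i w\<bar> \<le> K)"
    for e :: real and z :: "(nat \<Rightarrow> nat \<Rightarrow> real) \<times> (real \<Rightarrow> real)"
  have K: "K > 0" by (auto simp: K_def intro: add_nonneg_pos sum_nonneg)
  have finL: "finite L" and finN: "finite N"
    using N(1) finite_subset by (auto simp: L_def)
  have lim: "decontraction_limit n w cf Q d L K e (\<lambda>k. fst (z k)) (\<lambda>k. snd (z k))"
    if "\<And>k. 0 < e k" "e \<longlonglongrightarrow> 0" "\<And>k. G (e k) (z k)" for e z
    using that w Q finL by unfold_locales (auto simp: G_def MM_def)
  have E1: "\<forall>\<^sub>F e in at_right 0. \<forall>z. G e z \<longrightarrow> strict_mono_on (d ` {..<n}) (\<lambda>x. x + snd z x)"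
  proof (rule eventually_at_right_0_seqI)
    fix e z assume e: "\<And>k. 0 < e k" "e \<longlonglongrightarrow> 0" and G: "\<And>k. G (e k) (z k)"
      and no: "\<And>k. \<not> strict_mono_on (d ` {..<n}) (\<lambda>x. x + snd (z k) x)"
    interpret decontraction_limit n w cf Q d L K e "\<lambda>k. fst (z k)" "\<lambda>k. snd (z k)" by (rule lim[OF e G])
    have "\<forall>\<^sub>F k in sequentially. strict_mono_on (d ` {..<n}) (\<lambda>x. x + snd (z k) x)"
      by (rule eventually_strict_mono_on) (use c_lim in auto)
    then show False using no by simp
  qed
  have "\<forall>\<^sub>F e in at_right 0. \<forall>z. G e z \<longrightarrow> diag_form n Q d i j \<noteq> 0 \<longrightarrow> MM e z i j \<noteq> 0"
    if ij: "i < n" "j < n" for i j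
  proof (rule eventually_at_right_0_seqI)
    fix e z assume e: "\<And>k. 0 < e k" "e \<longlonglongrightarrow> 0" and G: "\<And>k. G (e k) (z k)"
      and no: "\<And>k. \<not> (diag_form n Q d i j \<noteq> 0 \<longrightarrow> MM (e k) (z k) i j \<noteq> 0)"
    interpret decontraction_limit n w cf Q d L K e "\<lambda>k. fst (z k)" "\<lambda>k. snd (z k)" by (rule lim[OF e G])
    have "diag_form n Q d i j = 0"
      using M_lim[OF ij] no by (simp add: MM_def LIMSEQ_const_iff)
    then show False using no by simp
  qed
  then have E2: "\<forall>\<^sub>F e in at_right 0. \<forall>i\<in>{..<n}. \<forall>j\<in>{..<n}. \<forall>z. G e z \<longrightarrow> diag_form n Q d i j \<noteq> 0 \<longrightarrow> MM e z i j \<noteq> 0"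
    by (intro eventually_ball_finite ballI) auto
  have E3: "\<forall>\<^sub>F e in at_right 0. \<forall>z. G e z \<longrightarrow> MM e z w w < MM e z n n"
  proof (rule eventually_at_right_0_seqI)
    fix e z assume e: "\<And>k. 0 < e k" "e \<longlonglongrightarrow> 0" and G: "\<And>k. G (e k) (z k)"
      and no: "\<And>k. \<not> MM (e k) (z k) w w < MM (e k) (z k) n n"
    interpret decontraction_limit n w cf Q d L K e "\<lambda>k. fst (z k)" "\<lambda>k. snd (z k)" by (rule lim[OF e G])
    show False using M_corner no by (simp add: MM_def)
  qed
  have "\<forall>\<^sub>F e in at_right 0. \<forall>z. G e z \<longrightarrow> x + snd z x < 1 / e ^ 4" for x
  proof (rule eventually_at_right_0_seqI)
    fix e z assume e: "\<And>k. 0 < e k" "e \<longlonglongrightarrow> 0" and G: "\<And>k. G (e k) (z k)"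
      and no: "\<And>k. \<not> x + snd (z k) x < 1 / e k ^ 4"
    interpret decontraction_limit n w cf Q d L K e "\<lambda>k. fst (z k)" "\<lambda>k. snd (z k)" by (rule lim[OF e G])
    have "(\<lambda>k. (x + snd (z k) x) * e k ^ 4) \<longlonglongrightarrow> (x + 0) * 0 ^ 4"
      by (intro tendsto_intros e(2) c_lim)
    then have "\<forall>\<^sub>F k in sequentially. (x + snd (z k) x) * e k ^ 4 < 1"
      by (intro order_tendstoD(2)) auto
    then have "\<forall>\<^sub>F k in sequentially. x + snd (z k) x < 1 / e k ^ 4"
      by (rule eventually_mono) (simp only: pos_less_divide_eq[OF zero_less_power[OF e(1)]])
    then show False using no by simp
  qed
  then have E4: "\<forall>\<^sub>F e in at_right 0. \<forall>x\<in>d ` {..<n}. \<forall>z. G e z \<longrightarrow> x + snd z x < 1 / e ^ 4"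
    by (intro eventually_ball_finite ballI) auto
  have E5: "\<forall>\<^sub>F e in at_right 0. \<forall>zX. G e (fst zX) \<and> (\<forall>i\<le>n. \<forall>j\<le>n. snd zX i j = snd zX j i) \<and> snd zX n n = 0
      \<and> (\<forall>i<n. \<forall>j<n. (i, j) \<notin> N \<longrightarrow> reduced_entry n w cf (snd zX) i j = 0) \<and> reduced_norm n w cf e (snd zX) > 0
      \<longrightarrow> \<not> critical (Suc n) n L (snoc n d (1 / e ^ 4)) (fst (fst zX)) (snd (fst zX)) (B * e * sqrt (reduced_norm n w cf e (snd zX))) (snd zX)"
  proof (rule eventually_at_right_0_seqI)
    fix e :: "nat \<Rightarrow> real" and zX :: "nat \<Rightarrow> ((nat \<Rightarrow> nat \<Rightarrow> real) \<times> (real \<Rightarrow> real)) \<times> (nat \<Rightarrow> nat \<Rightarrow> real)"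
    assume e: "\<And>k. 0 < e k" "e \<longlonglongrightarrow> 0"
      and A: "\<And>k. G (e k) (fst (zX k)) \<and> (\<forall>i\<le>n. \<forall>j\<le>n. snd (zX k) i j = snd (zX k) j i) \<and> snd (zX k) n n = 0
      \<and> (\<forall>i<n. \<forall>j<n. (i, j) \<notin> N \<longrightarrow> reduced_entry n w cf (snd (zX k)) i j = 0) \<and> reduced_norm n w cf (e k) (snd (zX k)) > 0"
      and no: "\<And>k. \<not> \<not> critical (Suc n) n L (snoc n d (1 / e k ^ 4)) (fst (fst (zX k))) (snd (fst (zX k))) (B * e k * sqrt (reduced_norm n w cf (e k) (snd (zX k)))) (snd (zX k))"
    define z where "z k = fst (zX k)" for k
    define a where "a k = 1 / sqrt (reduced_norm n w cf (e k) (snd (zX k)))" for k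
    define X where "X k i j = a k * snd (zX k) i j" for k i j
    have G: "\<And>k. G (e k) (z k)" using A by (simp add: z_def)
    interpret decontraction_limit n w cf Q d L K e "\<lambda>k. fst (z k)" "\<lambda>k. snd (z k)" by (rule lim[OF e G])
    have reduced_entry: "reduced_entry n w cf (X k) i j = a k * reduced_entry n w cf (snd (zX k)) i j" for k i j
      by (simp add: reduced_entry_def X_def algebra_simps)
    have a: "a k > 0" "(a k)\<^sup>2 * reduced_norm n w cf (e k) (snd (zX k)) = 1" "B * e k = a k * (B * e k * sqrt (reduced_norm n w cf (e k) (snd (zX k))))" for k
      using A[of k] by (auto simp: a_def power_divide)
    show False
    proof (rule no_critical_sequence[OF strong_prop L_def, of X])
      show "X k i j = X k j i" if "i \<le> n" "j \<le> n" for k i j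
      proof -
        have "snd (zX k) i j = snd (zX k) j i" using A[of k] that by blast
        then show ?thesis by (simp only: X_def)
      qed
      show "X k n n = 0" for k using A[of k] by (simp add: X_def)
      show "reduced_entry n w cf (X k) i j = 0" if "i < n" "j < n" "(i, j) \<notin> N" for k i j
        using A[of k] that by (simp add: reduced_entry)
      have "reduced_norm n w cf (e k) (X k) = (a k)\<^sup>2 * reduced_norm n w cf (e k) (snd (zX k))" for k
        unfolding reduced_norm_def reduced_entry distrib_left sum_distrib_left
        by (simp add: X_def power_mult_distrib power_divide mult_ac)
      then show "reduced_norm n w cf (e k) (X k) = 1" for k using a(2) by simp
      show "critical (Suc n) n L (snoc n d (1 / e k ^ 4)) (fst (z k)) (snd (z k)) (B * e k) (X k)" for k
      proof -
        have "critical (Suc n) n L (snoc n d (1 / e k ^ 4)) (fst (z k)) (snd (z k))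
          (a k * (B * e k * sqrt (reduced_norm n w cf (e k) (snd (zX k))))) (\<lambda>i j. a k * snd (zX k) i j)"
          by (rule critical_scale) (use no[of k] a(1)[of k] in \<open>auto simp: z_def\<close>)
        then show ?thesis
          by (simp only: a(3)[of k, symmetric] X_def[abs_def])
      qed
    qed
  qed
  have E6: "\<forall>\<^sub>F e in at_right (0::real). 0 < e \<and> e < min 1 (1 / K)"
    unfolding eventually_at_right_field by (intro exI[of _ "min 1 (1 / K)"]) (use K in auto)
  \<comment> \<open>With \<open>t\<close> above \<open>L\<close>, the shift at \<open>t\<close> is 0
    and the index \<open>n\<close> lies in no class of an eigenvalue that may move.\<close>
  have E7: "\<forall>\<^sub>F e in at_right 0. \<forall>x\<in>insert t0 L. x < 1 / e ^ 4"
    by (intro eventually_ball_finite ballI eventually_less_inverse_power) (use finL in auto)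
  obtain e where e': "0 < e \<and> e < min 1 (1 / K)" and e7: "\<forall>x\<in>insert t0 L. x < 1 / e ^ 4"
    and e1: "\<forall>z. G e z \<longrightarrow> strict_mono_on (d ` {..<n}) (\<lambda>x. x + snd z x)"
    and e2: "\<forall>i\<in>{..<n}. \<forall>j\<in>{..<n}. \<forall>z. G e z \<longrightarrow> diag_form n Q d i j \<noteq> 0 \<longrightarrow> MM e z i j \<noteq> 0"
    and e3: "\<forall>z. G e z \<longrightarrow> MM e z w w < MM e z n n"
    and e4: "\<forall>x\<in>d ` {..<n}. \<forall>z. G e z \<longrightarrow> x + snd z x < 1 / e ^ 4"
    and e5: "\<forall>zX. G e (fst zX) \<and> (\<forall>i\<le>n. \<forall>j\<le>n. snd zX i j = snd zX j i) \<and> snd zX n n = 0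
      \<and> (\<forall>i<n. \<forall>j<n. (i, j) \<notin> N \<longrightarrow> reduced_entry n w cf (snd zX) i j = 0) \<and> reduced_norm n w cf e (snd zX) > 0
      \<longrightarrow> \<not> critical (Suc n) n L (snoc n d (1 / e ^ 4)) (fst (fst zX)) (snd (fst zX)) (B * e * sqrt (reduced_norm n w cf e (snd zX))) (snd zX)"
    using eventually_happens'[OF trivial_limit_at_right_real eventually_conj[OF E6 eventually_conj[OF E7 eventually_conj[OF E1
      eventually_conj[OF E2 eventually_conj[OF E3 eventually_conj[OF E4 E5]]]]]]]
    by (elim exE conjE) (rule that, (rule conjI)?, assumption+)
  have e: "0 < e" "e < 1" "e < 1 / K" using e' by auto
  define t where "t = 1 / e ^ 4"
  define D where "D = snoc n d t"
  define J where "J = N \<union> (\<lambda>i. (i, n)) ` {..<n}"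
  define C where "C ab i l = (if snd ab < n then of_bool (i = fst ab \<and> l = snd ab)
    else e\<^sup>2 * (of_bool (i = fst ab \<and> l = n) - cf (fst ab) * of_bool (i = fst ab \<and> l = w)) :: real)"
    for ab :: "nat \<times> nat" and i l :: nat
  have finJ: "finite J" using finN by (simp add: J_def)
  have sumJ: "(\<Sum>j\<in>J. f j) = (\<Sum>j\<in>N. f j) + (\<Sum>i<n. f (i, n))" for f :: "nat \<times> nat \<Rightarrow> real"
  proof -
    have "(\<Sum>j\<in>J. f j) = (\<Sum>j\<in>N. f j) + (\<Sum>j\<in>(\<lambda>i. (i, n)) ` {..<n}. f j)"
      unfolding J_def using finN N(1) by (intro sum.union_disjoint) auto
    also have "(\<Sum>j\<in>(\<lambda>i. (i, n)) ` {..<n}. f j) = (\<Sum>i<n. f (i, n))"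
      by (subst sum.reindex) (auto simp: inj_on_def)
    finally show ?thesis .
  qed
  have pairN: "frob (Suc n) (C (a, b)) S = S a b" if "(a, b) \<in> N" for a b S
    using that N(1) frob_unit[of a "Suc n" b S] by (auto simp: C_def[abs_def])
  have pairn: "frob (Suc n) (C (a, n)) S = e\<^sup>2 * (S a n - cf a * S a w)" if "a < n" for a S
    using that w by (simp add: C_def[abs_def] frob_lincomb frob_unit)
  have resN: "resid (Suc n) D C (\<lambda>_. 0) U c (a, b) = diag_form (Suc n) U (perturbed D c) a b" if "(a, b) \<in> N" for U c a b
    unfolding resid_def by (simp add: pairN that)
  have resn: "resid (Suc n) D C (\<lambda>_. 0) U c (a, n) = e\<^sup>2 * (diag_form (Suc n) U (perturbed D c) a n - cf a * diag_form (Suc n) U (perturbed D c) a w)"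
    if "a < n" for U c a
    unfolding resid_def by (simp add: pairn that)
  have dg0: "diag_form (Suc n) (border n Q) (perturbed D (\<lambda>_. 0)) i j = (if i < n \<and> j < n then diag_form n Q d i j else 0)"
    if "i < n" "j \<le> n" for i j
    using that unfolding diag_form_def by (auto simp: border_def perturbed_def D_def snoc_def intro!: sum.neutral)
  have start: "sqrt (\<Sum>j\<in>J. (resid (Suc n) D C (\<lambda>_. 0) (border n Q) (\<lambda>_. 0) j)\<^sup>2) \<le> K * e\<^sup>2"
  proof -
    have "sqrt (\<Sum>j\<in>J. (resid (Suc n) D C (\<lambda>_. 0) (border n Q) (\<lambda>_. 0) j)\<^sup>2)
      \<le> (\<Sum>j\<in>J. \<bar>resid (Suc n) D C (\<lambda>_. 0) (border n Q) (\<lambda>_. 0) j\<bar>)"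
      by (rule sqrt_sum_squares_le_sum_abs[OF finJ])
    also have "\<dots> = (\<Sum>j\<in>N. 0) + (\<Sum>i<n. e\<^sup>2 * \<bar>cf i * diag_form n Q d i w\<bar>)"
      unfolding sumJ
    proof (intro arg_cong2[where f = "(+)"] sum.cong refl)
      fix j assume j: "j \<in> N"
      then have "diag_form (Suc n) (border n Q) (perturbed D (\<lambda>_. 0)) (fst j) (snd j) = 0"
        using dg0[of "fst j" "snd j"] zero[of "fst j" "snd j"] N(1) by auto
      then show "\<bar>resid (Suc n) D C (\<lambda>_. 0) (border n Q) (\<lambda>_. 0) j\<bar> = 0"
        using resN[of "fst j" "snd j"] j by simp
    next
      fix i assume "i \<in> {..<n}"
      then show "\<bar>resid (Suc n) D C (\<lambda>_. 0) (border n Q) (\<lambda>_. 0) (i, n)\<bar> = e\<^sup>2 * \<bar>cf i * diag_form n Q d i w\<bar>"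
        using w by (simp add: resn dg0 abs_mult)
    qed
    also have "\<dots> = (\<Sum>i<n. \<bar>cf i * diag_form n Q d i w\<bar>) * e\<^sup>2"
      by (simp add: sum_distrib_left[symmetric] mult.commute)
    also have "\<dots> \<le> K * e\<^sup>2"
      unfolding K_def by (intro mult_right_mono) auto
    finally show ?thesis .
  qed
  have Ke: "K * e\<^sup>2 < e"
  proof -
    have "K * e < 1" using e K by (simp add: pos_less_divide_eq mult.commute)
    then have "K * e * e < 1 * e" using e by (intro mult_strict_right_mono)
    then show ?thesis by (simp add: power2_eq_square mult_ac)
  qed
  obtain U c where U: "orth (Suc n) U" and c0: "\<And>l. l \<notin> L \<Longrightarrow> c l = 0"
    and le: "sqrt (\<Sum>j\<in>J. (resid (Suc n) D C (\<lambda>_. 0) U c j)\<^sup>2) + e * dist1 (Suc n) L (border n Q) U c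
      \<le> sqrt (\<Sum>j\<in>J. (resid (Suc n) D C (\<lambda>_. 0) (border n Q) (\<lambda>_. 0) j)\<^sup>2)"
    and cr1: "\<And>p q. p < Suc n \<Longrightarrow> q < Suc n \<Longrightarrow>
      \<bar>\<Sum>j\<in>J. resid (Suc n) D C (\<lambda>_. 0) U c j * frob (Suc n) (C j) (\<lambda>i l. (perturbed D c p - perturbed D c q) * (U p i * U q l + U q i * U p l))\<bar>
        \<le> e * (4 * real (Suc n)) * sqrt (\<Sum>j\<in>J. (resid (Suc n) D C (\<lambda>_. 0) U c j)\<^sup>2)"
    and cr2: "\<And>x. x \<in> L \<Longrightarrow>
      \<bar>\<Sum>j\<in>J. resid (Suc n) D C (\<lambda>_. 0) U c j * frob (Suc n) (C j) (\<lambda>i l. \<Sum>k | k < Suc n \<and> D k = x. U k i * U k l)\<bar>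
        \<le> e * sqrt (\<Sum>j\<in>J. (resid (Suc n) D C (\<lambda>_. 0) U c j)\<^sup>2)"
    by (rule near_critical_point[OF orth_border[OF Q] finJ finL e(1), of D C "\<lambda>_. 0"]) (use start Ke in linarith, blast)
  define R where "R = resid (Suc n) D C (\<lambda>_. 0) U c"
  define M where "M = diag_form (Suc n) U (perturbed D c)"
  have R_nn: "0 \<le> sqrt (\<Sum>j\<in>J. (R j)\<^sup>2)" by (simp add: sum_nonneg)
  have dist_nn: "0 \<le> dist1 (Suc n) L (border n Q) U c"
    unfolding dist1_def by (intro add_nonneg_nonneg sum_nonneg) auto
  have "e * dist1 (Suc n) L (border n Q) U c \<le> K * e\<^sup>2"
    using le start R_nn unfolding R_def by linarith
  then have "e * dist1 (Suc n) L (border n Q) U c \<le> e * (K * e)"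
    by (simp only: power2_eq_square mult_ac)
  then have dist: "dist1 (Suc n) L (border n Q) U c \<le> K * e" using e(1) by simp
  have sqrtR: "sqrt (\<Sum>j\<in>J. (R j)\<^sup>2) \<le> K * e\<^sup>2"
    using le start mult_nonneg_nonneg[OF less_imp_le[OF e(1)] dist_nn] unfolding R_def by linarith
  \<comment> \<open>Removing the weight \<open>e\<^sup>2\<close> from the residual bound
    \<open>K * e\<^sup>2\<close> yields exactly the boundedness that controls the last row of
    \<open>U\<close>.\<close>
  have MK: "\<bar>M i n - cf i * M i w\<bar> \<le> K" if "i < n" for i
  proof -
    have "(R (i, n))\<^sup>2 \<le> (\<Sum>j\<in>J. (R j)\<^sup>2)"
      using that finJ by (intro member_le_sum) (auto simp: J_def)
    then have "sqrt ((R (i, n))\<^sup>2) \<le> sqrt (\<Sum>j\<in>J. (R j)\<^sup>2)" by (rule real_sqrt_le_mono)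
    also note sqrtR
    finally have "e\<^sup>2 * \<bar>M i n - cf i * M i w\<bar> \<le> e\<^sup>2 * K"
      using that by (simp add: R_def resn M_def abs_mult mult.commute)
    then show ?thesis using e(1) by simp
  qed
  have ct: "c t = 0" using e7 by (intro c0) (auto simp: t_def)
  have G: "G e (U, c)"
    using e U c0 ct dist MK by (auto simp: G_def MM_def M_def D_def t_def)
  define \<phi> where "\<phi> x = x + c x" for x
  have \<phi>d: "perturbed D c = snoc n (\<phi> \<circ> d) t"
    using ct by (simp add: fun_eq_iff \<phi>_def perturbed_def D_def snoc_def)
  have MM: "MM e (U, c) = M" by (simp add: MM_def M_def D_def t_def)
  have nocrit: "\<not> reduced_norm n w cf e X > 0"
    if "\<And>i j. i \<le> n \<Longrightarrow> j \<le> n \<Longrightarrow> X i j = X j i" "X n n = 0"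
      "\<And>i j. i < n \<Longrightarrow> j < n \<Longrightarrow> (i, j) \<notin> N \<Longrightarrow> reduced_entry n w cf X i j = 0"
      "critical (Suc n) n L D U c (B * e * sqrt (reduced_norm n w cf e X)) X" for X
  proof -
    have "\<forall>i\<le>n. \<forall>j\<le>n. X i j = X j i" using that(1) by blast
    then show ?thesis
      using spec[OF e5, of "((U, c), X)"] G that(2-4) unfolding D_def t_def fst_conv snd_conv by blast
  qed
  have reduced_norm_nn: "reduced_norm n w cf e X \<ge> 0" for X
    unfolding reduced_norm_def by (intro add_nonneg_nonneg sum_nonneg) auto
  define r where "r i j = (if (i, j) \<in> N then R (i, j) else 0)" for i j
  define g where "g i j = (if j = w then cf i * R (i, n) else 0)" for i j
  define h where "h i j = (if i < n \<and> j = n then e\<^sup>2 / 2 * R (i, n) else 0)" for i j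
  \<comment> \<open>The symmetric matrix representing the residual as a functional on symmetric
    matrices. The halves come from symmetrisation. By construction its reduced entries are
    \<open>r\<close> and \<open>2 * X i n / e\<^sup>2\<close> is \<open>R (i, n)\<close>, so its
    reduced norm is the squared norm of the residual.\<close>
  define X where "X i j = (if i < n \<and> j < n then r i j
      - e\<^sup>2 / 2 * (g i j + g j i) else h i j + h j i)" for i j
  have rsym: "r i j = r j i" for i j
    unfolding r_def R_def using N(2)[of i j] N(2)[of j i] diag_form_sym[of "Suc n" U "perturbed D c" i j]
    by (auto simp: resN)
  have Xsym: "X i j = X j i" for i j
  proof (cases "i < n \<and> j < n")
    case True
    then have "X i j = r i j - e\<^sup>2 / 2 * (g i j + g j i)" "X j i = r j i - e\<^sup>2 / 2 * (g j i + g i j)"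
      by (simp_all only: X_def if_True simp_thms)
    then show ?thesis by (simp only: rsym[of i j] add.commute[of "g i j"])
  next
    case False
    then have "(i < n \<and> j < n) = False" "(j < n \<and> i < n) = False" by auto
    then have "X i j = h i j + h j i" "X j i = h j i + h i j"
      by (simp_all only: X_def if_False)
    then show ?thesis by (simp only: add.commute)
  qed
  have Xnn: "X n n = 0" by (simp add: X_def h_def)
  have redrX: "reduced_entry n w cf X i j = r i j" if "i < n" "j < n" for i j
    using that by (simp add: reduced_entry_def X_def g_def h_def)
  have nrmX: "reduced_norm n w cf e X = (\<Sum>j\<in>J. (R j)\<^sup>2)"
  proof -
    have "(\<Sum>j\<in>N. (R j)\<^sup>2) = (\<Sum>i<n. \<Sum>j<n. (r i j)\<^sup>2)"
      using sum_restrict_pairs[OF N(1), of "\<lambda>i j. (r i j)\<^sup>2"] by (auto simp: r_def case_prod_beta intro!: sum.cong)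
    moreover have "2 * X i n / e\<^sup>2 = R (i, n)" if "i < n" for i
      using that e(1) by (simp add: X_def h_def)
    ultimately show ?thesis
      unfolding reduced_norm_def sumJ by (simp add: redrX)
  qed
  have eq: "(\<Sum>j\<in>J. R j * frob (Suc n) (C j) S) = frob (Suc n) X S" if S: "\<And>i j. S i j = S j i" for S
  proof -
    have "(\<Sum>j\<in>J. R j * frob (Suc n) (C j) S)
      = (\<Sum>j\<in>N. R j * frob (Suc n) (C j) S) + (\<Sum>i<n. R (i, n) * (e\<^sup>2 * (S i n - cf i * S i w)))"
      unfolding sumJ by (simp add: pairn)
    also have "(\<Sum>j\<in>N. R j * frob (Suc n) (C j) S) = (\<Sum>(i, j)\<in>N. r i j * S i j)"
      by (intro sum.cong) (auto simp: r_def pairN)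
    also have "\<dots> = (\<Sum>i<n. \<Sum>j<n. r i j * S i j)"
      by (rule sum_restrict_pairs[OF N(1)]) (simp add: r_def)
    finally have 1: "(\<Sum>j\<in>J. R j * frob (Suc n) (C j) S)
      = (\<Sum>i<n. \<Sum>j<n. r i j * S i j) + (\<Sum>i<n. R (i, n) * (e\<^sup>2 * (S i n - cf i * S i w)))" .
    have "(\<Sum>i<n. \<Sum>j<n. X i j * S i j) = (\<Sum>i<n. \<Sum>j<n. r i j * S i j
      - (if j = w then e\<^sup>2 / 2 * (cf i * R (i, n) * S i w) else 0) - (if i = w then e\<^sup>2 / 2 * (cf j * R (j, n) * S j w) else 0))"
      using S by (intro sum.cong refl) (auto simp: X_def g_def h_def algebra_simps)
    also have "\<dots> = (\<Sum>i<n. \<Sum>j<n. r i j * S i j) - (\<Sum>i<n. e\<^sup>2 * (cf i * R (i, n) * S i w))"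
    proof -
      have "(\<Sum>i<n. \<Sum>j<n. if i = w then e\<^sup>2 / 2 * (cf j * R (j, n) * S j w) else 0) = (\<Sum>j<n. e\<^sup>2 / 2 * (cf j * R (j, n) * S j w))"
        by (subst sum.swap) (use w in simp)
      then show ?thesis
        using w by (simp add: sum_subtractf) (simp add: sum_distrib_left[symmetric] sum_divide_distrib[symmetric])
    qed
    finally have 2: "(\<Sum>i<n. \<Sum>j<n. X i j * S i j) = (\<Sum>i<n. \<Sum>j<n. r i j * S i j) - (\<Sum>i<n. e\<^sup>2 * (cf i * R (i, n) * S i w))" .
    have "frob (Suc n) X S = (\<Sum>i<n. \<Sum>j<n. X i j * S i j) + (\<Sum>i<n. X i n * S i n) + (\<Sum>j<n. X n j * S n j) + X n n * S n n"
      unfolding frob_def by (simp add: sum.distrib)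
    also have "(\<Sum>j<n. X n j * S n j) = (\<Sum>i<n. X i n * S i n)"
      using S Xsym by simp
    also have "(\<Sum>i<n. X i n * S i n) = (\<Sum>i<n. e\<^sup>2 / 2 * (R (i, n) * S i n))"
      by (simp add: X_def h_def mult.assoc)
    finally have "frob (Suc n) X S = (\<Sum>i<n. \<Sum>j<n. r i j * S i j) - (\<Sum>i<n. e\<^sup>2 * (cf i * R (i, n) * S i w))
      + 2 * (\<Sum>i<n. e\<^sup>2 / 2 * (R (i, n) * S i n))"
      unfolding 2 by (simp add: Xnn)
    also have "\<dots> = (\<Sum>i<n. \<Sum>j<n. r i j * S i j) + (\<Sum>i<n. R (i, n) * (e\<^sup>2 * (S i n - cf i * S i w)))"
      by (simp add: sum_distrib_left sum_subtractf algebra_simps)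
    finally show ?thesis using 1 by simp
  qed
  have classes: "{k. k < Suc n \<and> D k = x} = {k. k < n \<and> D k = x}" if "x \<in> L" for x
    using e7 that by (auto simp: D_def snoc_def less_Suc_eq t_def)
  have "critical (Suc n) n L D U c (B * e * sqrt (reduced_norm n w cf e X)) X"
  proof -
    have le1: "e * (4 * real (Suc n)) * sqrt v \<le> 2 * (B * e * sqrt v)" "e * sqrt v \<le> B * e * sqrt v" if "v \<ge> 0" for v
      using e(1) that by (auto simp: B_def algebra_simps)
    have "\<bar>(perturbed D c p - perturbed D c q) * conj_entry (Suc n) U X p q\<bar> \<le> B * e * sqrt (reduced_norm n w cf e X)" if "p < Suc n" "q < Suc n" for p q
    proof -
      have "2 * \<bar>(perturbed D c p - perturbed D c q) * conj_entry (Suc n) U X p q\<bar> = \<bar>2 * ((perturbed D c p - perturbed D c q) * conj_entry (Suc n) U X p q)\<bar>"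
        by simp
      also have "\<dots> \<le> e * (4 * real (Suc n)) * sqrt (reduced_norm n w cf e X)"
      proof -
        have "(\<Sum>j\<in>J. R j * frob (Suc n) (C j) (\<lambda>i l. (perturbed D c p - perturbed D c q) * (U p i * U q l + U q i * U p l)))
          = 2 * ((perturbed D c p - perturbed D c q) * conj_entry (Suc n) U X p q)"
          by (rule trans[OF eq frob_direction(1)[OF Xsym]]) (simp add: add.commute mult.commute)
        then show ?thesis using cr1[OF that] unfolding R_def[symmetric] nrmX by (simp only:)
      qed
      also note le1(1)[OF reduced_norm_nn]
      finally show ?thesis by simp
    qed
    moreover have "\<bar>\<Sum>k | k < n \<and> D k = x. conj_entry (Suc n) U X k k\<bar> \<le> B * e * sqrt (reduced_norm n w cf e X)" if "x \<in> L" for x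
    proof -
      have "\<bar>\<Sum>k | k < n \<and> D k = x. conj_entry (Suc n) U X k k\<bar> \<le> e * sqrt (reduced_norm n w cf e X)"
      proof -
        have "(\<Sum>j\<in>J. R j * frob (Suc n) (C j) (\<lambda>i l. \<Sum>k | k < n \<and> D k = x. U k i * U k l))
          = (\<Sum>k | k < n \<and> D k = x. conj_entry (Suc n) U X k k)"
          by (rule trans[OF eq frob_direction(2)[OF Xsym]]) (simp add: mult.commute)
        then show ?thesis using cr2[OF that] unfolding R_def[symmetric] nrmX classes[OF that] by (simp only:)
      qed
      also note le1(2)[OF reduced_norm_nn]
      finally show ?thesis .
    qed
    ultimately show ?thesis unfolding critical_def by blast
  qed
  then have "\<not> reduced_norm n w cf e X > 0"
    by (rule nocrit[rotated -1]) (use Xsym redrX in \<open>auto simp: Xnn r_def\<close>)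
  then have "(\<Sum>j\<in>J. (R j)\<^sup>2) = 0"
    using reduced_norm_nn[of X] nrmX by linarith
  then have R0: "\<And>j. j \<in> J \<Longrightarrow> R j = 0"
    using finJ by (simp add: sum_nonneg_eq_0_iff)
  have mono: "strict_mono_on (d ` {..<n}) \<phi>"
    using e1 G by (auto simp: \<phi>_def[abs_def])
  have \<phi>t: "\<phi> (d k) < t" if "k < n" for k
    using e4 G that by (force simp: \<phi>_def t_def)
  show thesis
  proof (rule that[of U \<phi> t, folded \<phi>d, folded M_def])
    show "orth (Suc n) U" by (rule U)
    show "strict_mono_on (d ` {..<n}) \<phi>" by (rule mono)
    show "\<phi> x = x" if sp for x using c0 that by (simp add: \<phi>_def L_def)
    show "t0 < t" using e7 by (simp add: t_def)
    show "\<phi> (d k) < t" if "k < n" for k by (rule \<phi>t[OF that])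
    show "M i j = 0" if "(i, j) \<in> N" for i j
      using R0[of "(i, j)"] that by (simp add: J_def R_def resN M_def)
    show "M i j \<noteq> 0" if "i < n" "j < n" "diag_form n Q d i j \<noteq> 0" for i j
      using e2 G that by (auto simp: MM[symmetric])
    show "M i n = cf i * M i w" if "i < n" for i
      using R0[of "(i, n)"] that e(1) by (simp add: J_def R_def resn M_def)
    show "M w w < M n n"
      using e3 G by (auto simp: MM[symmetric])
    show "contracted_strong_prop sp n w cf N U (perturbed D c)"
      unfolding contracted_strong_prop_def
    proof (rule allI, rule impI, rule impI, rule impI, rule impI, rule impI)
      fix Z
      assume sym': "\<forall>i\<le>n. \<forall>j\<le>n. Z i j = Z j i" and Zn: "Z n n = 0"
        and supp': "\<forall>i<n. \<forall>j<n. (i, j) \<notin> N \<longrightarrow> reduced_entry n w cf Z i j = 0"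
        and comm: "\<forall>p\<le>n. \<forall>q\<le>n. (perturbed D c p - perturbed D c q) * conj_entry (Suc n) U Z p q = 0"
        and tr': "\<not> sp \<longrightarrow> (\<forall>x. (\<Sum>k | k < Suc n \<and> perturbed D c k = x. conj_entry (Suc n) U Z k k) = 0)"
      have sym: "\<And>i j. i \<le> n \<Longrightarrow> j \<le> n \<Longrightarrow> Z i j = Z j i" using sym' by blast
      have supp: "\<And>i j. i < n \<Longrightarrow> j < n \<Longrightarrow> (i, j) \<notin> N \<Longrightarrow> reduced_entry n w cf Z i j = 0" using supp' by blast
      have tr: "\<And>x. \<not> sp \<Longrightarrow> (\<Sum>k | k < Suc n \<and> perturbed D c k = x. conj_entry (Suc n) U Z k k) = 0" using tr' by blast
      have "(\<Sum>k | k < n \<and> D k = x. conj_entry (Suc n) U Z k k) = 0" if x: "x \<in> L" for x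
      proof -
        have x': "\<not> sp" "x \<in> d ` {..<n}" using x by (auto simp: L_def split: if_splits)
        then have "\<phi> x < t" using \<phi>t by auto
        then have "{k. k < Suc n \<and> perturbed D c k = \<phi> x} = {k. k < n \<and> \<phi> (d k) = \<phi> x}"
          by (auto simp: \<phi>d snoc_def less_Suc_eq)
        also have "\<dots> = {k. k < n \<and> d k = x}"
          by (rule strict_mono_on_classes[OF mono x'(2)])
        also have "\<dots> = {k. k < n \<and> D k = x}"
          by (auto simp: D_def snoc_def)
        finally show ?thesis using tr[OF x'(1), of "\<phi> x"] by simp
      qed
      moreover have "0 \<le> B * e * sqrt (reduced_norm n w cf e Z)"
        using e(1) reduced_norm_nn by (auto simp: B_def intro!: mult_nonneg_nonneg)
      ultimately have "critical (Suc n) n L D U c (B * e * sqrt (reduced_norm n w cf e Z)) Z"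
        using comm by (simp add: critical_def less_Suc_eq_le del: mult_eq_0_iff)
      from nocrit[OF sym Zn supp this] have "reduced_norm n w cf e Z = 0"
        using reduced_norm_nn[of Z] by auto
      then have "(\<Sum>i<n. \<Sum>j<n. (reduced_entry n w cf Z i j)\<^sup>2) = 0 \<and> (\<Sum>i<n. (2 * Z i n / e\<^sup>2)\<^sup>2) = 0"
        unfolding reduced_norm_def by (subst (asm) add_nonneg_eq_0_iff) (auto intro!: sum_nonneg)
      then have z1: "\<And>i j. i < n \<Longrightarrow> j < n \<Longrightarrow> reduced_entry n w cf Z i j = 0" and z2: "\<And>i. i < n \<Longrightarrow> Z i n = 0"
        using e(1) by (auto simp: sum_nonneg_eq_0_iff sum_nonneg)
      have "Z i j = 0" if "i < n" "j < n" for i j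
        using z1[OF that] z2 that by (simp add: reduced_entry_def split: if_splits)
      then show "\<forall>i\<le>n. \<forall>j\<le>n. Z i j = 0"
        using z2 Zn sym by (auto simp: order_le_less)
    qed
  qed
qed

section \<open>Realizations of minors\<close>

text \<open>\<open>simple_graph\<close> without nonemptiness, which a vertex deletion need not
  preserve.\<close>

definition sgraph :: "'a graph \<Rightarrow> bool" where
  "sgraph K \<longleftrightarrow> finite (verts K) \<and> edges K \<subseteq> {{u, v} | u v. u \<in> verts K \<and> v \<in> verts K \<and> u \<noteq> v}"

lemma sgraphE:
  assumes "sgraph K" "e \<in> edges K"
  obtains u v where "e = {u, v}" "u \<in> verts K" "v \<in> verts K" "u \<noteq> v"
  using assms unfolding sgraph_def by blast

lemma sgraphI:
  assumes "finite (verts K)" "\<And>e. e \<in> edges K \<Longrightarrow> \<exists>u v. e = {u, v} \<and> u \<in> verts K \<and> v \<in> verts K \<and> u \<noteq> v"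
  shows "sgraph K"
  using assms unfolding sgraph_def by blast

lemma sgraph_edge:
  assumes "sgraph K" "{u, v} \<in> edges K"
  shows "u \<in> verts K" "v \<in> verts K" "u \<noteq> v"
  using sgraphE[OF assms] by (auto simp: doubleton_eq_iff)

lemma sgraph_delete_edge: "sgraph K \<Longrightarrow> sgraph (delete_edge K e)"
  unfolding sgraph_def delete_edge_def by auto

lemma sgraph_delete_vertex:
  assumes "sgraph K"
  shows "sgraph (delete_vertex K v)"
proof (rule sgraphI)
  show "finite (verts (delete_vertex K v))"
    using assms by (simp add: sgraph_def delete_vertex_def)
  fix e assume "e \<in> edges (delete_vertex K v)"
  then have e: "e \<in> edges K" "v \<notin> e" by (auto simp: delete_vertex_def)
  from sgraphE[OF assms e(1)] obtain a b where "e = {a, b}" "a \<in> verts K" "b \<in> verts K" "a \<noteq> b" .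
  with e(2) show "\<exists>a b. e = {a, b} \<and> a \<in> verts (delete_vertex K v) \<and> b \<in> verts (delete_vertex K v) \<and> a \<noteq> b"
    by (simp add: delete_vertex_def) blast
qed

lemma contract_edge_edgeE:
  assumes "sgraph K" "e \<in> edges (contract_edge K u v)"
  obtains x y where "{x, y} \<in> edges K" "{x, y} \<noteq> {u, v}" "x \<in> verts K" "y \<in> verts K" "x \<noteq> y"
    "e = {if x = v then u else x, if y = v then u else y}"
proof -
  obtain e' where e': "e' \<in> edges K" "e' \<noteq> {u, v}" "e = (\<lambda>x. if x = v then u else x) ` e'"
    using assms(2) by (auto simp: contract_edge_def)
  from sgraphE[OF assms(1) e'(1)] obtain x y where xy: "e' = {x, y}" "x \<in> verts K" "y \<in> verts K" "x \<noteq> y" .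
  show thesis
    by (rule that[of x y]) (use e' xy in auto)
qed

lemma sgraph_contract_edge:
  assumes K: "sgraph K" and uv: "{u, v} \<in> edges K"
  shows "sgraph (contract_edge K u v)"
proof (rule sgraphI)
  show "finite (verts (contract_edge K u v))"
    using K by (simp add: sgraph_def contract_edge_def)
  fix e assume "e \<in> edges (contract_edge K u v)"
  from contract_edge_edgeE[OF K this] obtain x y where xy: "{x, y} \<noteq> {u, v}" "x \<in> verts K" "y \<in> verts K" "x \<noteq> y"
    "e = {if x = v then u else x, if y = v then u else y}" .
  have V: "verts (contract_edge K u v) = verts K - {v}" by (simp add: contract_edge_def)
  show "\<exists>a b. e = {a, b} \<and> a \<in> verts (contract_edge K u v) \<and> b \<in> verts (contract_edge K u v) \<and> a \<noteq> b"
    unfolding V xy(5) using xy(1-4) sgraph_edge[OF K uv]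
    by - (intro exI conjI, rule refl, auto simp: doubleton_eq_iff)
qed

lemma sgraph_minor_ops: "minor_ops H r s K \<Longrightarrow> sgraph H \<Longrightarrow> sgraph K"
  by (induction rule: minor_ops.induct)
    (auto intro: sgraph_contract_edge sgraph_delete_vertex sgraph_delete_edge)

lemma contract_edge_edges_away:
  assumes K: "sgraph K" and ab: "a \<noteq> u" "b \<noteq> u" "a \<noteq> v" "b \<noteq> v"
  shows "{a, b} \<in> edges (contract_edge K u v) \<longleftrightarrow> {a, b} \<in> edges K"
proof
  assume "{a, b} \<in> edges (contract_edge K u v)"
  from contract_edge_edgeE[OF K this] obtain x y where xy: "{x, y} \<in> edges K"
    "{a, b} = {if x = v then u else x, if y = v then u else y}" .
  have "x = a \<and> y = b \<or> x = b \<and> y = a"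
    using xy(2) ab unfolding doubleton_eq_iff by presburger
  then have "{x, y} = {a, b}" by auto
  with xy(1) show "{a, b} \<in> edges K" by simp
next
  assume "{a, b} \<in> edges K"
  moreover have "{a, b} \<noteq> {u, v}" "(\<lambda>x. if x = v then u else x) ` {a, b} = {a, b}" using ab by auto
  ultimately show "{a, b} \<in> edges (contract_edge K u v)"
    unfolding contract_edge_def by (metis (no_types, lifting) Diff_iff graph.sel(2) image_eqI singletonD)
qed

lemma contract_edge_edges_merged:
  assumes K: "sgraph K" and a: "a \<noteq> u" "a \<noteq> v"
  shows "{a, u} \<in> edges (contract_edge K u v) \<longleftrightarrow> {a, u} \<in> edges K \<or> {a, v} \<in> edges K"
proof
  assume "{a, u} \<in> edges (contract_edge K u v)"
  from contract_edge_edgeE[OF K this] obtain x y where xy: "{x, y} \<in> edges K"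
    "{a, u} = {if x = v then u else x, if y = v then u else y}" .
  have "x = a \<and> (y = u \<or> y = v) \<or> y = a \<and> (x = u \<or> x = v)"
    using xy(2) a unfolding doubleton_eq_iff by presburger
  then have "{x, y} = {a, u} \<or> {x, y} = {a, v}" by auto
  with xy(1) show "{a, u} \<in> edges K \<or> {a, v} \<in> edges K" by auto
next
  assume "{a, u} \<in> edges K \<or> {a, v} \<in> edges K"
  moreover have "{a, u} \<noteq> {u, v}" "{a, v} \<noteq> {u, v}" using a by (auto simp: doubleton_eq_iff)
  moreover have "(\<lambda>x. if x = v then u else x) ` {a, u} = {a, u}" "(\<lambda>x. if x = v then u else x) ` {a, v} = {a, u}"
    using a by auto
  ultimately show "{a, u} \<in> edges (contract_edge K u v)"
    unfolding contract_edge_def by (metis (no_types, lifting) Diff_iff graph.sel(2) image_eqI singletonD)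
qed

section \<open>Labelled realizations and restored edges\<close>

definition nonedges :: "'a graph \<Rightarrow> nat \<Rightarrow> (nat \<Rightarrow> 'a) \<Rightarrow> (nat \<times> nat) set" where
  "nonedges K n g = {(i, j). i < n \<and> j < n \<and> i \<noteq> j \<and> {g i, g j} \<notin> edges K}"

definition realizes :: "bool \<Rightarrow> 'a graph \<Rightarrow> nat \<Rightarrow> (nat \<Rightarrow> 'a) \<Rightarrow> (nat \<Rightarrow> nat \<Rightarrow> real) \<Rightarrow> (nat \<Rightarrow> real) \<Rightarrow> bool" where
  "realizes sp K n g Q d \<longleftrightarrow> bij_betw g {..<n} (verts K) \<and> orth n Q \<and>
     (\<forall>i<n. \<forall>j<n. i \<noteq> j \<longrightarrow> (diag_form n Q d i j \<noteq> 0 \<longleftrightarrow> {g i, g j} \<in> edges K)) \<and>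
     strong_prop sp n (nonedges K n g) Q d"

lemma nonedges_sym: "(i, j) \<in> nonedges K n g \<Longrightarrow> (j, i) \<in> nonedges K n g"
  by (auto simp: nonedges_def insert_commute)

lemma nonedges_subset: "nonedges K n g \<subseteq> {..<n} \<times> {..<n}"
  by (auto simp: nonedges_def)

lemma realizes_nonedge:
  "realizes sp K n g Q d \<Longrightarrow> (i, j) \<in> nonedges K n g \<Longrightarrow> diag_form n Q d i j = 0"
  by (auto simp: realizes_def nonedges_def)

lemma strong_prop_I:
  assumes "\<And>X. (\<And>i j. i < n \<Longrightarrow> j < n \<Longrightarrow> X i j = X j i) \<Longrightarrow>
    (\<And>i j. i < n \<Longrightarrow> j < n \<Longrightarrow> (i, j) \<notin> N \<Longrightarrow> X i j = 0) \<Longrightarrow>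
    (\<And>p q. p < n \<Longrightarrow> q < n \<Longrightarrow> (d p - d q) * conj_entry n Q X p q = 0) \<Longrightarrow>
    (\<And>x. \<not> sp \<Longrightarrow> (\<Sum>k | k < n \<and> d k = x. conj_entry n Q X k k) = 0) \<Longrightarrow>
    \<forall>i<n. \<forall>j<n. X i j = 0"
  shows "strong_prop sp n N Q d"
  unfolding strong_prop_def
proof (rule allI, rule impI, elim conjE)
  fix X
  assume a: "\<forall>i<n. \<forall>j<n. X i j = X j i" and b: "\<forall>i<n. \<forall>j<n. (i, j) \<notin> N \<longrightarrow> X i j = 0"
    and c: "\<forall>p<n. \<forall>q<n. (d p - d q) * conj_entry n Q X p q = 0"
    and e: "\<not> sp \<longrightarrow> (\<forall>x. (\<Sum>k | k < n \<and> d k = x. conj_entry n Q X k k) = 0)"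
  show "\<forall>i<n. \<forall>j<n. X i j = 0"
    by (rule assms) (use a b c e in blast)+
qed

lemma strong_prop_mono:
  assumes "strong_prop sp n N Q d" "N' \<subseteq> N"
  shows "strong_prop sp n N' Q d"
proof (rule strong_prop_I, intro allI impI)
  fix X i j
  assume ij: "i < n" "j < n" and X: "\<And>i j. i < n \<Longrightarrow> j < n \<Longrightarrow> X i j = X j i"
    "\<And>i j. i < n \<Longrightarrow> j < n \<Longrightarrow> (i, j) \<notin> N' \<Longrightarrow> X i j = 0"
    "\<And>p q. p < n \<Longrightarrow> q < n \<Longrightarrow> (d p - d q) * conj_entry n Q X p q = 0"
    "\<And>x. \<not> sp \<Longrightarrow> (\<Sum>k | k < n \<and> d k = x. conj_entry n Q X k k) = 0"
  show "X i j = 0"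
    by (rule strong_prop_D[OF assms(1) X(1) X(2) X(3) X(4) ij]) (use assms(2) in auto)
qed

lemma realizes_add_edges:
  assumes R: "realizes sp K n g Q d" and K': "verts K' = verts K" "edges K \<subseteq> edges K'"
  obtains U \<phi> where "strict_mono_on (d ` {..<n}) \<phi>" "\<And>x. sp \<Longrightarrow> \<phi> x = x" "realizes sp K' n g U (\<phi> \<circ> d)"
proof -
  define F where "F = {(i, j). (i, j) \<in> nonedges K n g \<and> {g i, g j} \<in> edges K'}"
  have strong_prop: "strong_prop sp n (nonedges K n g) Q d" and Q: "orth n Q" using R by (auto simp: realizes_def)
  obtain U \<phi> where U: "orth n U" and mono: "strict_mono_on (d ` {..<n}) \<phi>" and sp: "\<And>x. sp \<Longrightarrow> \<phi> x = x"
    and F: "\<And>i j. (i, j) \<in> nonedges K n g \<Longrightarrow> diag_form n U (\<phi> \<circ> d) i j \<noteq> 0 \<longleftrightarrow> (i, j) \<in> F"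
    and nz: "\<And>i j. i < n \<Longrightarrow> j < n \<Longrightarrow> diag_form n Q d i j \<noteq> 0 \<Longrightarrow> diag_form n U (\<phi> \<circ> d) i j \<noteq> 0"
    and strong_prop': "strong_prop sp n (nonedges K n g) U (\<phi> \<circ> d)"
  proof (rule supergraph_realization[OF Q strong_prop nonedges_subset nonedges_sym, of F])
    show "(j, i) \<in> F" if "(i, j) \<in> F" for i j
      using that nonedges_sym[of i j K n g] by (auto simp: F_def insert_commute)
  qed (use realizes_nonedge[OF R] in blast)+
  have "diag_form n U (\<phi> \<circ> d) i j \<noteq> 0 \<longleftrightarrow> {g i, g j} \<in> edges K'" if ij: "i < n" "j < n" "i \<noteq> j" for i j
  proof (cases "{g i, g j} \<in> edges K")
    case True
    then have "diag_form n Q d i j \<noteq> 0" using R ij by (simp add: realizes_def)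
    then show ?thesis using nz[OF ij(1,2)] True K'(2) by blast
  next
    case False
    then have "(i, j) \<in> nonedges K n g" using ij by (simp add: nonedges_def)
    then show ?thesis using F by (simp add: F_def)
  qed
  moreover have "nonedges K' n g \<subseteq> nonedges K n g"
    using K'(2) by (auto simp: nonedges_def)
  ultimately have "realizes sp K' n g U (\<phi> \<circ> d)"
    using R U strong_prop_mono[OF strong_prop'] K'(1) by (simp add: realizes_def)
  with that mono sp show thesis by blast
qed

section \<open>Restoring a deleted vertex\<close>

lemma bij_betw_snoc:
  assumes "bij_betw g {..<n} V" "v \<notin> V"
  shows "bij_betw (g(n := v)) {..<Suc n} (insert v V)"
proof -
  have "bij_betw (g(n := v)) {..<n} V"
    using assms(1) by (subst bij_betw_cong[of _ _ g]) auto
  then have "bij_betw (g(n := v)) ({..<n} \<union> {n}) (V \<union> {v})"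
    using assms(2) by (intro bij_betw_combine) (auto simp: bij_betw_def)
  then show ?thesis by (simp add: lessThan_Suc)
qed

lemma diag_form_border:
  assumes "i < Suc n" "j < Suc n" "i \<noteq> j"
  shows "diag_form (Suc n) (border n Q) (snoc n d x) i j = (if i < n \<and> j < n then diag_form n Q d i j else 0)"
  using assms unfolding diag_form_def by (auto simp: border_def snoc_def intro!: sum.neutral)

text \<open>The new row and column are all nonedges, so nothing in the pattern restricts their
  off-diagonal entries in \<open>X\<close>. Commutation does: the last column of \<open>X\<close>
  would be an eigenvector of the old matrix for \<open>x\<close>, which is not an eigenvalue, and
  hence it is 0. What is left is a test matrix for the old realization.\<close>

lemma realizes_add_isolated:
  assumes R: "realizes sp K n g Q d" and K: "sgraph K" and v: "v \<notin> verts K" and x: "x \<notin> d ` {..<n}"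
  shows "realizes sp (Graph (insert v (verts K)) (edges K)) (Suc n) (g(n := v)) (border n Q) (snoc n d x)"
    (is "realizes sp ?K' _ ?g _ ?d")
proof -
  have g: "bij_betw g {..<n} (verts K)" and Q: "orth n Q" and strong_prop: "strong_prop sp n (nonedges K n g) Q d"
    using R by (auto simp: realizes_def)
  have isolated: "{y, v} \<notin> edges K" "{v, y} \<notin> edges K" for y
    using v sgraph_edge[OF K] by blast+
  have "diag_form (Suc n) (border n Q) ?d i j \<noteq> 0 \<longleftrightarrow> {?g i, ?g j} \<in> edges ?K'"
    if ij: "i < Suc n" "j < Suc n" "i \<noteq> j" for i j
    using ij R isolated unfolding diag_form_border[OF ij] by (auto simp: realizes_def less_Suc_eq)
  moreover have "strong_prop sp (Suc n) (nonedges ?K' (Suc n) ?g) (border n Q) ?d"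
  proof (rule strong_prop_I)
    fix X
    assume sym: "\<And>i j. i < Suc n \<Longrightarrow> j < Suc n \<Longrightarrow> X i j = X j i"
      and supp: "\<And>i j. i < Suc n \<Longrightarrow> j < Suc n \<Longrightarrow> (i, j) \<notin> nonedges ?K' (Suc n) ?g \<Longrightarrow> X i j = 0"
      and comm: "\<And>p q. p < Suc n \<Longrightarrow> q < Suc n \<Longrightarrow> (?d p - ?d q) * conj_entry (Suc n) (border n Q) X p q = 0"
      and tr: "\<And>y. \<not> sp \<Longrightarrow> (\<Sum>k | k < Suc n \<and> ?d k = y. conj_entry (Suc n) (border n Q) X k k) = 0"
    have conj_entry_lt: "conj_entry (Suc n) (border n Q) X p q = conj_entry n Q X p q" if "p < n" "q < n" for p q
      using that unfolding conj_entry_def by (simp add: border_def)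
    have conj_entry_n: "conj_entry (Suc n) (border n Q) X p n = (\<Sum>i<n. Q p i * X i n)" if "p < n" for p
      using that unfolding conj_entry_def by (simp add: border_def)
    have last: "X i n = 0" if i: "i < n" for i
    proof -
      have "(\<Sum>i<n. Q p i * X i n) = 0" if p: "p < n" for p
        using comm[of p n] x p unfolding conj_entry_n[OF p] by (auto simp: snoc_def)
      then have "0 = (\<Sum>p<n. Q p i * (\<Sum>j<n. Q p j * X j n))" by simp
      also have "\<dots> = (\<Sum>j<n. (\<Sum>p<n. Q p i * Q p j) * X j n)"
        unfolding sum_distrib_left sum_distrib_right by (subst sum.swap) (simp add: mult_ac)
      also have "\<dots> = (\<Sum>j<n. (if i = j then X j n else 0))"
        using Q i unfolding orth_def by (intro sum.cong) auto
      also have "\<dots> = X i n" using i by simp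
      finally show ?thesis ..
    qed
    have "X i j = 0" if ij: "i < n" "j < n" for i j
    proof (rule strong_prop_D[OF strong_prop _ _ _ _ ij])
      show "X i j = X j i" if "i < n" "j < n" for i j using sym that by simp
      show "X i j = 0" if "i < n" "j < n" "(i, j) \<notin> nonedges K n g" for i j
        using supp[of i j] that by (auto simp: nonedges_def)
      show "(d p - d q) * conj_entry n Q X p q = 0" if "p < n" "q < n" for p q
        using comm[of p q] that conj_entry_lt[OF that] by (simp add: snoc_def)
      show "(\<Sum>k | k < n \<and> d k = y. conj_entry n Q X k k) = 0" if "\<not> sp" for y
      proof (cases "y \<in> d ` {..<n}")
        case True
        then have "{k. k < Suc n \<and> ?d k = y} = {k. k < n \<and> d k = y}"
          using x by (auto simp: snoc_def less_Suc_eq)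
        then show ?thesis using tr[OF that, of y] conj_entry_lt by simp
      next
        case False
        then have "{k. k < n \<and> d k = y} = {}" by auto
        then show ?thesis by (simp only: sum.empty)
      qed
    qed
    moreover have "X n n = 0" by (rule supp) (auto simp: nonedges_def)
    moreover have "X n j = 0" if "j < n" for j
      using sym[of n j] last[OF that] that by simp
    ultimately show "\<forall>i<Suc n. \<forall>j<Suc n. X i j = 0"
      using last by (auto simp: less_Suc_eq)
  qed
  ultimately show ?thesis
    using bij_betw_snoc[OF g v] orth_border[OF Q] by (auto simp: realizes_def)
qed

text \<open>If the last column of a symmetric matrix is \<open>c\<close> times column \<open>w\<close>, with entries
  \<open>c i \<in> {- 1, 0, 1}\<close>, then a rotation of these two coordinates by 45 degrees yields entries
  proportional to \<open>1 - c i\<close> and \<open>1 + c i\<close>: each edge at the contracted vertex can be given to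
  one of its two preimages or to both.\<close>

definition colrot :: "nat \<Rightarrow> nat \<Rightarrow> (nat \<Rightarrow> nat \<Rightarrow> real) \<Rightarrow> nat \<Rightarrow> nat \<Rightarrow> real" where
  "colrot w n U k j = (if j = w then (U k w - U k n) / sqrt 2 else if j = n then (U k w + U k n) / sqrt 2 else U k j)"

text \<open>The transpose of the column rotation, by which \<open>colrot\<close> is moved to the
  other factor of a scalar product.\<close>

definition vecrot :: "nat \<Rightarrow> nat \<Rightarrow> (nat \<Rightarrow> real) \<Rightarrow> nat \<Rightarrow> real" where
  "vecrot w n f j = (if j = w then (f w + f n) / sqrt 2 else if j = n then (f n - f w) / sqrt 2 else f j)"

lemma orth_transpose:
  assumes "orth m U"
  shows "orth m (\<lambda>i j. U j i)"
  unfolding orth_def using orth_rows[OF assms] by blast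

text \<open>Rotating two columns is rotating two rows of the transpose; the angle is
  \<open>- (pi / 4)\<close>.\<close>

lemma orth_colrot:
  assumes "orth (Suc n) U" "w < n"
  shows "orth (Suc n) (colrot w n U)"
proof -
  have "orth (Suc n) (givens w n (\<lambda>i j. U j i) (- (pi / 4)))"
    by (rule orth_givens[OF orth_transpose[OF assms(1)]]) (use assms(2) in auto)
  moreover have "givens w n (\<lambda>i j. U j i) (- (pi / 4)) = (\<lambda>i j. colrot w n U j i)"
    using assms by (auto simp: givens_def colrot_def fun_eq_iff cos_45 sin_45 field_simps)
  ultimately have "orth (Suc n) (\<lambda>i j. colrot w n U j i)" by simp
  from orth_transpose[OF this] show ?thesis by simp
qed

lemma sum_colrot:
  assumes "w < n"
  shows "(\<Sum>j<Suc n. f j * colrot w n U k j) = (\<Sum>j<Suc n. vecrot w n f j * U k j)"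
proof -
  have "(\<Sum>j\<in>{..<Suc n} - {w, n}. f j * colrot w n U k j) = (\<Sum>j\<in>{..<Suc n} - {w, n}. vecrot w n f j * U k j)"
    by (intro sum.cong) (auto simp: colrot_def vecrot_def)
  moreover have "f w * colrot w n U k w + f n * colrot w n U k n = vecrot w n f w * U k w + vecrot w n f n * U k n"
    using assms by (simp add: colrot_def vecrot_def field_simps)
  ultimately show ?thesis
    using assms by (simp only: sum_split2[of w "Suc n" n] lessI less_SucI less_not_refl2 not_less_iff_gr_or_eq simp_thms)
qed

lemma conj_entry_colrot:
  assumes "w < n"
  shows "conj_entry (Suc n) (colrot w n U) X p q = conj_entry (Suc n) U (\<lambda>i j. vecrot w n (\<lambda>i. vecrot w n (X i) j) i) p q"
proof -
  have "conj_entry (Suc n) (colrot w n U) X p q = (\<Sum>i<Suc n. colrot w n U p i * (\<Sum>j<Suc n. X i j * colrot w n U q j))"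
    unfolding conj_entry_def sum_distrib_left by (simp only: mult.assoc)
  also have "\<dots> = (\<Sum>i<Suc n. colrot w n U p i * (\<Sum>j<Suc n. vecrot w n (X i) j * U q j))"
    unfolding sum_colrot[OF assms] ..
  also have "\<dots> = (\<Sum>j<Suc n. (\<Sum>i<Suc n. vecrot w n (X i) j * colrot w n U p i) * U q j)"
    unfolding sum_distrib_left sum_distrib_right by (subst sum.swap) (simp only: mult_ac)
  also have "\<dots> = (\<Sum>j<Suc n. (\<Sum>i<Suc n. vecrot w n (\<lambda>i. vecrot w n (X i) j) i * U p i) * U q j)"
    unfolding sum_colrot[OF assms] ..
  also have "\<dots> = conj_entry (Suc n) U (\<lambda>i j. vecrot w n (\<lambda>i. vecrot w n (X i) j) i) p q"
    unfolding conj_entry_def sum_distrib_right by (subst sum.swap) (simp only: mult_ac)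
  finally show ?thesis .
qed

lemma diag_form_colrot:
  assumes "w < n" "i < n" "i \<noteq> w"
  shows "j < n \<Longrightarrow> j \<noteq> w \<Longrightarrow> diag_form m (colrot w n U) d i j = diag_form m U d i j"
    and "diag_form m (colrot w n U) d i w = (diag_form m U d i w - diag_form m U d i n) / sqrt 2"
    and "diag_form m (colrot w n U) d i n = (diag_form m U d i w + diag_form m U d i n) / sqrt 2"
proof -
  have n: "n \<noteq> w" "i \<noteq> n" using assms by auto
  show "diag_form m (colrot w n U) d i j = diag_form m U d i j" if "j < n" "j \<noteq> w"
    using that assms unfolding diag_form_def by (simp add: colrot_def)
  show "diag_form m (colrot w n U) d i w = (diag_form m U d i w - diag_form m U d i n) / sqrt 2"
    using assms n unfolding diag_form_def sum_subtractf[symmetric] sum_divide_distrib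
    by (intro sum.cong) (auto simp: colrot_def field_simps)
  show "diag_form m (colrot w n U) d i n = (diag_form m U d i w + diag_form m U d i n) / sqrt 2"
    using assms n unfolding diag_form_def sum.distrib[symmetric] sum_divide_distrib
    by (intro sum.cong) (auto simp: colrot_def field_simps)
qed

text \<open>The index \<open>w\<close> of the merged vertex becomes \<open>u\<close>, and the new
  index \<open>n\<close> becomes \<open>v\<close>. The same rotation that turns the constraints into
  the pattern of \<open>K\<close> turns test matrices for \<open>K\<close> into those of
  \<open>contracted_strong_prop\<close>, so both the pattern and the strong property are
  transported.\<close>

lemma realizes_decontract:
  assumes R: "realizes sp (contract_edge K u v) n g Q d" and K: "sgraph K" and uv: "{u, v} \<in> edges K"
  obtains V \<phi> t where "strict_mono_on (d ` {..<n}) \<phi>" "\<And>x. sp \<Longrightarrow> \<phi> x = x" "t0 < t"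
    "\<And>k. k < n \<Longrightarrow> \<phi> (d k) < t" "realizes sp K (Suc n) (g(n := v)) V (snoc n (\<phi> \<circ> d) t)"
proof -
  let ?K = "contract_edge K u v" and ?g = "g(n := v)"
  have vertsK: "verts ?K = verts K - {v}" by (simp add: contract_edge_def)
  have g: "bij_betw g {..<n} (verts K - {v})" and Q: "orth n Q" and strong_prop: "strong_prop sp n (nonedges ?K n g) Q d"
    and pat: "\<And>i j. i < n \<Longrightarrow> j < n \<Longrightarrow> i \<noteq> j \<Longrightarrow> diag_form n Q d i j \<noteq> 0 \<longleftrightarrow> {g i, g j} \<in> edges ?K"
    using R by (auto simp: realizes_def vertsK)
  note uv' = sgraph_edge[OF K uv]
  have "u \<in> g ` {..<n}" using g uv' by (auto simp: bij_betw_def)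
  then obtain w where w: "w < n" and gw: "g w = u" by auto
  have gv: "g i \<noteq> v" if "i < n" for i using g that by (auto simp: bij_betw_def)
  have gu: "g i \<noteq> u" if "i < n" "i \<noteq> w" for i
    using g that w gw by (auto simp: bij_betw_def inj_on_def)
  have away: "{g i, g j} \<in> edges ?K \<longleftrightarrow> {g i, g j} \<in> edges K" if "i < n" "j < n" "i \<noteq> w" "j \<noteq> w" for i j
    using that gv gu by (intro contract_edge_edges_away[OF K]) auto
  have merged: "{g i, u} \<in> edges ?K \<longleftrightarrow> {g i, u} \<in> edges K \<or> {g i, v} \<in> edges K" if "i < n" "i \<noteq> w" for i
    using that gv gu by (intro contract_edge_edges_merged[OF K]) auto
  \<comment> \<open>After the rotation the entries at \<open>u\<close> and \<open>v\<close> are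
    proportional to \<open>1 - cf i\<close> and \<open>1 + cf i\<close>. So \<open>- 1\<close> keeps
    only the edge to \<open>u\<close>, \<open>1\<close> only the edge to \<open>v\<close>, and 0
    keeps both if the merged entry is nonzero.\<close>
  define cf :: "nat \<Rightarrow> real" where "cf i = (if i = w then 0 else if {g i, u} \<in> edges K \<and> {g i, v} \<notin> edges K then - 1
    else if {g i, u} \<notin> edges K \<and> {g i, v} \<in> edges K then 1 else 0)" for i
  have cfw: "cf w = 0" by (simp add: cf_def)
  obtain U \<phi> t where U: "orth (Suc n) U" and mono: "strict_mono_on (d ` {..<n}) \<phi>" and sp: "\<And>x. sp \<Longrightarrow> \<phi> x = x"
    and t0: "t0 < t" and t: "\<And>k. k < n \<Longrightarrow> \<phi> (d k) < t"
    and M0: "\<And>i j. (i, j) \<in> nonedges ?K n g \<Longrightarrow> diag_form (Suc n) U (snoc n (\<phi> \<circ> d) t) i j = 0"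
    and M1: "\<And>i j. i < n \<Longrightarrow> j < n \<Longrightarrow> diag_form n Q d i j \<noteq> 0 \<Longrightarrow> diag_form (Suc n) U (snoc n (\<phi> \<circ> d) t) i j \<noteq> 0"
    and M2: "\<And>i. i < n \<Longrightarrow> diag_form (Suc n) U (snoc n (\<phi> \<circ> d) t) i n = cf i * diag_form (Suc n) U (snoc n (\<phi> \<circ> d) t) i w"
    and M3: "diag_form (Suc n) U (snoc n (\<phi> \<circ> d) t) w w < diag_form (Suc n) U (snoc n (\<phi> \<circ> d) t) n n"
    and strong: "contracted_strong_prop sp n w cf (nonedges ?K n g) U (snoc n (\<phi> \<circ> d) t)"
    by (rule decontraction_realization[where cf = cf and w = w and N = "nonedges ?K n g" and ?t0.0 = t0,
      OF Q strong_prop nonedges_subset nonedges_sym realizes_nonedge[OF R] w cfw]) (assumption | rule that)+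
  define D where "D = snoc n (\<phi> \<circ> d) t"
  define M where "M = diag_form (Suc n) U D"
  define V where "V = colrot w n U"
  have V: "orth (Suc n) V" unfolding V_def by (rule orth_colrot[OF U w])
  have M_nz: "M i j \<noteq> 0 \<longleftrightarrow> {g i, g j} \<in> edges ?K" if "i < n" "j < n" "i \<noteq> j" for i j
  proof (cases "{g i, g j} \<in> edges ?K")
    case True
    then show ?thesis using M1 that pat[OF that] by (auto simp: M_def D_def)
  next
    case False
    then have "(i, j) \<in> nonedges ?K n g" using that by (simp add: nonedges_def)
    then show ?thesis using M0 False by (auto simp: M_def D_def)
  qed
  have Min: "M i n = cf i * M i w" if "i < n" for i
    using M2[OF that] by (simp add: M_def D_def)
  have half: "diag_form (Suc n) V D i j \<noteq> 0 \<longleftrightarrow> {?g i, ?g j} \<in> edges K" if i: "i < n" "i \<noteq> w" and j: "j < Suc n" "i \<noteq> j" for i j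
  proof -
    consider "j < n" "j \<noteq> w" | "j = w" | "j = n" using j by linarith
    then show ?thesis
    proof cases
      case 1
      then show ?thesis
        unfolding V_def using diag_form_colrot(1)[OF w i 1] M_nz[OF i(1) 1(1) j(2)] away[OF i(1) 1(1) i(2) 1(2)] i
        by (simp add: M_def)
    next
      case 2
      have "diag_form (Suc n) V D i w = (1 - cf i) * M i w / sqrt 2"
        unfolding V_def diag_form_colrot(2)[OF w i] using Min[OF i(1)] by (simp add: M_def algebra_simps)
      moreover have "M i w \<noteq> 0 \<longleftrightarrow> {g i, u} \<in> edges K \<or> {g i, v} \<in> edges K"
        using M_nz[OF i(1) w i(2)] merged[OF i] by (simp add: gw)
      ultimately show ?thesis using 2 i w by (auto simp: cf_def gw)
    next
      case 3
      have "diag_form (Suc n) V D i n = (1 + cf i) * M i w / sqrt 2"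
        unfolding V_def diag_form_colrot(3)[OF w i] using Min[OF i(1)] by (simp add: M_def algebra_simps)
      moreover have "M i w \<noteq> 0 \<longleftrightarrow> {g i, u} \<in> edges K \<or> {g i, v} \<in> edges K"
        using M_nz[OF i(1) w i(2)] merged[OF i] by (simp add: gw)
      ultimately show ?thesis using 3 i w by (auto simp: cf_def)
    qed
  qed
  \<comment> \<open>This entry belongs to the contracted edge, which left no trace in the contracted
    graph; it is supplied by the gap between the two diagonal entries.\<close>
  have corner: "diag_form (Suc n) V D w n \<noteq> 0"
  proof -
    have "diag_form (Suc n) V D w n = (M w w - M n n) / 2"
      unfolding V_def diag_form_def M_def sum_subtractf[symmetric] sum_divide_distrib using w
      by (intro sum.cong) (auto simp: colrot_def field_simps)
    then show ?thesis using M3 by (simp add: M_def D_def)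
  qed
  have pattern: "diag_form (Suc n) V D i j \<noteq> 0 \<longleftrightarrow> {?g i, ?g j} \<in> edges K" if ij: "i < Suc n" "j < Suc n" "i \<noteq> j" for i j
  proof -
    consider "i < n" "i \<noteq> w" | "j < n" "j \<noteq> w" | "i = w" "j = n" | "i = n" "j = w" using ij by linarith
    then show ?thesis
    proof cases
      case 1 then show ?thesis using half ij by blast
    next
      case 2
      from half[OF 2 ij(1) not_sym[OF ij(3)]] show ?thesis
        by (simp only: diag_form_sym[of _ _ _ i j] insert_commute)
    next
      case 3 then show ?thesis using corner w uv by (simp add: gw)
    next
      case 4 then show ?thesis using corner w uv by (simp add: gw diag_form_sym[of _ _ _ n w] insert_commute)
    qed
  qed
  have "strong_prop sp (Suc n) (nonedges K (Suc n) ?g) V D"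
  proof (rule strong_prop_I)
    fix X
    assume sym: "\<And>i j. i < Suc n \<Longrightarrow> j < Suc n \<Longrightarrow> X i j = X j i"
      and supp: "\<And>i j. i < Suc n \<Longrightarrow> j < Suc n \<Longrightarrow> (i, j) \<notin> nonedges K (Suc n) ?g \<Longrightarrow> X i j = 0"
      and comm: "\<And>p q. p < Suc n \<Longrightarrow> q < Suc n \<Longrightarrow> (D p - D q) * conj_entry (Suc n) V X p q = 0"
      and tr: "\<And>y. \<not> sp \<Longrightarrow> (\<Sum>k | k < Suc n \<and> D k = y. conj_entry (Suc n) V X k k) = 0"
    define Z where "Z i j = vecrot w n (\<lambda>i. vecrot w n (X i) j) i" for i j
    have cjZ: "conj_entry (Suc n) V X p q = conj_entry (Suc n) U Z p q" for p q
      unfolding V_def Z_def[abs_def] by (rule conj_entry_colrot[OF w])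
    have diag: "X i i = 0" if "i < Suc n" for i
      using supp[OF that that] by (simp add: nonedges_def)
    have Xwn: "X w n = 0" "X n w = 0"
      using supp[of w n] supp[of n w] w uv by (auto simp: nonedges_def gw insert_commute)
    have wn: "w \<noteq> n" using w by simp
    have Z_away: "Z i j = X i j" if "i < n" "j < n" "i \<noteq> w" "j \<noteq> w" for i j
      using that by (simp add: Z_def vecrot_def)
    have Z_w: "Z i w = (X i w + X i n) / sqrt 2" "Z w i = (X i w + X i n) / sqrt 2"
      and Z_n: "Z i n = (X i n - X i w) / sqrt 2" "Z n i = (X i n - X i w) / sqrt 2"
      if "i < n" "i \<noteq> w" for i
      using that wn w sym[of i w] sym[of i n] by (simp_all add: Z_def vecrot_def)
    have Z_corner: "Z w w = 0" "Z n n = 0" "Z w n = 0" "Z n w = 0"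
      using wn w Xwn diag[of w] diag[of n] by (simp_all add: Z_def vecrot_def)
    have Zsym: "Z i j = Z j i" if "i \<le> n" "j \<le> n" for i j
    proof -
      have edge: "Z x y = Z y x" if "x < n" "x \<noteq> w" "y = w \<or> y = n" for x y
        using that(3) Z_w[OF that(1,2)] Z_n[OF that(1,2)] by (elim disjE) (simp_all only:)
      show ?thesis
      proof (cases "i = w \<or> i = n")
        case i: True
        show ?thesis
        proof (cases "j = w \<or> j = n")
          case True
          with i show ?thesis using Z_corner by (elim disjE) (simp_all only:)
        next
          case False
          with that i show ?thesis by (intro edge[symmetric]) auto
        qed
      next
        case i: False
        show ?thesis
        proof (cases "j = w \<or> j = n")
          case True
          with that i show ?thesis by (intro edge) auto
        next
          case False
          have ij: "i < n" "j < n" "i \<noteq> w" "j \<noteq> w" using False i that by auto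
          have "X i j = X j i" using ij by (intro sym) auto
          with Z_away[OF ij] Z_away[OF ij(2,1,4,3)] show ?thesis by (simp only:)
        qed
      qed
    qed
    \<comment> \<open>For \<open>cf i = - 1\<close> the combination is a multiple of
      \<open>X i w\<close>, for \<open>cf i = 1\<close> a multiple of \<open>X i n\<close>, and
      these are the entries at the edge that is present. If both edges are present, both entries of
      \<open>X\<close> are 0.\<close>
    have reduced_entry_w: "reduced_entry n w cf Z i w = 0" if i: "i < n" "i \<noteq> w" and e: "{g i, u} \<in> edges ?K" for i
    proof -
      have u0: "X i w = 0" if "{g i, u} \<in> edges K"
        using supp[of i w] that i w by (auto simp: nonedges_def gw)
      have v0: "X i n = 0" if "{g i, v} \<in> edges K"
        using supp[of i n] that i w by (auto simp: nonedges_def)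
      have "reduced_entry n w cf Z i w = Z i w + cf i * Z i n"
        using i by (simp add: reduced_entry_def)
      then show ?thesis
        using e u0 v0 i unfolding merged[OF i] Z_w(1)[OF i] Z_n(1)[OF i] by (auto simp: cf_def)
    qed
    have "\<forall>i\<le>n. \<forall>j\<le>n. Z i j = 0"
    proof (rule contracted_strong_prop_D[OF strong[folded D_def]])
      show "Z i j = Z j i" if "i \<le> n" "j \<le> n" for i j by (rule Zsym[OF that])
      show "Z n n = 0" by (rule Z_corner(2))
      show "reduced_entry n w cf Z i j = 0" if ij: "i < n" "j < n" "(i, j) \<notin> nonedges ?K n g" for i j
      proof -
        have e: "i = j \<or> {g i, g j} \<in> edges ?K" using ij by (auto simp: nonedges_def)
        consider "i \<noteq> w" "j \<noteq> w" | "i \<noteq> w" "j = w" | "i = w" "j \<noteq> w" | "i = w" "j = w" by blast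
        then show ?thesis
        proof cases
          case 1
          have "X i j = 0"
            using e diag[of i] supp[of i j] away[OF ij(1,2) 1] ij 1 by (auto simp: nonedges_def)
          then show ?thesis using 1 ij by (simp add: reduced_entry_def Z_away)
        next
          case 2
          then show ?thesis using reduced_entry_w[of i] e ij gw by auto
        next
          case 3
          have "reduced_entry n w cf Z w j = reduced_entry n w cf Z j w"
            using 3 Zsym[of w j] ij by (simp add: reduced_entry_def)
          moreover have "{g j, u} \<in> edges ?K" using e 3 gw by (auto simp: insert_commute)
          ultimately show ?thesis using reduced_entry_w[of j] 3 ij by simp
        next
          case 4
          then show ?thesis using Z_corner cfw by (simp add: reduced_entry_def)
        qed
      qed
      show "(D p - D q) * conj_entry (Suc n) U Z p q = 0" if "p \<le> n" "q \<le> n" for p q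
        using comm[of p q] that by (simp add: cjZ)
      show "(\<Sum>k | k < Suc n \<and> D k = y. conj_entry (Suc n) U Z k k) = 0" if "\<not> sp" for y
        using tr[OF that, of y] by (simp add: cjZ)
    qed
    then have "conj_entry (Suc n) V X p q = 0" for p q
      unfolding cjZ by (simp add: conj_entry_def)
    then show "\<forall>i<Suc n. \<forall>j<Suc n. X i j = 0"
      using conj_back[OF V, of _ _ X] by simp
  qed
  moreover have "bij_betw ?g {..<Suc n} (verts K)"
    using bij_betw_snoc[OF g, of v] uv'(2) by (simp add: insert_absorb)
  ultimately have "realizes sp K (Suc n) ?g V D"
    using V pattern by (simp add: realizes_def)
  with that mono sp t0 t show thesis unfolding D_def by blast
qed

section \<open>Bookkeeping of the eigenvalues\<close>

definition eigvals :: "nat \<Rightarrow> (nat \<Rightarrow> real) \<Rightarrow> real multiset" where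
  "eigvals n d = image_mset d (mset_set {..<n})"

lemma eigvals_Suc: "eigvals (Suc n) d = add_mset (d n) (eigvals n d)"
  unfolding eigvals_def by (simp add: lessThan_Suc)

lemma eigvals_snoc: "eigvals n (snoc n d x) = eigvals n d"
  unfolding eigvals_def by (intro image_mset_cong) (simp add: snoc_def)

lemma eigvals_comp: "eigvals n (\<phi> \<circ> d) = image_mset \<phi> (eigvals n d)"
  unfolding eigvals_def by (simp add: multiset.map_comp)

lemma set_eigvals [simp]: "set_mset (eigvals n d) = d ` {..<n}"
  unfolding eigvals_def by simp

text \<open>\<open>\<phi>\<close> is the accumulated shift of the old eigenvalues, \<open>S\<close>
  collects the eigenvalues from vertex deletions and \<open>B\<close> the large ones from
  contractions. As \<open>S\<close> and \<open>B\<close> are disjoint sets off the shifted spectrum,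
  the added eigenvalues are simple. Only \<open>S\<close> can reach between the old
  extremes.\<close>

definition extends_spec :: "bool \<Rightarrow> nat \<Rightarrow> nat \<Rightarrow> real set \<Rightarrow> real multiset \<Rightarrow> real multiset \<Rightarrow> bool" where
  "extends_spec sp r s M E E' \<longleftrightarrow> (\<exists>\<phi> S B. strict_mono_on (set_mset E) \<phi> \<and> finite S \<and> finite B \<and> card S = s \<and> card B = r \<and>
     S \<inter> B = {} \<and> (S \<union> B) \<inter> \<phi> ` set_mset E = {} \<and> (\<forall>y\<in>B. \<forall>x\<in>set_mset E. \<phi> x < y) \<and>
     (sp \<longrightarrow> S = M \<and> (\<forall>x. \<phi> x = x)) \<and> E' = image_mset \<phi> E + mset_set S + mset_set B)"

lemma extends_spec_refl: "sp \<longrightarrow> M = {} \<Longrightarrow> extends_spec sp 0 0 M E E"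
  unfolding extends_spec_def
  by (intro exI[of _ "\<lambda>x. x"] exI[of _ "{}"]) (auto simp: strict_mono_on_def)

text \<open>The induction adds steps at the beginning, so the shift of the first step is composed
  with all later shifts.\<close>

lemma extends_spec_image:
  assumes "extends_spec sp r s M (image_mset \<psi> E) E'" "strict_mono_on (set_mset E) \<psi>" "\<And>x. sp \<Longrightarrow> \<psi> x = x"
  shows "extends_spec sp r s M E E'"
proof -
  obtain \<phi> S B where *: "strict_mono_on (\<psi> ` set_mset E) \<phi>" "finite S" "finite B" "card S = s" "card B = r"
    "S \<inter> B = {}" "(S \<union> B) \<inter> \<phi> ` \<psi> ` set_mset E = {}" "\<forall>y\<in>B. \<forall>x\<in>\<psi> ` set_mset E. \<phi> x < y"
    "sp \<longrightarrow> S = M \<and> (\<forall>x. \<phi> x = x)" "E' = image_mset \<phi> (image_mset \<psi> E) + mset_set S + mset_set B"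
    using assms(1) unfolding extends_spec_def set_image_mset by (elim exE conjE) (rule that)
  have "strict_mono_on (set_mset E) (\<phi> \<circ> \<psi>)"
    using *(1) assms(2) by (auto simp: strict_mono_on_def)
  moreover have "(S \<union> B) \<inter> (\<phi> \<circ> \<psi>) ` set_mset E = {}" using *(7) by (simp only: image_comp)
  moreover have "E' = image_mset (\<phi> \<circ> \<psi>) E + mset_set S + mset_set B"
    using *(10) by (simp add: multiset.map_comp)
  ultimately show ?thesis
    unfolding extends_spec_def using *(2-6,8,9) assms(3)
    by (intro exI[of _ "\<phi> \<circ> \<psi>"] exI[of _ S] exI[of _ B]) simp
qed

lemma extends_spec_add_chosen:
  assumes "extends_spec sp r s (M - {x}) (add_mset x E) E'" "x \<notin># E" "sp \<longrightarrow> x \<in> M"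
  shows "extends_spec sp r (Suc s) M E E'"
proof -
  obtain \<phi> S B where *: "strict_mono_on (insert x (set_mset E)) \<phi>" "finite S" "finite B" "card S = s" "card B = r"
    "S \<inter> B = {}" "(S \<union> B) \<inter> \<phi> ` insert x (set_mset E) = {}" "\<forall>y\<in>B. \<forall>z\<in>insert x (set_mset E). \<phi> z < y"
    "sp \<longrightarrow> S = M - {x} \<and> (\<forall>x. \<phi> x = x)" "E' = image_mset \<phi> (add_mset x E) + mset_set S + mset_set B"
    using assms(1) unfolding extends_spec_def set_mset_add_mset_insert by (elim exE conjE) (rule that)
  have inj: "inj_on \<phi> (insert x (set_mset E))" by (rule strict_mono_on_imp_inj_on[OF *(1)])
  have x: "\<phi> x \<notin> S" "\<phi> x \<notin> B" "\<phi> x \<notin> \<phi> ` set_mset E"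
    using *(7) inj assms(2) by (auto simp: inj_on_def)
  have "strict_mono_on (set_mset E) \<phi>" using *(1) by (auto simp: strict_mono_on_def)
  moreover have "E' = image_mset \<phi> E + mset_set (insert (\<phi> x) S) + mset_set B"
    using *(2,10) x(1) by simp
  ultimately show ?thesis
    unfolding extends_spec_def using *(2-9) x assms(3)
    by (intro exI[of _ \<phi>] exI[of _ "insert (\<phi> x) S"] exI[of _ B]) auto
qed

text \<open>The image of \<open>t\<close> joins \<open>B\<close>. It stays above the shifted old
  eigenvalues because all later shifts are strictly monotone on a set that contains both.\<close>

lemma extends_spec_add_large:
  assumes "extends_spec sp r s M (add_mset t E) E'" "\<And>x. x \<in># E \<Longrightarrow> x < t"
  shows "extends_spec sp (Suc r) s M E E'"
proof -
  obtain \<phi> S B where *: "strict_mono_on (insert t (set_mset E)) \<phi>" "finite S" "finite B" "card S = s" "card B = r"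
    "S \<inter> B = {}" "(S \<union> B) \<inter> \<phi> ` insert t (set_mset E) = {}" "\<forall>y\<in>B. \<forall>z\<in>insert t (set_mset E). \<phi> z < y"
    "sp \<longrightarrow> S = M \<and> (\<forall>x. \<phi> x = x)" "E' = image_mset \<phi> (add_mset t E) + mset_set S + mset_set B"
    using assms(1) unfolding extends_spec_def set_mset_add_mset_insert by (elim exE conjE) (rule that)
  have lt: "\<phi> z < \<phi> t" if "z \<in># E" for z
    using *(1) assms(2)[OF that] that by (auto simp: strict_mono_on_def)
  have t: "\<phi> t \<notin> S" "\<phi> t \<notin> B" using *(7) by auto
  have "strict_mono_on (set_mset E) \<phi>" using *(1) by (auto simp: strict_mono_on_def)
  moreover have "E' = image_mset \<phi> E + mset_set S + mset_set (insert (\<phi> t) B)"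
    using *(3,10) t(2) by simp
  moreover have "(S \<union> insert (\<phi> t) B) \<inter> \<phi> ` set_mset E = {}" using *(7) lt by fastforce
  moreover have "\<forall>y\<in>insert (\<phi> t) B. \<forall>x\<in>set_mset E. \<phi> x < y" using *(8) lt by auto
  ultimately show ?thesis
    unfolding extends_spec_def using *(2-6,9) t
    by (intro exI[of _ \<phi>] exI[of _ S] exI[of _ "insert (\<phi> t) B"]) auto
qed

text \<open>The operation performed last is undone first, so the induction hypothesis is applied to
  the enlarged realization and everything but \<open>H\<close> is generalised. Each undone vertex
  deletion uses up one element of \<open>M\<close>; the others must remain outside the growing
  spectrum.\<close>

theorem realizes_minor:
  assumes "minor_ops H r s K" "sgraph H" "realizes sp K n g Q d"
    and "sp \<Longrightarrow> finite M \<and> card M = s \<and> M \<inter> d ` {..<n} = {}"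
  shows "\<exists>g' Q' d'. realizes sp H (n + r + s) g' Q' d' \<and> extends_spec sp r s M (eigvals n d) (eigvals (n + r + s) d')"
  using assms
proof (induction arbitrary: n g Q d M rule: minor_ops.induct)
  case start
  then have "extends_spec sp 0 0 M (eigvals n d) (eigvals n d)" by (intro extends_spec_refl) auto
  with start have "realizes sp H (n + 0 + 0) g Q d \<and> extends_spec sp 0 0 M (eigvals n d) (eigvals (n + 0 + 0) d)"
    by simp
  then show ?case by blast
next
  case (contraction r s K u v)
  have K: "sgraph K" using sgraph_minor_ops contraction by blast
  \<comment> \<open>Choosing \<open>t\<close> above \<open>M\<close> keeps the prescribed
    eigenvalues available for the vertices still to be restored. The inserted 0 keeps the argument
    of \<open>Max\<close> nonempty.\<close>
  obtain V \<phi> t where mono: "strict_mono_on (d ` {..<n}) \<phi>" and sp: "\<And>x. sp \<Longrightarrow> \<phi> x = x"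
    and t0: "Max (insert 0 M) < t" and t: "\<And>k. k < n \<Longrightarrow> \<phi> (d k) < t"
    and R: "realizes sp K (Suc n) (g(n := v)) V (snoc n (\<phi> \<circ> d) t)"
    using realizes_decontract[OF contraction.prems(2) K contraction.hyps(2)] by metis
  have "finite M \<and> card M = s \<and> M \<inter> snoc n (\<phi> \<circ> d) t ` {..<Suc n} = {}" if sp
  proof -
    have M: "finite M" "card M = s" "M \<inter> d ` {..<n} = {}" using contraction.prems(3) that by auto
    have "y < t" if "y \<in> M" for y
      using le_less_trans[OF Max_ge t0, of y] M(1) that by auto
    then have "t \<notin> M" by blast
    then show ?thesis using M sp that by (auto simp: snoc_def less_Suc_eq)
  qed
  from contraction.IH[OF contraction.prems(1) R this]
  obtain g' Q' d' where R': "realizes sp H (Suc n + r + s) g' Q' d'"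
    and ext: "extends_spec sp r s M (eigvals (Suc n) (snoc n (\<phi> \<circ> d) t)) (eigvals (Suc n + r + s) d')" by blast
  have "eigvals (Suc n) (snoc n (\<phi> \<circ> d) t) = add_mset t (image_mset \<phi> (eigvals n d))"
    by (simp add: eigvals_Suc eigvals_snoc eigvals_comp) (simp add: snoc_def)
  with ext have "extends_spec sp (Suc r) s M (image_mset \<phi> (eigvals n d)) (eigvals (Suc n + r + s) d')"
    by (intro extends_spec_add_large) (use t in auto)
  then have "extends_spec sp (Suc r) s M (eigvals n d) (eigvals (Suc n + r + s) d')"
    by (rule extends_spec_image) (use mono sp in auto)
  with R' show ?case by (intro exI conjI) (simp_all only: add_Suc add_Suc_right)
next
  case (vertex_deletion r s K v)
  have K: "sgraph K" using sgraph_minor_ops vertex_deletion by blast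
  \<comment> \<open>For the SSP the next prescribed eigenvalue is taken from \<open>M\<close>; for
    the SMP any number outside the finite spectrum will do.\<close>
  obtain x where x: "x \<notin> d ` {..<n}" and xM: "sp \<longrightarrow> x \<in> M"
  proof (cases sp)
    case True
    then have "M \<noteq> {}" "M \<inter> d ` {..<n} = {}" using vertex_deletion.prems(3) by auto
    then obtain y where "y \<in> M" "y \<notin> d ` {..<n}" by blast
    then show thesis by (intro that[of y]) auto
  next
    case False
    have "\<exists>x. x \<notin> d ` {..<n}" by (rule ex_new_if_finite) (auto simp: infinite_UNIV_char_0)
    then show thesis using that False by auto
  qed
  \<comment> \<open>The vertex returns in two moves, first isolated with the eigenvalue
    \<open>x\<close> and then with its edges. In the SMP case the second move may shift
    \<open>x\<close>, so \<open>\<phi>\<close> acts on the spectrum that already contains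
    it.\<close>
  let ?K = "Graph (insert v (verts (delete_vertex K v))) (edges (delete_vertex K v))"
  have R0: "realizes sp ?K (Suc n) (g(n := v)) (border n Q) (snoc n d x)"
    by (rule realizes_add_isolated[OF vertex_deletion.prems(2) sgraph_delete_vertex[OF K] _ x])
      (simp add: delete_vertex_def)
  have "verts K = verts ?K" "edges ?K \<subseteq> edges K"
    using vertex_deletion.hyps(2) by (auto simp: delete_vertex_def)
  from realizes_add_edges[OF R0 this]
  obtain U \<phi> where mono: "strict_mono_on (snoc n d x ` {..<Suc n}) \<phi>" and sp: "\<And>y. sp \<Longrightarrow> \<phi> y = y"
    and R: "realizes sp K (Suc n) (g(n := v)) U (\<phi> \<circ> snoc n d x)" by blast
  have "finite (M - {x}) \<and> card (M - {x}) = s \<and> (M - {x}) \<inter> (\<phi> \<circ> snoc n d x) ` {..<Suc n} = {}" if sp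
  proof -
    have M: "finite M" "card M = Suc s" "M \<inter> d ` {..<n} = {}" "x \<in> M"
      using vertex_deletion.prems(3) that xM by auto
    then show ?thesis using sp that by (auto simp: snoc_def less_Suc_eq)
  qed
  from vertex_deletion.IH[OF vertex_deletion.prems(1) R this]
  obtain g' Q' d' where R': "realizes sp H (Suc n + r + s) g' Q' d'"
    and ext: "extends_spec sp r s (M - {x}) (eigvals (Suc n) (\<phi> \<circ> snoc n d x)) (eigvals (Suc n + r + s) d')" by blast
  have "eigvals (Suc n) (snoc n d x) = add_mset x (eigvals n d)"
    by (simp add: eigvals_Suc eigvals_snoc) (simp add: snoc_def)
  moreover have "extends_spec sp r s (M - {x}) (eigvals (Suc n) (snoc n d x)) (eigvals (Suc n + r + s) d')"
    by (rule extends_spec_image[OF ext[unfolded eigvals_comp]]) (use mono sp in auto)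
  ultimately have "extends_spec sp r (Suc s) M (eigvals n d) (eigvals (Suc n + r + s) d')"
    by (intro extends_spec_add_chosen[of _ _ _ _ x]) (use x xM in auto)
  with R' show ?case by (intro exI conjI) (simp_all only: add_Suc add_Suc_right)
next
  case (edge_deletion r s K e)
  have "verts K = verts (delete_edge K e)" "edges (delete_edge K e) \<subseteq> edges K"
    by (auto simp: delete_edge_def)
  from realizes_add_edges[OF edge_deletion.prems(2) this]
  obtain U \<phi> where mono: "strict_mono_on (d ` {..<n}) \<phi>" and sp: "\<And>x. sp \<Longrightarrow> \<phi> x = x"
    and R: "realizes sp K n g U (\<phi> \<circ> d)" by blast
  have "finite M \<and> card M = s \<and> M \<inter> (\<phi> \<circ> d) ` {..<n} = {}" if sp
    using edge_deletion.prems(3) sp that by auto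
  from edge_deletion.IH[OF edge_deletion.prems(1) R this]
  obtain g' Q' d' where R': "realizes sp H (n + r + s) g' Q' d'"
    and ext: "extends_spec sp r s M (eigvals n (\<phi> \<circ> d)) (eigvals (n + r + s) d')" by blast
  have "extends_spec sp r s M (eigvals n d) (eigvals (n + r + s) d')"
    by (rule extends_spec_image[OF ext[unfolded eigvals_comp]]) (use mono sp in auto)
  with R' show ?case by (intro exI conjI) (simp_all only: add_Suc add_Suc_right)
qed

section \<open>Matrices and their spectra\<close>

lemma spec_diag_form:
  assumes Q: "orth n Q" and A: "A \<in> carrier_mat n n" and AQ: "\<And>i j. i < n \<Longrightarrow> j < n \<Longrightarrow> A $$ (i, j) = diag_form n Q d i j"
  shows "spec A = eigvals n d" and "spectrum A = d ` {..<n}"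
proof -
  define P where "P = mat n n (\<lambda>(i, j). Q j i)"
  define R where "R = mat n n (\<lambda>(i, j). Q i j)"
  define D where "D = mat n n (\<lambda>(i, j). if i = j then d i else 0)"
  have carr: "P \<in> carrier_mat n n" "R \<in> carrier_mat n n" "D \<in> carrier_mat n n"
    by (auto simp: P_def R_def D_def)
  have PR: "P * R = 1\<^sub>m n"
    using Q by (intro eq_matI) (auto simp: P_def R_def scalar_prod_def atLeast0LessThan orth_def)
  have RP: "R * P = 1\<^sub>m n"
    using orth_rows[OF Q] by (intro eq_matI) (auto simp: P_def R_def scalar_prod_def atLeast0LessThan)
  have PD: "P * D = mat n n (\<lambda>(i, j). d j * Q j i)"
  proof (rule eq_matI)
    fix i j assume "i < dim_row (mat n n (\<lambda>(i, j). d j * Q j i))" "j < dim_col (mat n n (\<lambda>(i, j). d j * Q j i))"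
    then have ij: "i < n" "j < n" by auto
    have "(P * D) $$ (i, j) = (\<Sum>k<n. Q k i * (if k = j then d k else 0))"
      using ij by (simp add: P_def D_def scalar_prod_def atLeast0LessThan)
    also have "\<dots> = (\<Sum>k<n. if k = j then d k * Q k i else 0)"
      by (intro sum.cong) auto
    finally show "(P * D) $$ (i, j) = mat n n (\<lambda>(i, j). d j * Q j i) $$ (i, j)"
      using ij by simp
  qed (auto simp: P_def D_def)
  have "A = P * D * R"
    unfolding PD using A AQ
    by (intro eq_matI) (auto simp: R_def scalar_prod_def atLeast0LessThan diag_form_def)
  then have "similar_mat A D"
    using similar_matI[of A D P R n] carr A PR RP by auto
  then have "char_poly A = char_poly D" by (rule char_poly_similar)
  also have "\<dots> = (\<Prod>a\<leftarrow>diag_mat D. [:- a, 1:])"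
    by (rule char_poly_upper_triangular[OF carr(3)]) (auto simp: upper_triangular_def D_def)
  also have "diag_mat D = map d [0..<n]"
    by (auto simp: diag_mat_def D_def)
  finally have cp: "char_poly A = (\<Prod>p\<leftarrow>map (\<lambda>a. [:- a, 1:]) (map d [0..<n]). p)" by simp
  have "spec A = (\<Sum>p\<leftarrow>map (\<lambda>a. [:- a, 1:]) (map d [0..<n]). proots p)"
    unfolding spec_def cp by (rule proots_prod_list) auto
  also have "\<dots> = (\<Sum>k\<leftarrow>[0..<n]. {#d k#})"
    by (simp add: o_def)
  also have "\<dots> = mset (map d [0..<n])"
    by (induction n) auto
  also have "\<dots> = eigvals n d"
    by (simp add: eigvals_def atLeast0LessThan[symmetric])
  finally show spec: "spec A = eigvals n d" .
  have "char_poly A \<noteq> 0"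
    using degree_monic_char_poly[OF A] by auto
  then have "spectrum A = set_mset (spec A)"
    unfolding spectrum_root_char_poly[OF A] spec_def by simp
  then show "spectrum A = d ` {..<n}" unfolding spec by simp
qed

section \<open>Products and commutators in the eigenbasis\<close>

lemma sum_rotate:
  "(\<Sum>a\<in>A. \<Sum>b\<in>B. \<Sum>c\<in>C. f a b c :: 'a::comm_monoid_add) = (\<Sum>b\<in>B. \<Sum>c\<in>C. \<Sum>a\<in>A. f a b c)"
proof -
  have "(\<Sum>a\<in>A. \<Sum>b\<in>B. \<Sum>c\<in>C. f a b c) = (\<Sum>b\<in>B. \<Sum>a\<in>A. \<Sum>c\<in>C. f a b c)"
    by (rule sum.swap)
  also have "\<dots> = (\<Sum>b\<in>B. \<Sum>c\<in>C. \<Sum>a\<in>A. f a b c)"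
    by (intro sum.cong refl sum.swap)
  finally show ?thesis .
qed

lemma diag_form_mult:
  assumes Q: "orth n Q"
  shows "(\<Sum>l<n. diag_form n Q d a l * diag_form n Q e l b) = diag_form n Q (\<lambda>k. d k * e k) a b"
proof -
  have "(\<Sum>l<n. diag_form n Q d a l * diag_form n Q e l b)
    = (\<Sum>l<n. \<Sum>k<n. \<Sum>k'<n. d k * Q k a * (e k' * Q k' b) * (Q k l * Q k' l))"
    unfolding diag_form_def sum_product by (simp add: mult_ac)
  also have "\<dots> = (\<Sum>k<n. \<Sum>k'<n. \<Sum>l<n. d k * Q k a * (e k' * Q k' b) * (Q k l * Q k' l))"
    by (rule sum_rotate)
  also have "\<dots> = (\<Sum>k<n. \<Sum>k'<n. if k = k' then d k * Q k a * (e k' * Q k' b) else 0)"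
    unfolding sum_distrib_left[symmetric] using orth_rows[OF Q] by (intro sum.cong refl) auto
  also have "\<dots> = diag_form n Q (\<lambda>k. d k * e k) a b"
    unfolding diag_form_def by (intro sum.cong) (auto simp: mult_ac)
  finally show ?thesis .
qed

lemma pow_mat_diag_form:
  assumes Q: "orth n Q" and A: "A \<in> carrier_mat n n" and AQ: "\<And>i j. i < n \<Longrightarrow> j < n \<Longrightarrow> A $$ (i, j) = diag_form n Q d i j"
    and ab: "a < n" "b < n"
  shows "(A ^\<^sub>m i) $$ (a, b) = diag_form n Q (\<lambda>k. d k ^ i) a b"
  using ab
proof (induction i arbitrary: a b)
  case 0
  then show ?case using A Q by (simp add: diag_form_def orth_def)
next
  case (Suc i)
  have "(A ^\<^sub>m Suc i) $$ (a, b) = (\<Sum>l<n. (A ^\<^sub>m i) $$ (a, l) * A $$ (l, b))"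
    using A Suc.prems by (simp add: scalar_prod_def atLeast0LessThan)
  also have "\<dots> = (\<Sum>l<n. diag_form n Q (\<lambda>k. d k ^ i) a l * diag_form n Q d l b)"
    using Suc AQ by (intro sum.cong) auto
  also have "\<dots> = diag_form n Q (\<lambda>k. d k ^ Suc i) a b"
    unfolding diag_form_mult[OF Q] by (simp add: mult.commute)
  finally show ?case .
qed

text \<open>The rows of \<open>Q\<close> are eigenvectors of the diagonal form, so in the eigenbasis
  multiplication from the left and from the right is scaling by \<open>d p\<close> and by
  \<open>d q\<close>.\<close>

lemma conj_entry_commutator:
  assumes Q: "orth n Q" and pq: "p < n" "q < n"
  shows "conj_entry n Q (\<lambda>i j. (\<Sum>k<n. diag_form n Q d i k * X k j) - (\<Sum>k<n. X i k * diag_form n Q d k j)) p q = (d p - d q) * conj_entry n Q X p q"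
proof -
  have row: "(\<Sum>i<n. Q p i * diag_form n Q d i k) = d p * Q p k" if "p < n" for p k
  proof -
    have "(\<Sum>i<n. Q p i * diag_form n Q d i k) = (\<Sum>i<n. \<Sum>l<n. d l * Q l k * (Q p i * Q l i))"
      unfolding diag_form_def sum_distrib_left by (simp add: mult_ac)
    also have "\<dots> = (\<Sum>l<n. d l * Q l k * (\<Sum>i<n. Q p i * Q l i))"
      unfolding sum_distrib_left by (rule sum.swap)
    also have "\<dots> = (\<Sum>l<n. if l = p then d l * Q l k else 0)"
      using orth_rows[OF Q that] by (intro sum.cong) auto
    finally show ?thesis using that by simp
  qed
  have "(\<Sum>i<n. \<Sum>j<n. Q p i * (\<Sum>k<n. diag_form n Q d i k * X k j) * Q q j)
    = (\<Sum>i<n. \<Sum>j<n. \<Sum>k<n. Q p i * diag_form n Q d i k * (X k j * Q q j))"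
    by (simp add: sum_distrib_left sum_distrib_right mult_ac)
  also have "\<dots> = (\<Sum>j<n. \<Sum>k<n. \<Sum>i<n. Q p i * diag_form n Q d i k * (X k j * Q q j))"
    by (rule sum_rotate)
  also have "\<dots> = (\<Sum>j<n. \<Sum>k<n. d p * Q p k * (X k j * Q q j))"
    unfolding sum_distrib_right[symmetric] using row[OF pq(1)] by simp
  also have "\<dots> = d p * conj_entry n Q X p q"
    unfolding conj_entry_def by (subst sum.swap) (simp add: sum_distrib_left mult_ac)
  finally have left: "(\<Sum>i<n. \<Sum>j<n. Q p i * (\<Sum>k<n. diag_form n Q d i k * X k j) * Q q j) = d p * conj_entry n Q X p q" .
  have "(\<Sum>i<n. \<Sum>j<n. Q p i * (\<Sum>k<n. X i k * diag_form n Q d k j) * Q q j)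
    = (\<Sum>i<n. \<Sum>j<n. \<Sum>k<n. Q p i * X i k * (Q q j * diag_form n Q d j k))"
    by (simp add: sum_distrib_left sum_distrib_right mult_ac diag_form_sym[of n Q d])
  also have "\<dots> = (\<Sum>i<n. \<Sum>k<n. Q p i * X i k * (\<Sum>j<n. Q q j * diag_form n Q d j k))"
    unfolding sum_distrib_left by (intro sum.cong refl sum.swap)
  also have "\<dots> = d q * conj_entry n Q X p q"
    unfolding row[OF pq(2)] conj_entry_def by (simp add: sum_distrib_left mult_ac)
  finally have right: "(\<Sum>i<n. \<Sum>j<n. Q p i * (\<Sum>k<n. X i k * diag_form n Q d k j) * Q q j) = d q * conj_entry n Q X p q" .
  have "conj_entry n Q (\<lambda>i j. (\<Sum>k<n. diag_form n Q d i k * X k j) - (\<Sum>k<n. X i k * diag_form n Q d k j)) p q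
    = (\<Sum>i<n. \<Sum>j<n. Q p i * (\<Sum>k<n. diag_form n Q d i k * X k j) * Q q j)
    - (\<Sum>i<n. \<Sum>j<n. Q p i * (\<Sum>k<n. X i k * diag_form n Q d k j) * Q q j)"
    unfolding conj_entry_def by (simp only: left_diff_distrib right_diff_distrib sum_subtractf)
  then show ?thesis unfolding left right by (simp add: algebra_simps)
qed

section \<open>Translation between matrix conditions and eigenbasis conditions\<close>

locale diagonalised =
  fixes n :: nat and Q :: "nat \<Rightarrow> nat \<Rightarrow> real" and d :: "nat \<Rightarrow> real" and A :: "real mat"
  assumes Q: "orth n Q" and A: "A \<in> carrier_mat n n"
    and AQ: "\<And>i j. i < n \<Longrightarrow> j < n \<Longrightarrow> A $$ (i, j) = diag_form n Q d i j"
begin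

abbreviation "N \<equiv> {(i, j). i < n \<and> j < n \<and> i \<noteq> j \<and> A $$ (i, j) = 0}"

lemma commutator_iff:
  assumes X: "X \<in> carrier_mat n n"
  shows "commutator A X = 0\<^sub>m n n \<longleftrightarrow> (\<forall>p<n. \<forall>q<n. (d p - d q) * conj_entry n Q (\<lambda>i j. X $$ (i, j)) p q = 0)"
proof -
  define Z where "Z i j = (\<Sum>k<n. diag_form n Q d i k * X $$ (k, j)) - (\<Sum>k<n. X $$ (i, k) * diag_form n Q d k j)" for i j
  have entry: "commutator A X $$ (i, j) = Z i j" if "i < n" "j < n" for i j
    using that A X AQ by (simp add: commutator_def Z_def scalar_prod_def atLeast0LessThan)
  have cjZ: "conj_entry n Q Z p q = (d p - d q) * conj_entry n Q (\<lambda>i j. X $$ (i, j)) p q" if "p < n" "q < n" for p q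
    unfolding Z_def[abs_def] by (rule conj_entry_commutator[OF Q that])
  have "commutator A X = 0\<^sub>m n n \<longleftrightarrow> (\<forall>i<n. \<forall>j<n. Z i j = 0)"
  proof
    assume "commutator A X = 0\<^sub>m n n"
    then show "\<forall>i<n. \<forall>j<n. Z i j = 0" using entry by (metis index_zero_mat(1))
  next
    assume "\<forall>i<n. \<forall>j<n. Z i j = 0"
    then show "commutator A X = 0\<^sub>m n n"
      using entry A X by (intro eq_matI) (auto simp: commutator_def)
  qed
  also have "\<dots> \<longleftrightarrow> (\<forall>p<n. \<forall>q<n. conj_entry n Q Z p q = 0)"
  proof
    assume "\<forall>i<n. \<forall>j<n. Z i j = 0"
    then show "\<forall>p<n. \<forall>q<n. conj_entry n Q Z p q = 0" by (simp add: conj_entry_def)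
  next
    assume "\<forall>p<n. \<forall>q<n. conj_entry n Q Z p q = 0"
    then show "\<forall>i<n. \<forall>j<n. Z i j = 0" using conj_back[OF Q, of _ _ Z] by auto
  qed
  finally show ?thesis using cjZ by simp
qed

lemma pattern_iff:
  assumes X: "X \<in> carrier_mat n n"
  shows "transpose_mat X = X \<and> entrywise_prod A X = 0\<^sub>m n n \<and> entrywise_prod (1\<^sub>m n) X = 0\<^sub>m n n \<longleftrightarrow>
    (\<forall>i<n. \<forall>j<n. X $$ (i, j) = X $$ (j, i)) \<and> (\<forall>i<n. \<forall>j<n. (i, j) \<notin> N \<longrightarrow> X $$ (i, j) = 0)"
    (is "?L1 \<and> ?L2 \<and> ?L3 \<longleftrightarrow> ?R1 \<and> ?R2")
proof -
  have eq0: "M = 0\<^sub>m n n \<longleftrightarrow> (\<forall>i<n. \<forall>j<n. M $$ (i, j) = 0)" if "M \<in> carrier_mat n n" for M :: "real mat"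
    using that by (auto intro!: eq_matI)
  have c: "entrywise_prod A X \<in> carrier_mat n n" "entrywise_prod (1\<^sub>m n) X \<in> carrier_mat n n"
    using A by (auto simp: entrywise_prod_def)
  have "?L1 \<longleftrightarrow> ?R1"
  proof
    assume "transpose_mat X = X"
    then show ?R1 using X by (metis carrier_matD index_transpose_mat(1))
  next
    assume R1: ?R1
    show ?L1
    proof (rule eq_matI)
      fix i j assume "i < dim_row X" "j < dim_col X"
      then have ij: "i < n" "j < n" using X by auto
      then have "X $$ (j, i) = X $$ (i, j)" using R1 by blast
      then show "transpose_mat X $$ (i, j) = X $$ (i, j)" using X ij by simp
    qed (use X in auto)
  qed
  moreover have "?L2 \<longleftrightarrow> (\<forall>i<n. \<forall>j<n. A $$ (i, j) = 0 \<or> X $$ (i, j) = 0)"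
    unfolding eq0[OF c(1)] using A by (auto simp: entrywise_prod_def)
  moreover have "?L3 \<longleftrightarrow> (\<forall>i<n. X $$ (i, i) = 0)"
    unfolding eq0[OF c(2)] by (auto simp: entrywise_prod_def)
  moreover have "(\<forall>i<n. \<forall>j<n. A $$ (i, j) = 0 \<or> X $$ (i, j) = 0) \<and> (\<forall>i<n. X $$ (i, i) = 0) \<longleftrightarrow> ?R2"
  proof -
    have N_iff: "(i, j) \<in> N \<longleftrightarrow> i < n \<and> j < n \<and> i \<noteq> j \<and> A $$ (i, j) = 0" for i j by simp
    show ?thesis unfolding N_iff by blast
  qed
  ultimately show ?thesis by argo
qed

lemma trace_pow:
  assumes X: "X \<in> carrier_mat n n" and sym: "\<And>i j. i < n \<Longrightarrow> j < n \<Longrightarrow> X $$ (i, j) = X $$ (j, i)"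
  shows "trace ((A ^\<^sub>m i) * X) = (\<Sum>k<n. d k ^ i * conj_entry n Q (\<lambda>i j. X $$ (i, j)) k k)"
proof -
  have "trace ((A ^\<^sub>m i) * X) = (\<Sum>a<n. \<Sum>b<n. (A ^\<^sub>m i) $$ (a, b) * X $$ (b, a))"
    using A X by (simp add: trace_def scalar_prod_def atLeast0LessThan)
  also have "\<dots> = (\<Sum>a<n. \<Sum>b<n. X $$ (a, b) * diag_form n Q (\<lambda>k. d k ^ i) a b)"
  proof (intro sum.cong refl)
    fix a b assume "a \<in> {..<n}" "b \<in> {..<n}"
    then have ab: "a < n" "b < n" by auto
    show "(A ^\<^sub>m i) $$ (a, b) * X $$ (b, a) = X $$ (a, b) * diag_form n Q (\<lambda>k. d k ^ i) a b"
    proof -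
      have "(A ^\<^sub>m i) $$ (a, b) = diag_form n Q (\<lambda>k. d k ^ i) a b"
        by (rule pow_mat_diag_form[OF Q A _ ab]) (rule AQ)
      then show ?thesis unfolding sym[OF ab] by (simp only: mult.commute)
    qed
  qed
  also have "\<dots> = (\<Sum>k<n. d k ^ i * conj_entry n Q (\<lambda>i j. X $$ (i, j)) k k)"
    by (rule sum_conj_entry_diag[symmetric])
  finally show ?thesis .
qed

lemma sum_by_classes:
  fixes f h :: "nat \<Rightarrow> real"
  shows "(\<Sum>k<n. g (d k) * h k) = (\<Sum>x\<in>d ` {..<n}. g x * (\<Sum>k | k < n \<and> d k = x. h k))"
proof -
  have "(\<Sum>k<n. g (d k) * h k) = (\<Sum>x\<in>d ` {..<n}. \<Sum>k | k \<in> {..<n} \<and> d k = x. g (d k) * h k)"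
    by (rule sum.image_gen) simp
  also have "\<dots> = (\<Sum>x\<in>d ` {..<n}. g x * (\<Sum>k | k < n \<and> d k = x. h k))"
    unfolding sum_distrib_left by (intro sum.cong) auto
  finally show ?thesis .
qed

text \<open>Lagrange interpolation: fewer than \<open>n\<close> powers separate at most \<open>n\<close> distinct eigenvalues.\<close>

lemma class_sums_zero:
  assumes pow: "\<And>i. i \<le> n - 1 \<Longrightarrow> (\<Sum>k<n. d k ^ i * y k) = 0"
  shows "(\<Sum>k | k < n \<and> d k = x. y k) = 0"
proof (cases "x \<in> d ` {..<n}")
  case False
  then have "{k. k < n \<and> d k = x} = {}" by auto
  then show ?thesis by (simp only: sum.empty)
next
  case True
  define S where "S = d ` {..<n} - {x}"
  define g where "g = (\<Prod>z\<in>S. [:- z, 1:])"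
  have fin: "finite S" by (simp add: S_def)
  have "degree g \<le> sum (degree \<circ> (\<lambda>z. [:- z, 1:])) S"
    unfolding g_def by (rule degree_prod_sum_le[OF fin])
  also have "\<dots> = card S" by simp
  also have "card S = card (d ` {..<n}) - 1" using True by (simp add: S_def)
  also have "\<dots> \<le> n - 1" using card_image_le[of "{..<n}" d] by simp
  finally have deg: "degree g \<le> n - 1" .
  have "(\<Sum>k<n. poly g (d k) * y k) = (\<Sum>i\<le>degree g. coeff g i * (\<Sum>k<n. d k ^ i * y k))"
    unfolding poly_altdef sum_distrib_left sum_distrib_right by (subst sum.swap) (simp add: mult_ac)
  also have "\<dots> = 0" using pow deg by simp
  finally have "(\<Sum>z\<in>d ` {..<n}. poly g z * (\<Sum>k | k < n \<and> d k = z. y k)) = 0"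
    unfolding sum_by_classes .
  moreover have "poly g z = 0" if "z \<in> S" for z
    unfolding g_def poly_prod using that fin by (intro prod_zero) auto
  then have "(\<Sum>z\<in>d ` {..<n}. poly g z * (\<Sum>k | k < n \<and> d k = z. y k)) = poly g x * (\<Sum>k | k < n \<and> d k = x. y k)"
    using True by (subst sum.remove[of _ x]) (auto simp: S_def)
  moreover have "poly g x \<noteq> 0"
    unfolding g_def poly_prod using fin by (auto simp: S_def)
  ultimately show ?thesis by simp
qed

text \<open>Grouping a power trace by eigenvalues shows that vanishing class sums force all power
  traces to vanish, in particular those in the definition of \<open>SMP\<close>.\<close>

lemma SSP_imp_strong_prop: "SSP A \<Longrightarrow> strong_prop True n N Q d"
  and SMP_imp_strong_prop: "SMP A \<Longrightarrow> strong_prop False n N Q d"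
proof -
  have key: "\<forall>i<n. \<forall>j<n. X i j = 0"
    if strong: "\<And>Y. Y \<in> carrier_mat n n \<Longrightarrow> transpose_mat Y = Y \<and> entrywise_prod A Y = 0\<^sub>m n n \<and>
        entrywise_prod (1\<^sub>m n) Y = 0\<^sub>m n n \<Longrightarrow> commutator A Y = 0\<^sub>m n n \<Longrightarrow>
        (\<not> sp \<Longrightarrow> \<forall>i. trace ((A ^\<^sub>m i) * Y) = 0) \<Longrightarrow> Y = 0\<^sub>m n n"
      and X: "\<And>i j. i < n \<Longrightarrow> j < n \<Longrightarrow> X i j = X j i" "\<And>i j. i < n \<Longrightarrow> j < n \<Longrightarrow> (i, j) \<notin> N \<Longrightarrow> X i j = 0"
        "\<And>p q. p < n \<Longrightarrow> q < n \<Longrightarrow> (d p - d q) * conj_entry n Q X p q = 0"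
        "\<And>x. \<not> sp \<Longrightarrow> (\<Sum>k | k < n \<and> d k = x. conj_entry n Q X k k) = 0" for sp X
  proof -
    define Y where "Y = mat n n (\<lambda>(i, j). X i j)"
    have Yc: "Y \<in> carrier_mat n n" by (simp add: Y_def)
    have cjY: "conj_entry n Q (\<lambda>i j. Y $$ (i, j)) p q = conj_entry n Q X p q" for p q
      unfolding conj_entry_def by (intro sum.cong refl) (simp add: Y_def)
    have Ysym: "Y $$ (i, j) = Y $$ (j, i)" if "i < n" "j < n" for i j
      using X(1)[OF that] that by (simp add: Y_def)
    have "Y = 0\<^sub>m n n"
    proof (rule strong[OF Yc])
      show "transpose_mat Y = Y \<and> entrywise_prod A Y = 0\<^sub>m n n \<and> entrywise_prod (1\<^sub>m n) Y = 0\<^sub>m n n"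
        unfolding pattern_iff[OF Yc]
      proof (intro conjI allI impI)
        show "Y $$ (i, j) = Y $$ (j, i)" if "i < n" "j < n" for i j by (rule Ysym[OF that])
        show "Y $$ (i, j) = 0" if "i < n" "j < n" "(i, j) \<notin> N" for i j
          using X(2)[OF that] that(1,2) by (simp add: Y_def)
      qed
      show "commutator A Y = 0\<^sub>m n n"
        unfolding commutator_iff[OF Yc] cjY using X(3) by blast
      show "\<forall>i. trace ((A ^\<^sub>m i) * Y) = 0" if "\<not> sp"
      proof
        fix i
        have "trace ((A ^\<^sub>m i) * Y) = (\<Sum>k<n. d k ^ i * conj_entry n Q (\<lambda>i j. Y $$ (i, j)) k k)"
          by (rule trace_pow[OF Yc]) (rule Ysym)
        also have "\<dots> = (\<Sum>x\<in>d ` {..<n}. x ^ i * (\<Sum>k | k < n \<and> d k = x. conj_entry n Q X k k))"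
          unfolding cjY by (rule sum_by_classes)
        also have "\<dots> = 0" using X(4)[OF that] by simp
        finally show "trace ((A ^\<^sub>m i) * Y) = 0" .
      qed
    qed
    then have "Y $$ (i, j) = 0" if "i < n" "j < n" for i j using that by simp
    then show ?thesis by (simp add: Y_def)
  qed
  show "strong_prop True n N Q d" if "SSP A"
    by (rule strong_prop_I, rule key[of True]) (use that A in \<open>auto simp: SSP_def Let_def\<close>)
  show "strong_prop False n N Q d" if "SMP A"
    by (rule strong_prop_I, rule key[of False]) (use that A in \<open>auto simp: SMP_def Let_def\<close>)
qed

text \<open>The definition of \<open>SMP\<close> requires the traces from \<open>i = 2\<close> to
  \<open>n - 1\<close>. The cases \<open>i = 0\<close> and \<open>i = 1\<close> are automatic for an
  admissible \<open>X\<close>, and the resulting \<open>n\<close> power traces determine the class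
  sums.\<close>

lemma strong_prop_imp_SSP: "strong_prop True n N Q d \<Longrightarrow> SSP A"
  and strong_prop_imp_SMP: "strong_prop False n N Q d \<Longrightarrow> SMP A"
proof -
  have key: "X = 0\<^sub>m n n"
    if strong_prop: "strong_prop sp n N Q d" and X: "X \<in> carrier_mat n n" and pat: "transpose_mat X = X \<and> entrywise_prod A X = 0\<^sub>m n n \<and>
        entrywise_prod (1\<^sub>m n) X = 0\<^sub>m n n" and comm: "commutator A X = 0\<^sub>m n n"
      and tr: "\<not> sp \<Longrightarrow> \<forall>i\<in>{2..n - 1}. trace ((A ^\<^sub>m i) * X) = 0" for sp X
  proof -
    note pat' = pat[unfolded pattern_iff[OF X]]
    have sym: "\<And>i j. i < n \<Longrightarrow> j < n \<Longrightarrow> X $$ (i, j) = X $$ (j, i)"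
      and supp: "\<And>i j. i < n \<Longrightarrow> j < n \<Longrightarrow> (i, j) \<notin> N \<Longrightarrow> X $$ (i, j) = 0"
      using pat' by blast+
    have tr': "(\<Sum>k<n. d k ^ i * conj_entry n Q (\<lambda>i j. X $$ (i, j)) k k) = 0" if "\<not> sp" "i \<le> n - 1" for i
    proof -
      \<comment> \<open>The identity and \<open>A\<close> vanish at all positions in
        \<open>N\<close>, while \<open>X\<close> vanishes at all others, so the products are 0 entry
        by entry.\<close>
      have "(\<Sum>a<n. \<Sum>b<n. X $$ (a, b) * diag_form n Q (\<lambda>k. d k ^ i) a b) = 0" if "i = 0 \<or> i = 1"
      proof (intro sum.neutral ballI)
        fix a b assume "a \<in> {..<n}" "b \<in> {..<n}"
        then have ab: "a < n" "b < n" by auto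
        show "X $$ (a, b) * diag_form n Q (\<lambda>k. d k ^ i) a b = 0"
        proof (cases "(a, b) \<in> N")
          case True
          then have "diag_form n Q (\<lambda>k. d k ^ i) a b = 0"
            using that AQ[OF ab] Q by (auto simp: diag_form_def orth_def)
          then show ?thesis by simp
        qed (use supp[OF ab] in simp)
      qed
      moreover have "i \<in> {2..n - 1} \<or> i = 0 \<or> i = 1" using that(2) by auto
      ultimately show ?thesis
        using tr[OF that(1)] trace_pow[OF X sym, of i] sum_conj_entry_diag[of "\<lambda>k. d k ^ i" n Q "\<lambda>i j. X $$ (i, j)"] by auto
    qed
    have "X $$ (i, j) = 0" if ij: "i < n" "j < n" for i j
    proof (rule strong_prop_D[OF strong_prop _ _ _ _ ij, where X = "\<lambda>i j. X $$ (i, j)"])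
      show "(d p - d q) * conj_entry n Q (\<lambda>i j. X $$ (i, j)) p q = 0" if "p < n" "q < n" for p q
        using comm that unfolding commutator_iff[OF X] by blast
      show "(\<Sum>k | k < n \<and> d k = x. conj_entry n Q (\<lambda>i j. X $$ (i, j)) k k) = 0" if "\<not> sp" for x
        by (rule class_sums_zero) (rule tr'[OF that])
    qed (use sym supp in blast)+
    then show ?thesis using X by (intro eq_matI) auto
  qed
  show "SSP A" if "strong_prop True n N Q d"
    using key[OF that] A by (auto simp: SSP_def Let_def)
  show "SMP A" if "strong_prop False n N Q d"
    using key[OF that] A by (auto simp: SMP_def Let_def)
qed

end

section \<open>Relabelling vertices\<close>

lemma conj_entry_reindex:
  assumes h: "bij_betw h {..<m} {..<m :: nat}" and Z: "\<And>i j. i < m \<Longrightarrow> j < m \<Longrightarrow> Z (h i) (h j) = X i j"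
  shows "conj_entry m (\<lambda>k i. Q k (h i)) X p q = conj_entry m Q Z p q"
proof -
  have "conj_entry m (\<lambda>k i. Q k (h i)) X p q = (\<Sum>i<m. \<Sum>j<m. Q p (h i) * Z (h i) (h j) * Q q (h j))"
    unfolding conj_entry_def by (intro sum.cong refl) (auto simp: Z)
  also have "\<dots> = (\<Sum>i<m. \<Sum>j<m. Q p (h i) * Z (h i) j * Q q j)"
    by (intro sum.cong refl sum.reindex_bij_betw[OF h])
  also have "\<dots> = conj_entry m Q Z p q"
    unfolding conj_entry_def by (rule sum.reindex_bij_betw[OF h])
  finally show ?thesis .
qed

text \<open>Undoing the operations numbers the vertices in the order of their return, whereas
  \<open>sym_mats\<close> puts vertex \<open>i\<close> at index \<open>i\<close>. Only the columns
  of \<open>Q\<close> are permuted; eigenvalues and eigenbasis keep their numbering.\<close>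

lemma realizes_reindex:
  assumes R: "realizes sp K m g Q d" and h: "bij_betw h {..<m} {..<m}"
  shows "realizes sp K m (g \<circ> h) (\<lambda>k i. Q k (h i)) d"
proof -
  have g: "bij_betw g {..<m} (verts K)" and Q: "orth m Q" and strong_prop: "strong_prop sp m (nonedges K m g) Q d"
    and pat: "\<And>i j. i < m \<Longrightarrow> j < m \<Longrightarrow> i \<noteq> j \<Longrightarrow> diag_form m Q d i j \<noteq> 0 \<longleftrightarrow> {g i, g j} \<in> edges K"
    using R by (auto simp: realizes_def)
  have hm: "h i < m" if "i < m" for i using h that by (auto simp: bij_betw_def)
  have hinj: "h i = h j \<longleftrightarrow> i = j" if "i < m" "j < m" for i j
    using h that by (auto simp: bij_betw_def inj_on_def)
  have "orth m (\<lambda>k i. Q k (h i))"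
    using Q hm hinj unfolding orth_def by simp
  moreover have "diag_form m (\<lambda>k i. Q k (h i)) d i j = diag_form m Q d (h i) (h j)" for i j
    by (simp add: diag_form_def)
  moreover have "strong_prop sp m (nonedges K m (g \<circ> h)) (\<lambda>k i. Q k (h i)) d"
  proof (rule strong_prop_I)
    fix X
    assume sym: "\<And>i j. i < m \<Longrightarrow> j < m \<Longrightarrow> X i j = X j i"
      and supp: "\<And>i j. i < m \<Longrightarrow> j < m \<Longrightarrow> (i, j) \<notin> nonedges K m (g \<circ> h) \<Longrightarrow> X i j = 0"
      and comm: "\<And>p q. p < m \<Longrightarrow> q < m \<Longrightarrow> (d p - d q) * conj_entry m (\<lambda>k i. Q k (h i)) X p q = 0"
      and tr: "\<And>y. \<not> sp \<Longrightarrow> (\<Sum>k | k < m \<and> d k = y. conj_entry m (\<lambda>k i. Q k (h i)) X k k) = 0"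
    define h' where "h' = inv_into {..<m} h"
    have h': "h' i < m" "h (h' i) = i" if "i < m" for i
      using that h bij_betw_inv_into_right[OF h, of i] bij_betw_inv_into[OF h]
      by (auto simp: h'_def bij_betw_def)
    have h'h: "h' (h i) = i" if "i < m" for i
      using that bij_betw_inv_into_left[OF h, of i] by (simp add: h'_def)
    define Z where "Z i j = X (h' i) (h' j)" for i j
    have cjZ: "conj_entry m (\<lambda>k i. Q k (h i)) X p q = conj_entry m Q Z p q" for p q
      by (rule conj_entry_reindex[OF h]) (simp add: Z_def h'h)
    have Z0: "Z i j = 0" if ij: "i < m" "j < m" for i j
    proof (rule strong_prop_D[OF strong_prop _ _ _ _ ij])
      show "Z i j = Z j i" if "i < m" "j < m" for i j
        unfolding Z_def using that h' by (intro sym) auto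
      show "Z i j = 0" if "i < m" "j < m" "(i, j) \<notin> nonedges K m g" for i j
        unfolding Z_def
      proof (rule supp)
        show "(h' i, h' j) \<notin> nonedges K m (g \<circ> h)"
          using that h' hinj by (auto simp: nonedges_def)
      qed (use that h' in auto)
      show "(d p - d q) * conj_entry m Q Z p q = 0" if "p < m" "q < m" for p q
        using comm[OF that] by (simp only: cjZ)
      show "(\<Sum>k | k < m \<and> d k = y. conj_entry m Q Z k k) = 0" if "\<not> sp" for y
        using tr[OF that, of y] by (simp only: cjZ)
    qed
    show "\<forall>i<m. \<forall>j<m. X i j = 0"
    proof (intro allI impI)
      fix i j assume ij: "i < m" "j < m"
      have "Z (h i) (h j) = 0" using ij hm by (intro Z0) auto
      then show "X i j = 0" using ij by (simp add: Z_def h'h)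
    qed
  qed
  ultimately show ?thesis
    using bij_betw_trans[OF h g] pat hm hinj by (simp add: realizes_def)
qed

lemma realizes_matrix:
  assumes R: "realizes sp H m g Q d" and V: "verts H = {0..<m}"
  obtains A where "A \<in> sym_mats H" "spec A = eigvals m d" "spectrum A = d ` {..<m}" "SMP A" "sp \<Longrightarrow> SSP A"
proof -
  have g: "bij_betw g {..<m} {..<m}" using R V by (simp add: realizes_def atLeast0LessThan)
  define h where "h = inv_into {..<m} g"
  have h: "bij_betw h {..<m} {..<m}" unfolding h_def by (rule bij_betw_inv_into[OF g])
  have gh: "(g \<circ> h) i = i" if "i < m" for i
    using that bij_betw_inv_into_right[OF g, of i] by (simp add: h_def)
  define U where "U k i = Q k (h i)" for k i
  have RU: "realizes sp H m (g \<circ> h) U d"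
    unfolding U_def[abs_def] by (rule realizes_reindex[OF R h])
  then have U: "orth m U" and strong_prop: "strong_prop sp m (nonedges H m (g \<circ> h)) U d"
    and pat: "\<And>i j. i < m \<Longrightarrow> j < m \<Longrightarrow> i \<noteq> j \<Longrightarrow> diag_form m U d i j \<noteq> 0 \<longleftrightarrow> {i, j} \<in> edges H"
    using gh by (auto simp: realizes_def)
  define A where "A = mat m m (\<lambda>(i, j). diag_form m U d i j)"
  interpret diagonalised m U d A
    by unfold_locales (auto simp: A_def U)
  have "diag_form m U d i j = 0 \<longleftrightarrow> {i, j} \<notin> edges H" if "i < m" "j < m" "i \<noteq> j" for i j
    using pat[OF that] by blast
  then have N: "N = nonedges H m (g \<circ> h)"
    using gh by (auto simp: A_def nonedges_def)
  have "transpose_mat A = A"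
    by (rule eq_matI) (auto simp: A_def diag_form_sym[of m U d])
  then have "A \<in> sym_mats H"
    using A pat by (auto simp: sym_mats_def V A_def)
  \<comment> \<open>The SSP implies the SMP: the latter puts more conditions on the test
    matrix.\<close>
  moreover have "strong_prop False m N U d"
  proof (rule strong_prop_I, intro allI impI)
    fix X i j
    assume ij: "i < m" "j < m" and X: "\<And>i j. i < m \<Longrightarrow> j < m \<Longrightarrow> X i j = X j i"
      "\<And>i j. i < m \<Longrightarrow> j < m \<Longrightarrow> (i, j) \<notin> N \<Longrightarrow> X i j = 0"
      "\<And>p q. p < m \<Longrightarrow> q < m \<Longrightarrow> (d p - d q) * conj_entry m U X p q = 0"
      "\<And>x. \<not> False \<Longrightarrow> (\<Sum>k | k < m \<and> d k = x. conj_entry m U X k k) = 0"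
    show "X i j = 0"
      by (rule strong_prop_D[OF strong_prop[folded N] X(1) X(2) X(3) X(4) ij]) auto
  qed
  moreover have "strong_prop True m N U d" if sp using strong_prop that N by simp
  ultimately show thesis
    using that[of A] spec_diag_form[OF U A] AQ strong_prop_imp_SMP strong_prop_imp_SSP by blast
qed

section \<open>From spectra to multiplicity lists\<close>

definition mlist :: "real multiset \<Rightarrow> nat list" where
  "mlist E = map (count E) (sorted_list_of_set (set_mset E))"

text \<open>The witness \<open>f\<close> sends the position of \<open>x\<close> in the sorted old
  spectrum to the position of \<open>\<phi> x\<close> in the new one. The positions it misses belong
  to \<open>S\<close> or \<open>B\<close>, and the values in \<open>B\<close> lie above the image of
  the largest old eigenvalue, so at most \<open>card S\<close> of these positions are strictly
  inside.\<close>

lemma extends_spec_adds_ones: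
  assumes ext: "extends_spec sp r s M E E'" and ne: "E \<noteq> {#}"
  shows "adds_ones (r + s) s (mlist E) (mlist E')"
proof -
  obtain \<phi> S B where mono: "strict_mono_on (set_mset E) \<phi>" and fin: "finite S" "finite B" and card: "card S = s" "card B = r"
    and disj: "S \<inter> B = {}" "(S \<union> B) \<inter> \<phi> ` set_mset E = {}" and big: "\<forall>y\<in>B. \<forall>x\<in>set_mset E. \<phi> x < y"
    and E': "E' = image_mset \<phi> E + mset_set S + mset_set B"
    using ext unfolding extends_spec_def by (elim exE conjE) (rule that)
  define l where "l = sorted_list_of_set (set_mset E)"
  define l' where "l' = sorted_list_of_set (set_mset E')"
  have inj: "inj_on \<phi> (set_mset E)" by (rule strict_mono_on_imp_inj_on[OF mono])
  have setE': "set_mset E' = \<phi> ` set_mset E \<union> S \<union> B"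
    unfolding E' using fin by auto
  have set_l: "set l = set_mset E" "set l' = set_mset E'" and dist: "distinct l'"
    and sorted: "sorted_wrt (<) l" "sorted_wrt (<) l'"
    by (auto simp: l_def l'_def)
  have len_l: "length l = card (set_mset E)" by (simp add: l_def)
  have len_l': "length l' = length l + (r + s)"
  proof -
    have "card (\<phi> ` set_mset E \<union> (S \<union> B)) = card (\<phi> ` set_mset E) + card (S \<union> B)"
      using fin disj by (intro card_Un_disjoint) auto
    also have "card (S \<union> B) = s + r" using fin disj card by (simp add: card_Un_disjoint)
    also have "card (\<phi> ` set_mset E) = card (set_mset E)" by (rule card_image[OF inj])
    finally show ?thesis by (simp add: l'_def setE' len_l Un_assoc)
  qed
  have "\<forall>i<length l. \<exists>j<length l'. l' ! j = \<phi> (l ! i)"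
  proof (intro allI impI)
    fix i assume "i < length l"
    then have "\<phi> (l ! i) \<in> set l'" using set_l setE' nth_mem by auto
    then show "\<exists>j<length l'. l' ! j = \<phi> (l ! i)" by (simp add: in_set_conv_nth)
  qed
  then obtain f where f: "\<And>i. i < length l \<Longrightarrow> f i < length l'" "\<And>i. i < length l \<Longrightarrow> l' ! f i = \<phi> (l ! i)"
    by metis
  have less_iff: "l' ! i < l' ! j \<longleftrightarrow> i < j" if "i < length l'" "j < length l'" for i j
    using sorted_wrt_nth_less[OF sorted(2), of i j] sorted_wrt_nth_less[OF sorted(2), of j i] that
    by (cases i j rule: linorder_cases) auto
  have count_S: "count (mset_set T) x = (if x \<in> T then 1 else 0)" if "finite T" for T and x :: real
    using that by (simp add: count_mset_set')
  have count_im: "count (image_mset \<phi> E) (\<phi> x) = count E x" if "x \<in># E" for x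
  proof -
    have "{y. y \<in># E \<and> \<phi> x = \<phi> y} = {x}" using inj that by (auto simp: inj_on_def)
    then show ?thesis unfolding count_image_mset' by simp
  qed
  have new: "l' ! j \<in> S \<union> B" if "j \<in> {..<length l'} - f ` {..<length l}" for j
  proof (rule ccontr)
    assume "l' ! j \<notin> S \<union> B"
    moreover have "l' ! j \<in> set_mset E'" using that set_l(2) nth_mem by blast
    ultimately obtain x where x: "x \<in># E" "l' ! j = \<phi> x" unfolding setE' by auto
    then obtain i where i: "i < length l" "l ! i = x" using set_l(1) by (metis in_set_conv_nth)
    have "j = f i" using nth_eq_iff_index_eq[OF dist, of j "f i"] f[OF i(1)] i(2) x(2) that by auto
    then show False using that i(1) by auto
  qed
  have ne_l: "length l > 0" using ne by (simp add: len_l card_gt_0_iff)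
  have "strict_mono_on {..<length l} f"
  proof (rule strict_mono_onI)
    fix i j assume ij: "i \<in> {..<length l}" "j \<in> {..<length l}" "i < j"
    then have "l ! i < l ! j" using sorted_wrt_nth_less[OF sorted(1)] by auto
    moreover have "l ! i \<in># E" "l ! j \<in># E"
      using ij set_l(1) nth_mem[of i l] nth_mem[of j l] by auto
    ultimately have "\<phi> (l ! i) < \<phi> (l ! j)"
      using mono by (simp add: strict_mono_on_def)
    then show "f i < f j" using less_iff[of "f i" "f j"] f[of i] f[of j] ij by simp
  qed
  moreover have "f ` {..<length l} \<subseteq> {..<length l'}" using f by auto
  moreover have "mlist E' ! f i = mlist E ! i" if "i < length l" for i
  proof -
    have x: "l ! i \<in># E" using that set_l(1) nth_mem by blast
    then have "\<phi> (l ! i) \<notin> S" "\<phi> (l ! i) \<notin> B" using disj(2) by auto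
    then have "count E' (\<phi> (l ! i)) = count E (l ! i)"
      unfolding E' using count_im[OF x] fin by (simp add: count_S)
    then show ?thesis
      using f[OF that] that by (simp add: mlist_def l_def[symmetric] l'_def[symmetric])
  qed
  moreover have "mlist E' ! j = 1" if j: "j \<in> {..<length l'} - f ` {..<length l}" for j
  proof -
    have "l' ! j \<notin> \<phi> ` set_mset E" using new[OF j] disj(2) by blast
    then have "count (image_mset \<phi> E) (l' ! j) = 0" by (auto simp: count_eq_zero_iff)
    then have "count E' (l' ! j) = 1"
      unfolding E' using new[OF j] disj(1) fin by (auto simp: count_S)
    then show ?thesis using j by (simp add: mlist_def l'_def[symmetric])
  qed
  moreover have "card {j \<in> {..<length l'} - f ` {..<length l}. f 0 < j \<and> j < f (length l - 1)} \<le> s"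
  proof -
    have last: "length l - 1 < length l" using ne_l by simp
    have "(\<lambda>j. l' ! j) ` {j \<in> {..<length l'} - f ` {..<length l}. f 0 < j \<and> j < f (length l - 1)} \<subseteq> S"
    proof
      fix y assume "y \<in> (\<lambda>j. l' ! j) ` {j \<in> {..<length l'} - f ` {..<length l}. f 0 < j \<and> j < f (length l - 1)}"
      then obtain j where j: "j \<in> {..<length l'} - f ` {..<length l}" "j < f (length l - 1)" "y = l' ! j" by auto
      then have "y < \<phi> (l ! (length l - 1))"
        using less_iff[of j "f (length l - 1)"] f[OF last] by simp
      moreover have "l ! (length l - 1) \<in># E" using set_l(1) nth_mem[OF last] by simp
      ultimately have "y \<notin> B" using big by force
      then show "y \<in> S" using new[OF j(1)] j(3) by blast
    qed
    moreover have "inj_on (\<lambda>j. l' ! j) {j \<in> {..<length l'} - f ` {..<length l}. f 0 < j \<and> j < f (length l - 1)}"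
      using dist by (auto simp: inj_on_def nth_eq_iff_index_eq)
    ultimately show ?thesis using card_inj_on_le[of _ _ S] fin(1) card(1) by metis
  qed
  moreover have "length (mlist E) = length l" "length (mlist E') = length l'"
    by (simp_all add: mlist_def l_def l'_def)
  ultimately show ?thesis
    unfolding adds_ones_def using len_l' by (intro conjI exI[of _ f]) simp_all
qed

text \<open>For the SSP the shift is the identity and \<open>S = M\<close>, so the spectrum grows by
  exactly the two sets \<open>M\<close> and \<open>B\<close>, the second lying above
  \<open>hi\<close>.\<close>

lemma extends_spec_strong:
  assumes ext: "extends_spec True r s M E E'" and ne: "E \<noteq> {#}"
  defines "lo \<equiv> Min (set_mset E)" and "hi \<equiv> Max (set_mset E)"
  shows "E \<subseteq># E'" "\<forall>x\<in>#E' - E. count E' x = 1"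
    "size {#x \<in># E' - E. lo < x \<and> x < hi#} \<le> s"
    "\<forall>x\<in>M. x \<in># E' - E" "\<forall>x\<in>#E' - E. lo < x \<and> x < hi \<longrightarrow> x \<in> M"
proof -
  obtain \<phi> S B where fin: "finite S" "finite B" and card: "card S = s" "card B = r"
    and disj: "S \<inter> B = {}" "(S \<union> B) \<inter> \<phi> ` set_mset E = {}" and big: "\<forall>y\<in>B. \<forall>x\<in>set_mset E. \<phi> x < y"
    and sp: "True \<longrightarrow> S = M \<and> (\<forall>x. \<phi> x = x)"
    and E': "E' = image_mset \<phi> E + mset_set S + mset_set B"
    using ext unfolding extends_spec_def by (elim exE conjE) (rule that)
  have "\<phi> = (\<lambda>x. x)" and S: "S = M" using sp by auto
  then have E': "E' = E + (mset_set M + mset_set B)" and disj': "M \<inter> B = {}" "(M \<union> B) \<inter> set_mset E = {}"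
    and big': "\<forall>y\<in>B. \<forall>x\<in>set_mset E. x < y" and finM: "finite M" and cardM: "card M = s"
    using E' disj big fin card by auto
  have diff: "E' - E = mset_set M + mset_set B" unfolding E' by simp
  have hi: "hi < y" if "y \<in> B" for y
    using big' that ne unfolding hi_def by simp
  show "E \<subseteq># E'" unfolding E' by simp
  show "\<forall>x\<in>#E' - E. count E' x = 1"
  proof
    fix x assume "x \<in># E' - E"
    then have x: "x \<in> M \<union> B" unfolding diff using finM fin by auto
    then have "count E x = 0" using disj' by (auto simp: count_eq_zero_iff)
    then show "count E' x = 1" unfolding E' using x disj' finM fin by (auto simp: count_mset_set')
  qed
  have B0: "filter_mset (\<lambda>x. lo < x \<and> x < hi) (mset_set B) = {#}"
  proof -
    have "\<not> x < hi" if "x \<in> B" for x using hi[OF that] by simp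
    then have e: "{x \<in> B. lo < x \<and> x < hi} = {}" by blast
    show ?thesis unfolding filter_mset_mset_set[OF fin(2)] e by simp
  qed
  have "size (filter_mset (\<lambda>x. lo < x \<and> x < hi) (mset_set M)) \<le> size (mset_set M)"
    by (rule size_filter_mset_lesseq)
  then show "size {#x \<in># E' - E. lo < x \<and> x < hi#} \<le> s"
    unfolding diff filter_union_mset B0 using cardM by simp
  show "\<forall>x\<in>M. x \<in># E' - E" unfolding diff using finM by simp
  show "\<forall>x\<in>#E' - E. lo < x \<and> x < hi \<longrightarrow> x \<in> M"
    unfolding diff using finM fin hi by (auto dest: less_asym)
qed

text \<open>The spectral theorem supplies the eigenbasis, and the inverse of the graph isomorphism
  serves as the labelling of \<open>K\<close> by matrix indices.\<close>

lemma realizes_of_matrix: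
  assumes A: "A \<in> sym_mats G" and V: "verts G = {0..<n}" and iso: "graph_iso K G" and K: "sgraph K"
    and SMP: "SMP A"
  obtains g Q d where "spec A = eigvals n d" "spectrum A = d ` {..<n}"
    "realizes False K n g Q d" "SSP A \<Longrightarrow> realizes True K n g Q d"
proof -
  have Ac: "A \<in> carrier_mat n n" and sym: "transpose_mat A = A"
    and pat: "\<And>i j. i < n \<Longrightarrow> j < n \<Longrightarrow> i \<noteq> j \<Longrightarrow> A $$ (i, j) \<noteq> 0 \<longleftrightarrow> {i, j} \<in> edges G"
    using A by (auto simp: sym_mats_def V)
  have "A $$ (i, j) = A $$ (j, i)" if "i < n" "j < n" for i j
    using sym Ac that by (metis carrier_matD index_transpose_mat(1))
  then obtain Q d where Q: "orth n Q" and AQ: "\<And>i j. i < n \<Longrightarrow> j < n \<Longrightarrow> A $$ (i, j) = diag_form n Q d i j"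
    using spectral_theorem[of n "\<lambda>i j. A $$ (i, j)"] by metis
  interpret diagonalised n Q d A
    by unfold_locales (use Ac AQ Q in auto)
  obtain f where f: "bij_betw f (verts K) (verts G)" and E: "edges G = (\<lambda>e. f ` e) ` edges K"
    using iso by (auto simp: graph_iso_def)
  define g where "g = inv_into (verts K) f"
  have f': "bij_betw f (verts K) {..<n}" using f V by (simp add: atLeast0LessThan)
  have g: "bij_betw g {..<n} (verts K)" unfolding g_def by (rule bij_betw_inv_into[OF f'])
  have fg: "f (g i) = i" if "i < n" for i
    using that bij_betw_inv_into_right[OF f', of i] by (simp add: g_def)
  have gf: "g (f x) = x" if "x \<in> verts K" for x
    using that bij_betw_inv_into_left[OF f', of x] by (simp add: g_def)
  have edge: "{i, j} \<in> edges G \<longleftrightarrow> {g i, g j} \<in> edges K" if ij: "i < n" "j < n" for i j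
  proof
    assume "{i, j} \<in> edges G"
    then obtain e where e: "e \<in> edges K" "{i, j} = f ` e" unfolding E by auto
    from sgraphE[OF K e(1)] obtain x y where xy: "e = {x, y}" "x \<in> verts K" "y \<in> verts K" .
    have "g ` {i, j} = e" unfolding e(2) xy(1) using gf xy by simp
    then show "{g i, g j} \<in> edges K" using e(1) by simp
  next
    assume "{g i, g j} \<in> edges K"
    then have "f ` {g i, g j} \<in> edges G" unfolding E by blast
    then show "{i, j} \<in> edges G" using fg ij by simp
  qed
  have pat': "\<forall>i<n. \<forall>j<n. i \<noteq> j \<longrightarrow> (diag_form n Q d i j \<noteq> 0 \<longleftrightarrow> {g i, g j} \<in> edges K)"
    using pat edge AQ by simp
  have "A $$ (i, j) = 0 \<longleftrightarrow> {g i, g j} \<notin> edges K" if "i < n" "j < n" "i \<noteq> j" for i j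
    using pat[OF that] edge[OF that(1,2)] by blast
  then have N: "N = nonedges K n g"
    by (auto simp: nonedges_def)
  have "realizes False K n g Q d"
    using g Q pat' SMP_imp_strong_prop[OF SMP] unfolding realizes_def N by blast
  moreover have "realizes True K n g Q d" if "SSP A"
    using g Q pat' SSP_imp_strong_prop[OF that] unfolding realizes_def N by blast
  ultimately show thesis
    using that[of d g Q] spec_diag_form[OF Q Ac AQ] by blast
qed

text \<open>Arbitrary choice is expressed by quantifying over \<open>M\<close>. It has to avoid the
  spectrum of \<open>A\<close>, since an additional eigenvalue inside it would not be
  simple.\<close>

theorem theorem6p12:
  fixes G H :: "nat graph" and A :: "real mat" and n N r s :: nat
  assumes "simple_graph G" and "verts G = {0..<n}"
    and "simple_graph H" and "verts H = {0..<N}"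
    and "minor_by r s G H"
    and "A \<in> sym_mats G"
    and "SMP A"
  shows "(\<exists>A' \<in> sym_mats H. SMP A' \<and> adds_ones (r + s) s (mult_list A) (mult_list A')) \<and>
    (SSP A \<longrightarrow>
      (\<forall>M. finite M \<and> card M = s \<and> M \<inter> spectrum A = {} \<longrightarrow>
        (\<exists>A' \<in> sym_mats H.
          SMP A' \<and> adds_ones (r + s) s (mult_list A) (mult_list A') \<and>
          SSP A' \<and>
          spec A \<subseteq># spec A' \<and>
          (\<forall>x \<in># spec A' - spec A. count (spec A') x = 1) \<and>
          size {#x \<in># spec A' - spec A. lambda_min A < x \<and> x < lambda_max A#} \<le> s \<and>
          (\<forall>x \<in> M. x \<in># spec A' - spec A) \<and>
          (\<forall>x \<in># spec A' - spec A. lambda_min A < x \<and> x < lambda_max A \<longrightarrow> x \<in> M))))"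
proof -
  have H: "sgraph H" and n: "n > 0"
    using assms(1-3) by (auto simp: simple_graph_def sgraph_def)
  obtain K where ops: "minor_ops H r s K" and iso: "graph_iso K G"
    using assms(5) by (auto simp: minor_by_def)
  have K: "sgraph K" by (rule sgraph_minor_ops[OF ops H])
  obtain g Q d where specA: "spec A = eigvals n d" and spectrumA: "spectrum A = d ` {..<n}"
    and R: "realizes False K n g Q d" "SSP A \<Longrightarrow> realizes True K n g Q d"
    using realizes_of_matrix[OF assms(6,2) iso K assms(7)] by metis
  \<comment> \<open>Nonemptiness gives meaning to the smallest and largest eigenvalue and to the
    first and last position of the multiplicity list.\<close>
  have ne: "spec A \<noteq> {#}" unfolding specA using n by (auto simp: eigvals_def mset_set_empty_iff)
  have ml: "mult_list A = mlist (spec A)"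
    by (simp add: mult_list_def mlist_def specA spectrumA)
  \<comment> \<open>Stated for both values of the flag, so that the two halves of the theorem are
    instances of one construction.\<close>
  have step: "\<exists>A'\<in>sym_mats H. SMP A' \<and> (sp \<longrightarrow> SSP A') \<and> extends_spec sp r s M (spec A) (spec A')
      \<and> adds_ones (r + s) s (mult_list A) (mult_list A')"
    if R: "realizes sp K n g Q d" and M: "sp \<Longrightarrow> finite M \<and> card M = s \<and> M \<inter> d ` {..<n} = {}" for sp M
  proof -
    obtain g' Q' d' where R': "realizes sp H (n + r + s) g' Q' d'"
      and ext: "extends_spec sp r s M (eigvals n d) (eigvals (n + r + s) d')"
      using realizes_minor[OF ops H R M] by blast
    have "card (verts H) = n + r + s"
      using R' bij_betw_same_card[of g' "{..<n + r + s}" "verts H"] by (simp add: realizes_def)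
    then have "verts H = {0..<n + r + s}" using assms(4) by simp
    from realizes_matrix[OF R' this] obtain A' where A': "A' \<in> sym_mats H" "spec A' = eigvals (n + r + s) d'"
      "spectrum A' = d' ` {..<n + r + s}" "SMP A'" "sp \<Longrightarrow> SSP A'" by metis
    have ext': "extends_spec sp r s M (spec A) (spec A')" using ext specA A'(2) by simp
    moreover have "mult_list A' = mlist (spec A')"
      by (simp add: mult_list_def mlist_def A'(2,3))
    ultimately show ?thesis
      using A' extends_spec_adds_ones[OF ext' ne] ml by auto
  qed
  show ?thesis
  proof (intro conjI impI allI)
    show "\<exists>A'\<in>sym_mats H. SMP A' \<and> adds_ones (r + s) s (mult_list A) (mult_list A')"
      using step[OF R(1), of "{}"] by blast
    fix M assume SSP: "SSP A" and M: "finite M \<and> card M = s \<and> M \<inter> spectrum A = {}"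
    obtain A' where A': "A' \<in> sym_mats H" "SMP A'" "SSP A'" "extends_spec True r s M (spec A) (spec A')"
      "adds_ones (r + s) s (mult_list A) (mult_list A')"
      using step[OF R(2)[OF SSP], of M] M spectrumA by auto
    have minmax: "lambda_min A = Min (set_mset (spec A))" "lambda_max A = Max (set_mset (spec A))"
      by (simp_all add: lambda_min_def lambda_max_def specA spectrumA)
    show "\<exists>A'\<in>sym_mats H.
          SMP A' \<and> adds_ones (r + s) s (mult_list A) (mult_list A') \<and>
          SSP A' \<and>
          spec A \<subseteq># spec A' \<and>
          (\<forall>x \<in># spec A' - spec A. count (spec A') x = 1) \<and>
          size {#x \<in># spec A' - spec A. lambda_min A < x \<and> x < lambda_max A#} \<le> s \<and>
          (\<forall>x \<in> M. x \<in># spec A' - spec A) \<and>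
          (\<forall>x \<in># spec A' - spec A. lambda_min A < x \<and> x < lambda_max A \<longrightarrow> x \<in> M)"
      using A' extends_spec_strong[OF A'(4) ne] unfolding minmax by (intro bexI[of _ A'] conjI)
  qed
qed

end
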